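(* Let $K/\mathbf{Q}$ be a finite Galois extension which is tamely ramified at each prime. Let $\{f_n(X)\}_{n\geq 0}$ be a $\mathbf{Z}$-basis of $\mathrm{Int}_{\mathbf{Q}}(\mathcal{O}_K)$ such that $\deg(f_n)=n$ for each $n\geq 0$. Then we can write \[f_n(X)=\frac{g_n(X)}{\prod_{p}p^{\omega_p(n)}}\] for some monic polynomial $g_n(X)$ in $\mathbf{Z}[X]$, where the product is over all prime numbers $p$ and $\omega_p(n)=\left\lfloor \frac{w_{q_p}(n)}{e_p}\right\rfloor$.
   Context: For a number field $K$, $\mathcal{O}_K$ denotes its ring of algebraic integers, and $\mathrm{Int}_{\mathbf{Q}}(\mathcal{O}_K):=\{f\in\mathbf{Q}[X] \mid f(\mathcal{O}_K)\subseteq\mathcal{O}_K\}$, regarded as a $\mathbf{Z}$-module. For $K/\mathbf{Q}$ Galois and a prime number $p$, $q_p$ denotes the cardinality of the residue field $\mathcal{O}_K/\mathfrak{p}$ of any prime ideal $\mathfrak{p}$ of $\mathcal{O}_K$ above $p$, and $e_p$ denotes the ramification index of $p$ in $\mathcal{O}_K$ (both are independent of the choice of $\mathfrak{p}$). Tamely ramified at each prime means $p\nmid e_p$ for every prime $p$. For each prime $p$ and integer $n\geq 0$, $w_{q_p}(n):=\sum_{j\geq 1}\left\lfloor \frac{n}{q_p^j}\right\rfloor$. For fixed $n$, one has $\omega_p(n)=0$ for all but finitely many $p$, so the product is finite.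
   Formalization: The formula is proved up to sign: f_n = ±g_n/∏p^{ω_p(n)} with g_n monic in Z[X]; as literally stated it fails for a basis element with negative leading coefficient (e.g. f_0 = -1), and the sign is + exactly when the leading coefficient of f_n is positive. *)

theory Defs
  imports
    "HOL-Computational_Algebra.Computational_Algebra"
    "HOL-Algebra.Ideal_Product"
    "HOL-Algebra.QuotRing"
    "HOL-Algebra.Divisibility"
    "HOL-Algebra.Algebraic_Closure_Type"
begin

text \<open>
  A number field is a subfield \<open>K\<close>, of finite dimension over the rationals, of an arbitrary
  ambient field of characteristic 0. The case of an abstract field is \<open>K = UNIV\<close>.
\<close>

definition sub_ring_on :: "'a::field_char_0 set \<Rightarrow> 'a ring" where
  "sub_ring_on S = ring_of_type_algebra\<lparr>carrier := S\<rparr>"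

definition number_field :: "'a::field_char_0 set \<Rightarrow> bool" where
  "number_field K \<longleftrightarrow>
     subfield K ring_of_type_algebra \<and>
     (\<exists>B. finite B \<and> K = module.span (\<lambda>(q::rat) (x::'a). of_rat q * x) B)"

definition aut_over_Q :: "'a::field_char_0 set \<Rightarrow> ('a \<Rightarrow> 'a) set" where
  "aut_over_Q K =
     {\<sigma> \<in> ring_iso (sub_ring_on K) (sub_ring_on K). \<forall>q::rat. \<sigma> (of_rat q) = of_rat q}"

definition galois_over_Q :: "'a::field_char_0 set \<Rightarrow> bool" where
  "galois_over_Q K \<longleftrightarrow> {x \<in> K. \<forall>\<sigma>\<in>aut_over_Q K. \<sigma> x = x} = \<rat>"

definition ring_of_integers :: "'a::field_char_0 set \<Rightarrow> 'a set" where
  "ring_of_integers K = {x \<in> K. algebraic_int x}"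

definition OK :: "'a::field_char_0 set \<Rightarrow> 'a ring" where
  "OK K = sub_ring_on (ring_of_integers K)"

definition prime_ideal_above :: "'a::field_char_0 set \<Rightarrow> nat \<Rightarrow> 'a set \<Rightarrow> bool" where
  "prime_ideal_above K p P \<longleftrightarrow>
     primeideal P (OK K) \<and> P \<inter> \<int> = range (\<lambda>k::int. of_int (int p * k))"

definition residue_card :: "'a::field_char_0 set \<Rightarrow> 'a set \<Rightarrow> nat" where
  "residue_card K P = card (carrier (OK K Quot P))"

text \<open>
  The exponent of \<open>P\<close> in the factorisation of \<open>p \<O>\<^sub>K\<close> into prime ideals: the largest \<open>e\<close> such that
  \<open>P\<close> to the \<open>e\<close> divides \<open>p \<O>\<^sub>K\<close> in the monoid of ideals.
\<close>

definition ramification_index :: "'a::field_char_0 set \<Rightarrow> nat \<Rightarrow> 'a set \<Rightarrow> nat" where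
  "ramification_index K p P =
     (GREATEST e. (P [^]\<^bsub>ideals_set (OK K)\<^esub> e) divides\<^bsub>ideals_set (OK K)\<^esub>
                  (PIdl\<^bsub>OK K\<^esub> (of_nat p)))"

text \<open>
  For \<open>K\<close> Galois over the rationals the next two numbers do not depend on the prime ideal chosen.
\<close>

definition chosen_prime :: "'a::field_char_0 set \<Rightarrow> nat \<Rightarrow> 'a set" where
  "chosen_prime K p = (SOME P. prime_ideal_above K p P)"

definition q_at :: "'a::field_char_0 set \<Rightarrow> nat \<Rightarrow> nat" where
  "q_at K p = residue_card K (chosen_prime K p)"

definition e_at :: "'a::field_char_0 set \<Rightarrow> nat \<Rightarrow> nat" where
  "e_at K p = ramification_index K p (chosen_prime K p)"

definition tamely_ramified :: "'a::field_char_0 set \<Rightarrow> bool" where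
  "tamely_ramified K \<longleftrightarrow> (\<forall>p::nat. Factorial_Ring.prime p \<longrightarrow> \<not> p dvd e_at K p)"

text \<open>For \<open>q \<ge> 2\<close> only finitely many terms of the series are nonzero.\<close>

definition w :: "nat \<Rightarrow> nat \<Rightarrow> nat" where
  "w q n = (\<Sum>j. n div q ^ Suc j)"

definition \<omega> :: "'a::field_char_0 set \<Rightarrow> nat \<Rightarrow> nat \<Rightarrow> nat" where
  "\<omega> K p n = w (q_at K p) n div e_at K p"

text \<open>
  The product runs over the support only, since \<^const>\<open>prod\<close> over an infinite set is 1 by convention.
\<close>

definition denom :: "'a::field_char_0 set \<Rightarrow> nat \<Rightarrow> nat" where
  "denom K n = (\<Prod>p | Factorial_Ring.prime p \<and> \<omega> K p n \<noteq> 0. p ^ \<omega> K p n)"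

definition Int_Q :: "'a::field_char_0 set \<Rightarrow> rat poly set" where
  "Int_Q K =
     {f. \<forall>x\<in>ring_of_integers K. poly (map_poly of_rat f) x \<in> ring_of_integers K}"

definition Z_basis :: "(nat \<Rightarrow> rat poly) \<Rightarrow> rat poly set \<Rightarrow> bool" where
  "Z_basis f M \<longleftrightarrow>
     inj f \<and>
     \<not> module.dependent (\<lambda>k::int. smult (rat_of_int k)) (range f) \<and>
     module.span (\<lambda>k::int. smult (rat_of_int k)) (range f) = M"

end

theory Submission
  imports Defs "Jordan_Normal_Form.Char_Poly" "HOL-Algebra.Sylow"
begin

text \<open>
  Let \<open>P\<close> be a prime above \<open>p\<close> with valuation \<open>v\<close>, let \<open>q\<close> be the order of its residue field and 
  \<open>e = v p\<close>. For a sequence \<open>a\<^sub>0, a\<^sub>1, \<dots>\<close> of integers of \<open>K\<close> that is very well distributed modulo the 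
  powers of \<open>P\<close>, the polynomial \<open>h = (X - a\<^sub>0) \<cdots> (X - a\<^sub>n\<^sub>-\<^sub>1)\<close> takes values of valuation at least 
  \<open>w q n\<close> on the integers of \<open>K\<close>, with equality at \<open>a\<^sub>n\<close>. By Newton interpolation, the coefficients of an 
  integer-valued polynomial of degree \<open>n\<close> have valuation at least \<open>- w q n\<close>; if they are rational, 
  then \<open>p\<close> occurs in their denominators with exponent at most \<open>w q n div e\<close>. 

  This exponent is attained by a leading coefficient: choose \<open>c\<close> outside \<open>P\<close> such that \<open>c h\<close> takes values 
  divisible by \<open>p\<^sup>\<omega>\<close>, and apply the trace of \<open>K\<close> to the coefficients of \<open>\<beta> c h / p\<^sup>\<omega>\<close>. The result has 
  leading coefficient \<open>Tr (\<beta> c) / p\<^sup>\<omega>\<close>. If \<open>Tr (\<beta> c)\<close> were divisible by \<open>p\<close> for all \<open>\<beta>\<close>, then independence of 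
  characters modulo \<open>P\<close> would make the order of the inertia group divisible by \<open>p\<close>, which tame 
  ramification excludes. Hence the coefficients of \<open>X\<^sup>n\<close> of the integer-valued polynomials of degree at most 
  \<open>n\<close> generate the group \<open>(1 / denom n) \<int>\<close>, and the leading coefficient of \<open>f\<^sub>n\<close> is a generator.
\<close>

subsection \<open>Algebraic integers\<close>

text \<open>Everything local rests on one finiteness fact: \<open>\<O>/p\<O>\<close> is finite,
  because \<open>K\<close> has finite dimension. By pigeonhole it makes \<open>\<O>/P\<close> a
  field and the localised \<open>P\<close> nilpotent modulo \<open>p\<close>, and it supplies a
  fractional inverse of \<open>P\<close>, hence a uniformizer and a valuation.

  Two obstacles separate the Newton polynomial \<open>h\<close> from a rational integer-valued
  polynomial with the same denominator. It is adapted to a single prime \<open>P\<close>, whereas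
  the other primes above \<open>p\<close> also restrict division by \<open>p\<close>; the factor
  \<open>c\<close> absorbs them. Its coefficients lie in \<open>K\<close>; the trace brings them
  down to the rationals, but it could destroy the leading coefficient. The free factor
  \<open>\<beta>\<close> is there to prevent this.

  The trace argument sees the order of the inertia group, tameness speaks of \<open>e\<close>. The
  link is an automorphism group \<open>H\<close> of order \<open>p\<close> inside inertia: if
  \<open>p\<close> did not divide \<open>e\<close>, the field fixed by \<open>H\<close> would
  contain a uniformizer and represent all residues, which leaves \<open>H\<close> nothing to
  move.\<close>

interpretation zmod: Modules.module "\<lambda>k::int. (*) (of_int k :: 'a :: field_char_0)"
  by unfold_locales (auto simp: algebra_simps)

text \<open>Multiplication by \<open>z\<close> on the generators is given by an integer matrix, and
  the vector of generators is an eigenvector for \<open>z\<close>, nonzero because of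
  \<open>s0\<close>. So \<open>z\<close> is a root of a monic integer characteristic
  polynomial.\<close>

lemma algebraic_int_if_stable_span:
  fixes z :: "'a :: field_char_0"
  assumes "finite S" "s0 \<in> S" "s0 \<noteq> 0"
    and "\<And>s. s \<in> S \<Longrightarrow> z * s \<in> zmod.span S"
  shows "algebraic_int z"
proof -
  obtain xs where xs: "set xs = S" "distinct xs"
    using finite_distinct_list[OF assms(1)] by blast
  define n where "n = length xs"
  have "\<forall>s\<in>S. \<exists>u. z * s = (\<Sum>v\<in>S. of_int (u v) * v)"
    using assms(4) zmod.span_finite[OF assms(1)] by blast
  then obtain U where U: "\<And>s. s \<in> S \<Longrightarrow> z * s = (\<Sum>v\<in>S. of_int (U s v) * v)"
    by metis
  define A where "A = Matrix.mat n n (\<lambda>(i,j). U (xs ! i) (xs ! j))"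
  define B :: "'a Matrix.mat" where "B = map_mat of_int A"
  define v where "v = Matrix.vec n (\<lambda>i. xs ! i)"
  have A: "A \<in> carrier_mat n n" and B: "B \<in> carrier_mat n n" and v: "v \<in> carrier_vec n"
    by (auto simp: A_def B_def v_def)
  have "B *\<^sub>v v = z \<cdot>\<^sub>v v"
  proof (rule eq_vecI)
    fix i assume "i < dim_vec (z \<cdot>\<^sub>v v)"
    hence i: "i < n" by (simp add: v_def)
    have "(B *\<^sub>v v) $ i = (\<Sum>j<n. of_int (U (xs ! i) (xs ! j)) * xs ! j)"
      using i by (simp add: A_def B_def v_def scalar_prod_def atLeast0LessThan)
    also have "\<dots> = (\<Sum>v\<in>S. of_int (U (xs ! i) v) * v)"
      by (rule sum.reindex_bij_betw) (use xs n_def bij_betw_nth in auto)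
    also have "\<dots> = z * xs ! i"
      using U[of "xs ! i"] i xs n_def by auto
    finally show "(B *\<^sub>v v) $ i = (z \<cdot>\<^sub>v v) $ i" using i by (simp add: v_def)
  qed (auto simp: B_def v_def A_def)
  moreover have "v \<noteq> 0\<^sub>v n"
  proof
    assume *: "v = 0\<^sub>v n"
    obtain i where "i < n" "xs ! i = s0" using assms(2) xs n_def by (metis in_set_conv_nth)
    thus False using arg_cong[OF *, of "\<lambda>v. vec_index v i"] assms(3) by (simp add: v_def)
  qed
  ultimately have "eigenvalue B z"
    using B v unfolding eigenvalue_def eigenvector_def by auto
  hence "poly (char_poly B) z = 0" using eigenvalue_root_char_poly[OF B] by simp
  moreover have "char_poly B = map_poly of_int (char_poly A)"
    unfolding B_def by (rule of_int_hom.char_poly_hom[OF A])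
  moreover have "lead_coeff (char_poly A) = 1"
    using degree_monic_char_poly[OF A] by auto
  ultimately show ?thesis unfolding algebraic_int_altdef_ipoly by metis
qed

text \<open>The generators are the powers of \<open>x\<close> below the degree of an integral
  equation. With the previous lemma this describes integrality by finitely generated modules, which
  can be combined for sums and products.\<close>

lemma algebraic_int_stable_span:
  fixes x :: "'a :: field_char_0"
  assumes "algebraic_int x"
  obtains S where "finite S" "1 \<in> S" "\<And>s. s \<in> S \<Longrightarrow> x * s \<in> zmod.span S"
proof -
  obtain p where p: "lead_coeff p = 1" "\<forall>i. coeff p i \<in> \<int>" "poly p x = 0"
    using assms by (auto simp: algebraic_int.simps)
  define n where "n = degree p"
  have "n \<noteq> 0" using p n_def by (metis degree_eq_zeroE lead_coeff_pCons(2) mult_zero_right add.right_neutral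
      poly_0 poly_pCons pCons_0_0 zero_neq_one)
  define S where "S = (\<lambda>i. x ^ i) ` {..<n}"
  have "x * s \<in> zmod.span S" if s: "s \<in> S" for s
  proof -
    obtain i where i: "i < n" "s = x ^ i" using s S_def by auto
    show ?thesis
    proof (cases "Suc i < n")
      case True
      then show ?thesis using i by (intro zmod.span_base) (auto simp: S_def simp flip: power_Suc)
    next
      case False
      hence "n = Suc i" using i by simp
      have "x ^ n = - (\<Sum>j<n. coeff p j * x ^ j)"
      proof -
        have "0 = (\<Sum>j\<le>n. coeff p j * x ^ j)" using p(3) by (simp add: poly_altdef n_def)
        also have "\<dots> = (\<Sum>j<n. coeff p j * x ^ j) + x ^ n"
          using p(1) by (simp add: n_def flip: lessThan_Suc_atMost)
        finally show ?thesis by (metis add.inverse_unique add.commute)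
      qed
      moreover have "coeff p j * x ^ j \<in> zmod.span S" if "j < n" for j
      proof -
        obtain k where "coeff p j = of_int k" using p(2) by (metis Ints_cases)
        moreover have "x ^ j \<in> zmod.span S" using that by (intro zmod.span_base) (auto simp: S_def)
        ultimately show ?thesis using zmod.span_scale by metis
      qed
      ultimately have "x ^ n \<in> zmod.span S"
        by (auto intro!: zmod.span_neg zmod.span_sum)
      thus ?thesis using i \<open>n = Suc i\<close> by simp
    qed
  qed
  moreover have "finite S" "1 \<in> S"
    using \<open>n \<noteq> 0\<close> unfolding S_def by (auto intro!: image_eqI[of _ _ 0])
  ultimately show ?thesis using that by blast
qed

lemma zspan_mult:
  fixes t :: "'a :: field_char_0"
  assumes "x \<in> zmod.span S" "\<And>s. s \<in> S \<Longrightarrow> s * t \<in> zmod.span T"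
  shows "x * t \<in> zmod.span T"
  using assms(1)
proof (induction rule: zmod.span_induct_alt)
  case base
  show ?case using zmod.span_zero by simp
next
  case (step c x y)
  then show ?case using assms(2)[of x] 
    by (simp add: distrib_right mult.assoc zmod.span_add zmod.span_scale)
qed

text \<open>Pairwise products of generators for \<open>x\<close> and for \<open>y\<close> generate a
  module stable under both.\<close>

lemma algebraic_int_add_mult:
  fixes x y :: "'a :: field_char_0"
  assumes "algebraic_int x" "algebraic_int y"
  shows "algebraic_int (x + y)" "algebraic_int (x * y)"
proof -
  obtain S where S: "finite S" "1 \<in> S" "\<And>s. s \<in> S \<Longrightarrow> x * s \<in> zmod.span S"
    using algebraic_int_stable_span[OF assms(1)] by blast
  obtain T where T: "finite T" "1 \<in> T" "\<And>s. s \<in> T \<Longrightarrow> y * s \<in> zmod.span T"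
    using algebraic_int_stable_span[OF assms(2)] by blast
  define U where "U = (\<lambda>(s,t). s * t) ` (S \<times> T)"
  have U: "finite U" "1 \<in> U" using S T by (auto simp: U_def intro!: image_eqI[of _ _ "(1,1)"])
  have inU: "s * t \<in> zmod.span U" if "s \<in> S" "t \<in> T" for s t
    using that by (intro zmod.span_base) (auto simp: U_def)
  have xU: "x * r \<in> zmod.span U" if r: "r \<in> U" for r
  proof -
    obtain s t where st: "s \<in> S" "t \<in> T" "r = s * t" using r U_def by auto
    have "(x * s) * t \<in> zmod.span U" by (rule zspan_mult[OF S(3)[OF st(1)]]) (use inU st in auto)
    thus ?thesis by (simp add: st mult_ac)
  qed
  have yU: "y * r \<in> zmod.span U" if r: "r \<in> U" for r
  proof -
    obtain s t where st: "s \<in> S" "t \<in> T" "r = s * t" using r U_def by auto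
    have "(y * t) * s \<in> zmod.span U" 
      by (rule zspan_mult[OF T(3)[OF st(2)]]) (subst mult.commute, rule inU[OF st(1)])
    thus ?thesis by (simp add: st mult_ac)
  qed
  show "algebraic_int (x + y)"
    by (rule algebraic_int_if_stable_span[OF U]) (auto simp: distrib_right intro: zmod.span_add xU yU)
  show "algebraic_int (x * y)"
  proof (rule algebraic_int_if_stable_span[OF U])
    fix r assume "r \<in> U"
    have "(y * r) * x \<in> zmod.span U"
      by (rule zspan_mult[OF yU[OF \<open>r \<in> U\<close>]]) (subst mult.commute, rule xU)
    thus "x * y * r \<in> zmod.span U" by (simp add: mult_ac)
  qed simp
qed

text \<open>A case of transitivity of integrality: \<open>z\<close> satisfies
  \<open>Z^j - Z^i - c = 0\<close>, which is monic with integral \<open>c\<close>. It turns a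
  coincidence between powers of \<open>z\<close> into integrality of \<open>z\<close>.\<close>

lemma algebraic_int_if_power_diff:
  fixes z :: "'a :: field_char_0"
  assumes "i < j" "algebraic_int (z ^ j - z ^ i)"
  shows "algebraic_int z"
proof -
  define c where "c = z ^ j - z ^ i"
  obtain S where S: "finite S" "1 \<in> S" "\<And>s. s \<in> S \<Longrightarrow> c * s \<in> zmod.span S"
    using algebraic_int_stable_span assms(2) c_def by metis
  define U where "U = (\<lambda>(s,k). s * z ^ k) ` (S \<times> {..<j})"
  have U: "finite U" "1 \<in> U" using S assms by (auto simp: U_def intro!: image_eqI[of _ _ "(1,0)"])
  have inU: "s * z ^ k \<in> zmod.span U" if "s \<in> S" "k < j" for s k
    using that by (intro zmod.span_base) (auto simp: U_def)
  show ?thesis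
  proof (rule algebraic_int_if_stable_span[OF U])
    fix r assume "r \<in> U"
    then obtain s k where sk: "s \<in> S" "k < j" "r = s * z ^ k" by (auto simp: U_def)
    show "z * r \<in> zmod.span U"
    proof (cases "Suc k < j")
      case True
      then show ?thesis using inU[OF sk(1) True] by (simp add: sk mult_ac)
    next
      case False
      hence "j = Suc k" using sk by simp
      hence "z * r = s * z ^ i + c * s * 1" by (simp add: sk c_def algebra_simps)
      moreover have "c * s * 1 \<in> zmod.span U"
        by (rule zspan_mult[OF S(3)[OF sk(1)]]) (use inU[of _ 0] assms in auto)
      ultimately show ?thesis using inU[OF sk(1) assms(1)] by (simp add: zmod.span_add)
    qed
  qed simp
qed

subsection \<open>The ring of integers of a number field\<close>

lemma common_denom:
  assumes "finite S"
  obtains m :: int where "m > 0" "\<And>s. s \<in> S \<Longrightarrow> \<exists>k. of_int m * (u s :: rat) = of_int k"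
proof -
  have "\<exists>m::int > 0. \<forall>s\<in>S. \<exists>k. of_int m * (u s :: rat) = of_int k"
    using assms
  proof (induction S)
    case empty
    then show ?case by (intro exI[of _ 1]) auto
  next
    case (insert x S)
    then obtain m where m: "m > 0" "\<forall>s\<in>S. \<exists>k. of_int m * (u s :: rat) = of_int k" by blast
    obtain a b where ab: "b > 0" "u x = of_int a / of_int b"
      by (metis quotient_of_div quotient_of_denom_pos prod.collapse)
    have "\<forall>s\<in>insert x S. \<exists>k. of_int (b * m) * u s = of_int k"
    proof
      fix s assume "s \<in> insert x S"
      then consider "s = x" | "s \<in> S" by blast
      then show "\<exists>k. of_int (b * m) * u s = of_int k"
      proof cases
        case 1
        then show ?thesis using ab by (intro exI[of _ "m * a"]) simp
      next
        case 2
        then obtain k where "of_int m * u s = of_int k" using m by blast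
        then show ?thesis by (intro exI[of _ "b * k"]) (simp add: mult.assoc)
      qed
    qed
    thus ?case using ab m by (intro exI[of _ "b * m"]) auto
  qed
  thus ?thesis using that by blast
qed

locale number_field_on =
  fixes K :: "'a :: field_char_0 set"
  assumes number_field: "number_field K"
begin

abbreviation \<O> where "\<O> \<equiv> ring_of_integers K"

lemma K_subring: "Subrings.subring K ring_of_type_algebra"
proof -
  have "subfield K ring_of_type_algebra" using number_field by (simp add: number_field_def)
  then show ?thesis
    unfolding subfield_def subdomain_def subcring_def by blast
qed

lemma K_0: "0 \<in> K" and K_1: "1 \<in> K"
  and K_add: "x \<in> K \<Longrightarrow> y \<in> K \<Longrightarrow> x + y \<in> K"
  and K_mult: "x \<in> K \<Longrightarrow> y \<in> K \<Longrightarrow> x * y \<in> K"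
  and K_uminus: "x \<in> K \<Longrightarrow> - x \<in> K"
proof -
  interpret R: ring "ring_of_type_algebra :: 'a ring" by (rule ring_from_type_algebra)
  note E = subringE[OF K_subring]
  show "0 \<in> K" "1 \<in> K" using E(2,3) by (auto simp: ring_of_type_algebra_def)
  show "x \<in> K \<Longrightarrow> y \<in> K \<Longrightarrow> x + y \<in> K" "x \<in> K \<Longrightarrow> y \<in> K \<Longrightarrow> x * y \<in> K"
    using E(6,7)[of x y] by (auto simp: ring_of_type_algebra_def)
  assume "x \<in> K"
  hence "\<ominus>\<^bsub>ring_of_type_algebra\<^esub> x \<in> K" using E(5) by blast
  moreover have "\<ominus>\<^bsub>ring_of_type_algebra\<^esub> x = - x"
    by (rule R.minus_equality) (auto simp: ring_of_type_algebra_def)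
  ultimately show "- x \<in> K" by simp
qed

lemma K_inverse: "x \<in> K \<Longrightarrow> inverse x \<in> K"
proof (cases "x = 0")
  case False
  assume "x \<in> K"
  have "subfield K ring_of_type_algebra" using number_field by (simp add: number_field_def)
  from subfield.subfield_Units[OF this]
  have "Units (ring_of_type_algebra \<lparr>carrier := K\<rparr>) = K - {0}" 
    by (simp add: ring_of_type_algebra_def)
  hence "x \<in> Units (ring_of_type_algebra \<lparr>carrier := K\<rparr>)" using False \<open>x \<in> K\<close> by auto
  then obtain y where "y \<in> K" "y * x = 1"
    by (auto simp: Units_def ring_of_type_algebra_def)
  thus ?thesis using False by (metis inverse_unique mult.commute)
qed (simp add: K_0)

lemma K_diff: "x \<in> K \<Longrightarrow> y \<in> K \<Longrightarrow> x - y \<in> K"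
  using K_add[of x "-y"] K_uminus by simp

lemma K_divide: "x \<in> K \<Longrightarrow> y \<in> K \<Longrightarrow> x / y \<in> K"
  by (simp add: divide_inverse K_mult K_inverse)

lemma K_of_nat: "of_nat n \<in> K"
  by (induction n) (auto simp: K_0 K_1 K_add)

lemma K_of_int: "of_int n \<in> K"
  by (cases n rule: int_cases2) (auto simp: K_of_nat K_uminus)

lemma K_of_rat: "of_rat q \<in> K"
  by (cases q) (auto simp: of_rat_rat K_divide K_of_int)

lemma K_power: "x \<in> K \<Longrightarrow> x ^ n \<in> K"
  by (induction n) (auto simp: K_1 K_mult)

lemma K_power_int: "x \<in> K \<Longrightarrow> x powi n \<in> K"
  by (auto simp: power_int_def K_power K_inverse)

lemma K_sum: "(\<And>i. i \<in> A \<Longrightarrow> f i \<in> K) \<Longrightarrow> sum f A \<in> K"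
  by (induction A rule: infinite_finite_induct) (auto simp: K_0 K_add)

lemma K_prod: "(\<And>i. i \<in> A \<Longrightarrow> f i \<in> K) \<Longrightarrow> prod f A \<in> K"
  by (induction A rule: infinite_finite_induct) (auto simp: K_1 K_mult)

lemma O_iff: "x \<in> \<O> \<longleftrightarrow> x \<in> K \<and> algebraic_int x"
  by (simp add: ring_of_integers_def)

lemma O_K: "x \<in> \<O> \<Longrightarrow> x \<in> K"
  by (simp add: O_iff)

lemma O_0: "0 \<in> \<O>" and O_1: "1 \<in> \<O>" and O_of_int: "of_int n \<in> \<O>" and O_of_nat: "of_nat m \<in> \<O>"
  using K_of_int[of n] K_of_nat[of m] by (auto simp: O_iff K_0 K_1 intro!: int_imp_algebraic_int)

lemma O_add: "x \<in> \<O> \<Longrightarrow> y \<in> \<O> \<Longrightarrow> x + y \<in> \<O>"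
  and O_mult: "x \<in> \<O> \<Longrightarrow> y \<in> \<O> \<Longrightarrow> x * y \<in> \<O>"
  and O_uminus: "x \<in> \<O> \<Longrightarrow> - x \<in> \<O>"
  by (auto simp: O_iff K_add K_mult K_uminus algebraic_int_add_mult)

lemma O_diff: "x \<in> \<O> \<Longrightarrow> y \<in> \<O> \<Longrightarrow> x - y \<in> \<O>"
  using O_add[of x "-y"] O_uminus by simp

lemma O_power: "x \<in> \<O> \<Longrightarrow> x ^ n \<in> \<O>"
  by (induction n) (auto simp: O_1 O_mult)

lemma O_sum: "(\<And>i. i \<in> A \<Longrightarrow> f i \<in> \<O>) \<Longrightarrow> sum f A \<in> \<O>"
  by (induction A rule: infinite_finite_induct) (auto simp: O_0 O_add)

lemma O_prod: "(\<And>i. i \<in> A \<Longrightarrow> f i \<in> \<O>) \<Longrightarrow> prod f A \<in> \<O>"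
  by (induction A rule: infinite_finite_induct) (auto simp: O_1 O_mult)

lemma O_Rats: "x \<in> \<O> \<Longrightarrow> x \<in> \<rat> \<Longrightarrow> x \<in> \<int>"
  by (auto simp: O_iff rational_algebraic_int_is_int)

sublocale qvec: vector_space "\<lambda>(q::rat) (x::'a). of_rat q * x"
  by unfold_locales (auto simp: algebra_simps of_rat_add of_rat_mult)

lemma K_basis: obtains B where "finite B" "K = qvec.span B"
  using number_field by (auto simp: number_field_def)

text \<open>Multiplication by \<open>x\<close> on a finite rational spanning set \<open>B\<close>
  has a rational matrix. If \<open>m\<close> clears its denominators, \<open>m x\<close> stabilises
  the additive group generated by \<open>B\<close>.\<close>

lemma K_denominator:
  assumes "x \<in> K"
  obtains m :: int where "m > 0" "of_int m * x \<in> \<O>"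
proof -
  obtain B where B: "finite B" "K = qvec.span B" by (rule K_basis)
  have "\<exists>b\<in>B. b \<noteq> 0"
  proof (rule ccontr)
    assume "\<not> ?thesis"
    hence "B \<subseteq> {0}" by auto
    hence "K \<subseteq> {0}" using B qvec.span_mono[of B "{0}"] by (auto simp: qvec.span_insert_0)
    thus False using K_1 by auto
  qed
  then obtain b0 where b0: "b0 \<in> B" "b0 \<noteq> 0" by blast
  have "\<forall>b\<in>B. \<exists>u. x * b = (\<Sum>v\<in>B. of_rat (u v) * v)"
  proof
    fix b assume "b \<in> B"
    hence "x * b \<in> qvec.span B" using K_mult[OF assms] B qvec.span_base by blast
    thus "\<exists>u. x * b = (\<Sum>v\<in>B. of_rat (u v) * v)" using qvec.span_finite[OF B(1)] by auto
  qed
  then obtain U where U: "\<And>b. b \<in> B \<Longrightarrow> x * b = (\<Sum>v\<in>B. of_rat (U b v) * v)" by metis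
  obtain m :: int where m: "m > 0" 
    "\<And>s. s \<in> B \<times> B \<Longrightarrow> \<exists>k. of_int m * case_prod U s = of_int k"
    by (rule common_denom[of "B \<times> B" "case_prod U"]) (use B in auto)
  have "algebraic_int (of_int m * x)"
  proof (rule algebraic_int_if_stable_span[OF B(1) b0])
    fix b assume b: "b \<in> B"
    have "of_int m * x * b = (\<Sum>v\<in>B. of_rat (of_int m * U b v) * v)"
      by (simp add: U[OF b] mult.assoc sum_distrib_left of_rat_mult)
    also have "\<dots> \<in> zmod.span B"
    proof (rule zmod.span_sum)
      fix v assume v: "v \<in> B"
      obtain k where "of_int m * U b v = of_int k" using m(2)[of "(b,v)"] b v by auto
      thus "of_rat (of_int m * U b v) * v \<in> zmod.span B"
        using zmod.span_scale[OF zmod.span_base[OF v], of k] by simp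
    qed
    finally show "of_int m * x * b \<in> zmod.span B" .
  qed
  hence "of_int m * x \<in> \<O>" using assms by (auto simp: O_iff K_mult K_of_int)
  thus ?thesis using that m(1) by blast
qed

text \<open>Assumption \<open>ind\<close> is linear independence in \<open>\<O>/p\<O>\<close> over
  the field with \<open>p\<close> elements. A rational relation is scaled to integers and divided by
  the gcd of its coefficients; read with right side \<open>p * 0\<close>, it has all coefficients
  divisible by \<open>p\<close>, against the choice of the gcd.\<close>

lemma independent_mod_prime_imp_independent:
  assumes p: "Factorial_Ring.prime (p::nat)" and S: "S \<subseteq> \<O>"
    and ind: "\<And>t c. finite t \<Longrightarrow> t \<subseteq> S \<Longrightarrow> (\<exists>z\<in>\<O>. (\<Sum>s\<in>t. of_int (c s) * s) = of_nat p * z) \<Longrightarrow>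
                (\<forall>s\<in>t. int p dvd c s)"
  shows "qvec.independent S"
proof
  assume "qvec.dependent S"
  then obtain t u v where t: "finite t" "t \<subseteq> S" "(\<Sum>v\<in>t. of_rat (u v) * v) = 0" "v \<in> t" "u v \<noteq> 0"
    unfolding qvec.dependent_explicit by blast
  obtain m :: int where m: "m > 0" "\<And>s. s \<in> t \<Longrightarrow> \<exists>k. of_int m * u s = of_int k"
    by (rule common_denom[of t u]) (use t in auto)
  then obtain c where c: "\<And>s. s \<in> t \<Longrightarrow> of_int m * u s = of_int (c s)" by metis
  have "c v \<noteq> 0" using c[OF t(4)] t(5) m(1) by auto
  define g where "g = Gcd (c ` t)"
  have g: "g \<noteq> 0" using \<open>c v \<noteq> 0\<close> t(4) by (auto simp: g_def)
  have gd: "c s = g * (c s div g)" if "s \<in> t" for s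
  proof -
    have "g dvd c s" using that by (auto simp: g_def)
    thus ?thesis by simp
  qed
  have "0 = of_int m * (\<Sum>v\<in>t. of_rat (u v) * v)" using t by simp
  also have "\<dots> = (\<Sum>v\<in>t. of_rat (of_int m * u v) * v)" 
    by (simp add: sum_distrib_left of_rat_mult mult.assoc)
  also have "\<dots> = (\<Sum>v\<in>t. of_int (g * (c v div g)) * v)" 
  proof (intro sum.cong refl)
    fix v assume v: "v \<in> t"
    show "of_rat (of_int m * u v) * v = of_int (g * (c v div g)) * v"
      by (simp only: c[OF v] of_rat_of_int_eq gd[OF v, symmetric])
  qed
  also have "\<dots> = of_int g * (\<Sum>v\<in>t. of_int (c v div g) * v)" 
    by (simp only: sum_distrib_left of_int_mult mult.assoc)
  finally have "(\<Sum>v\<in>t. of_int (c v div g) * v) = of_nat p * 0" using g by simp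
  with O_0 have "\<exists>z\<in>\<O>. (\<Sum>v\<in>t. of_int (c v div g) * v) = of_nat p * z" by blast
  hence *: "\<forall>s\<in>t. int p dvd c s div g" by (rule ind[OF t(1,2)])
  have "g * int p dvd g" unfolding g_def
  proof (intro Gcd_greatest, elim imageE)
    fix x s assume s: "x = c s" "s \<in> t"
    have "g * int p dvd g * (c s div g)" using * s(2) by (intro mult_dvd_mono) auto
    thus "Gcd (c ` t) * int p dvd x" by (simp only: s(1) g_def[symmetric] gd[OF s(2), symmetric])
  qed
  hence "int p dvd 1" using g by (metis dvd_mult_cancel_left mult.right_neutral)
  thus False using p by (simp add: prime_nat_iff)
qed

text \<open>The previous lemma bounds the size of independent sets in \<open>\<O>/p\<O>\<close> by
  \<open>card B\<close>. A largest one spans, so its combinations with coefficients below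
  \<open>p\<close> represent all classes.\<close>

lemma O_finite_mod_prime:
  assumes p: "Factorial_Ring.prime (p::nat)"
  obtains T where "finite T" "T \<subseteq> \<O>" "\<And>y. y \<in> \<O> \<Longrightarrow> \<exists>t\<in>T. \<exists>z\<in>\<O>. y = t + of_nat p * z"
proof -
  define ind where "ind S \<longleftrightarrow> S \<subseteq> \<O> \<and> (\<forall>t c. finite t \<longrightarrow> t \<subseteq> S \<longrightarrow> (\<exists>z\<in>\<O>. (\<Sum>s\<in>t. of_int (c s) * s) = of_nat p * z) \<longrightarrow>
                (\<forall>s\<in>t. int p dvd c s))" for S
  obtain B where B: "finite B" "K = qvec.span B" by (rule K_basis)
  have bound: "finite S \<and> card S \<le> card B" if "ind S" for S
  proof -
    have "qvec.independent S"
      by (rule independent_mod_prime_imp_independent[OF p]) (use that in \<open>auto simp: ind_def\<close>)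
    moreover have "S \<subseteq> qvec.span B" using that B O_K by (auto simp: ind_def)
    ultimately show ?thesis using qvec.independent_span_bound B(1) by blast
  qed
  have "ind {}" by (auto simp: ind_def)
  moreover have "\<forall>S. ind S \<longrightarrow> card S < Suc (card B)" using bound by (simp add: less_Suc_eq_le)
  ultimately have "\<exists>S. ind S \<and> (\<forall>S'. ind S' \<longrightarrow> card S' \<le> card S)" by (rule ex_has_greatest_nat)
  then obtain S where S: "ind S" "\<And>S'. ind S' \<Longrightarrow> card S' \<le> card S" by blast
  have fin: "finite S" using bound[OF S(1)] by blast
  have SO: "S \<subseteq> \<O>" using S(1) unfolding ind_def by blast
  define T where "T = (\<lambda>c. \<Sum>s\<in>S. of_int (c s) * s) ` (S \<rightarrow>\<^sub>E {0..<int p})"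
  have "finite T" using fin by (auto simp: T_def intro!: finite_PiE)
  moreover have "T \<subseteq> \<O>" using SO by (auto simp: T_def intro!: O_sum O_mult O_of_int)
  moreover have "\<exists>t\<in>T. \<exists>z\<in>\<O>. y = t + of_nat p * z" if y: "y \<in> \<O>" for y
  proof -
    have "\<exists>c. \<exists>z\<in>\<O>. y = (\<Sum>s\<in>S. of_int (c s) * s) + of_nat p * z"
    proof (cases "y \<in> S")
      case True
      have "(\<Sum>s\<in>S. of_int (if s = y then 1 else 0) * s) = (\<Sum>s\<in>S. if s = y then s else 0)"
        by (intro sum.cong) auto
      also have "\<dots> = y" using True fin by simp
      finally show ?thesis 
        by (intro exI[of _ "\<lambda>s. if s = y then 1 else 0"] bexI[of _ 0]) (auto simp: O_0)
    next
      case False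
      have "insert y S \<subseteq> \<O>" using SO y by blast
      moreover have "\<not> ind (insert y S)" using S(2)[of "insert y S"] False fin by auto
      ultimately have "\<exists>t c. finite t \<and> t \<subseteq> insert y S \<and> (\<exists>z\<in>\<O>. (\<Sum>s\<in>t. of_int (c s) * s) = of_nat p * z) \<and>
          \<not> (\<forall>s\<in>t. int p dvd c s)" unfolding ind_def by meson
      then obtain t c z where t: "finite t" "t \<subseteq> insert y S" "z \<in> \<O>" 
          "(\<Sum>s\<in>t. of_int (c s) * s) = of_nat p * z" "\<not> (\<forall>s\<in>t. int p dvd c s)"
        by blast
      define d where "d s = (if s \<in> t then c s else 0)" for s
      have "(\<Sum>s\<in>t. of_int (c s) * s) = (\<Sum>s\<in>insert y S. of_int (d s) * s)"
        using fin t by (intro sum.mono_neutral_cong_left) (auto simp: d_def)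
      hence eq: "of_int (d y) * y + (\<Sum>s\<in>S. of_int (d s) * s) = of_nat p * z"
        using t(4) False fin by simp
      \<comment> \<open>Maximality of \<open>S\<close> gave a relation on \<open>insert y S\<close>
        that is nontrivial modulo \<open>p\<close>. With the coefficient of \<open>y\<close>
        divisible by \<open>p\<close> it would become one on \<open>S\<close>; hence that
        coefficient is invertible modulo \<open>p\<close> and the relation can be solved for
        \<open>y\<close>.\<close>
      have nd: "\<not> int p dvd d y"
      proof
        assume "int p dvd d y"
        then obtain k where k: "d y = int p * k" by blast
        have "(\<Sum>s\<in>S. of_int (d s) * s) = of_nat p * (z - of_int k * y)"
          using eq by (simp add: k algebra_simps)
        moreover have "z - of_int k * y \<in> \<O>" using t y by (intro O_diff O_mult O_of_int)
        ultimately have "\<forall>s\<in>S. int p dvd d s" using S(1) fin unfolding ind_def by blast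
        hence "\<forall>s\<in>t. int p dvd c s" using \<open>int p dvd d y\<close> t(2) by (force simp: d_def split: if_splits)
        thus False using t by blast
      qed
      have "Rings.coprime (int p) (d y)" using p nd
        by (intro prime_imp_coprime) auto
      hence "gcd (d y) (int p) = 1" by (simp add: coprime_iff_gcd_eq_1 gcd.commute)
      then obtain e l' where "e * d y + l' * int p = 1" using bezout_int[of "d y" "int p"] by metis
      then obtain l where l: "d y * e = 1 + int p * l" 
        using that[of "- l'"] by (simp add: algebra_simps)
      have "y = of_int (d y * e) * y - of_nat p * of_int l * y"
        unfolding l by (simp add: algebra_simps)
      also have "of_int (d y * e) * y = of_int e * (of_nat p * z - (\<Sum>s\<in>S. of_int (d s) * s))"
        unfolding eq[symmetric] by (simp add: algebra_simps)
      also have "\<dots> - of_nat p * of_int l * y = 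
           (\<Sum>s\<in>S. of_int (- e * d s) * s) + of_nat p * (of_int e * z - of_int l * y)"
        by (simp add: algebra_simps sum_distrib_left sum_negf)
      finally have "y = (\<Sum>s\<in>S. of_int (- e * d s) * s) + of_nat p * (of_int e * z - of_int l * y)" .
      moreover have "of_int e * z - of_int l * y \<in> \<O>" using t y by (intro O_diff O_mult O_of_int)
      ultimately show ?thesis by (intro exI[of _ "\<lambda>s. - e * d s"] bexI)
    qed
    then obtain c z where cz: "z \<in> \<O>" "y = (\<Sum>s\<in>S. of_int (c s) * s) + of_nat p * z" by blast
    define t where "t = (\<Sum>s\<in>S. of_int (c s mod int p) * s)"
    have "t \<in> T" unfolding T_def t_def
      by (rule image_eqI[of _ _ "restrict (\<lambda>s. c s mod int p) S"])
         (use p in \<open>auto simp: prime_gt_0_nat\<close>)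
    moreover have "y = t + of_nat p * (z + (\<Sum>s\<in>S. of_int (c s div int p) * s))"
    proof -
      have "(\<Sum>s\<in>S. of_int (c s) * s) = (\<Sum>s\<in>S. of_int (c s mod int p + int p * (c s div int p)) * s)"
        by simp
      also have "\<dots> = t + of_nat p * (\<Sum>s\<in>S. of_int (c s div int p) * s)"
        unfolding of_int_add of_int_mult t_def
        by (simp add: algebra_simps sum.distrib sum_distrib_left)
      finally show ?thesis using cz by (simp add: algebra_simps)
    qed
    moreover have "z + (\<Sum>s\<in>S. of_int (c s div int p) * s) \<in> \<O>"
      using cz SO by (intro O_add O_sum O_mult O_of_int) auto
    ultimately show ?thesis by blast
  qed
  ultimately show ?thesis using that by blast
qed

lemma O_finite_mod_prime_power:
  assumes p: "Factorial_Ring.prime (p::nat)"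
  shows "\<exists>T. finite T \<and> T \<subseteq> \<O> \<and> (\<forall>y\<in>\<O>. \<exists>t\<in>T. \<exists>z\<in>\<O>. y = t + of_nat (p ^ n) * z)"
proof (induction n)
  case 0
  show ?case by (intro exI[of _ "{0}"]) (auto simp: O_0)
next
  case (Suc n)
  then obtain T where T: "finite T" "T \<subseteq> \<O>" "\<And>y. y \<in> \<O> \<Longrightarrow> \<exists>t\<in>T. \<exists>z\<in>\<O>. y = t + of_nat (p ^ n) * z"
    by blast
  obtain T1 where T1: "finite T1" "T1 \<subseteq> \<O>" "\<And>y. y \<in> \<O> \<Longrightarrow> \<exists>t\<in>T1. \<exists>z\<in>\<O>. y = t + of_nat p * z"
    using O_finite_mod_prime[OF p] by blast
  define T2 where "T2 = (\<lambda>(s,t). s + of_nat (p ^ n) * t) ` (T \<times> T1)"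
  have "\<exists>t\<in>T2. \<exists>z\<in>\<O>. y = t + of_nat (p ^ Suc n) * z" if y: "y \<in> \<O>" for y
  proof -
    obtain s z where s: "s \<in> T" "z \<in> \<O>" "y = s + of_nat (p ^ n) * z" using T(3)[OF y] by blast
    obtain t z' where t: "t \<in> T1" "z' \<in> \<O>" "z = t + of_nat p * z'" using T1(3)[OF s(2)] by blast
    have "y = (s + of_nat (p ^ n) * t) + of_nat (p ^ Suc n) * z'" by (simp add: s t algebra_simps)
    moreover have "s + of_nat (p ^ n) * t \<in> T2" using s t by (auto simp: T2_def)
    ultimately show ?thesis using t by blast
  qed
  moreover have "T2 \<subseteq> \<O>" using T T1 by (auto simp: T2_def intro!: O_add O_mult O_of_nat O_power)
  moreover have "finite T2" using T T1 by (auto simp: T2_def)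
  ultimately show ?case by blast
qed

text \<open>Used three times: for the powers of an element outside \<open>P\<close>, of an element
  of \<open>P\<close>, and of a fractional inverse of \<open>P\<close> scaled by
  \<open>p\<close>.\<close>

lemma pigeonhole_mod_prime:
  assumes p: "Factorial_Ring.prime (p::nat)" and f: "\<And>n::nat. f n \<in> \<O>"
  obtains i j z where "i < j" "z \<in> \<O>" "f i - f j = of_nat p * z"
proof -
  obtain T where T: "finite T" "T \<subseteq> \<O>" "\<And>y. y \<in> \<O> \<Longrightarrow> \<exists>t\<in>T. \<exists>z\<in>\<O>. y = t + of_nat p * z"
    using O_finite_mod_prime[OF p] by blast
  obtain t where t: "\<And>n. t n \<in> T" "\<And>n. \<exists>z\<in>\<O>. f n = t n + of_nat p * z"
    using T(3)[OF f] by metis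
  have "\<not> inj t"
    using T(1) t(1) by (meson finite_subset infinite_UNIV_nat finite_imageD image_subsetI)
  then obtain i j where ij: "i < j" "t i = t j" by (metis linorder_injI)
  obtain z z' where z: "z \<in> \<O>" "z' \<in> \<O>" "f i = t i + of_nat p * z" "f j = t j + of_nat p * z'"
    using t(2) by metis
  have "f i - f j = of_nat p * (z - z')" by (simp add: z ij algebra_simps)
  thus ?thesis using that ij z O_diff by blast
qed

end

subsection \<open>The valuation of a prime ideal\<close>

context number_field_on
begin

lemma OK_simps [simp]:
  "carrier (OK K) = \<O>" "x \<otimes>\<^bsub>OK K\<^esub> y = x * y" "x \<oplus>\<^bsub>OK K\<^esub> y = x + y"
  "\<one>\<^bsub>OK K\<^esub> = 1" "\<zero>\<^bsub>OK K\<^esub> = 0"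
  by (simp_all add: OK_def sub_ring_on_def ring_of_type_algebra_def)

lemma OK_cring: "cring (OK K)"
proof (rule cringI)
  show "abelian_group (OK K)"
    by (rule abelian_groupI) (auto simp: O_add O_0 add_ac intro: bexI[OF _ O_uminus])
  show "comm_monoid (OK K)"
    by (rule comm_monoidI) (auto simp: O_mult O_1 mult_ac)
qed (auto simp: distrib_right)

lemma OK_ideal_iff:
  "ideal I (OK K) \<longleftrightarrow> I \<subseteq> \<O> \<and> 0 \<in> I \<and> (\<forall>x\<in>I. \<forall>y\<in>I. x + y \<in> I) \<and> (\<forall>x\<in>\<O>. \<forall>y\<in>I. x * y \<in> I)"
proof
  assume "ideal I (OK K)"
  then interpret ideal I "OK K" .
  show "I \<subseteq> \<O> \<and> 0 \<in> I \<and> (\<forall>x\<in>I. \<forall>y\<in>I. x + y \<in> I) \<and> (\<forall>x\<in>\<O>. \<forall>y\<in>I. x * y \<in> I)"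
    using a_subset I_l_closed additive_subgroup.zero_closed[OF is_additive_subgroup]
      additive_subgroup.a_closed[OF is_additive_subgroup] by auto
next
  assume I: "I \<subseteq> \<O> \<and> 0 \<in> I \<and> (\<forall>x\<in>I. \<forall>y\<in>I. x + y \<in> I) \<and> (\<forall>x\<in>\<O>. \<forall>y\<in>I. x * y \<in> I)"
  interpret cring "OK K" by (rule OK_cring)
  have "- 1 \<in> \<O>" using O_1 O_uminus by blast
  have neg: "- x \<in> I" if "x \<in> I" for x
  proof -
    have "(- 1) * x \<in> I" using I \<open>- 1 \<in> \<O>\<close> that by blast
    thus ?thesis by simp
  qed
  have "subgroup I (add_monoid (OK K))"
  proof (rule add.subgroupI)
    show "I \<subseteq> carrier (OK K)" "I \<noteq> {}" using I by auto
    fix a assume a: "a \<in> I"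
    have "\<ominus>\<^bsub>OK K\<^esub> a = - a" 
      by (rule minus_equality) (use a neg I in auto)
    thus "\<ominus>\<^bsub>OK K\<^esub> a \<in> I" using neg[OF a] by simp
  qed (use I in auto)
  moreover have "a * x \<in> I" if "a \<in> I" "x \<in> \<O>" for a x
    using I that by (metis mult.commute)
  ultimately show "ideal I (OK K)"
    by (intro idealI ring_axioms) (use I in auto)
qed

lemma OK_primeideal_iff:
  "primeideal I (OK K) \<longleftrightarrow> ideal I (OK K) \<and> 1 \<notin> I \<and> 
     (\<forall>x\<in>\<O>. \<forall>y\<in>\<O>. x * y \<in> I \<longrightarrow> x \<in> I \<or> y \<in> I)"
proof
  assume "primeideal I (OK K)"
  then interpret primeideal I "OK K" .
  show "ideal I (OK K) \<and> 1 \<notin> I \<and> (\<forall>x\<in>\<O>. \<forall>y\<in>\<O>. x * y \<in> I \<longrightarrow> x \<in> I \<or> y \<in> I)"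
    using is_ideal I_prime I_notcarr one_imp_carrier by auto
next
  assume *: "ideal I (OK K) \<and> 1 \<notin> I \<and> (\<forall>x\<in>\<O>. \<forall>y\<in>\<O>. x * y \<in> I \<longrightarrow> x \<in> I \<or> y \<in> I)"
  thus "primeideal I (OK K)"
    by (intro primeidealI OK_cring) (use O_1 in auto)
qed

end

locale prime_above = number_field_on +
  fixes p :: nat and P :: "'a set"
  assumes prime_p: "Factorial_Ring.prime p" and prime_ideal_above: "prime_ideal_above K p P"
begin

lemma P_prime: "primeideal P (OK K)"
  using prime_ideal_above by (simp add: prime_ideal_above_def)

lemma P_ideal: "ideal P (OK K)" and one_notin_P: "1 \<notin> P"
  and P_multD: "x \<in> \<O> \<Longrightarrow> y \<in> \<O> \<Longrightarrow> x * y \<in> P \<Longrightarrow> x \<in> P \<or> y \<in> P"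
  using P_prime unfolding OK_primeideal_iff by auto

lemma P_O: "x \<in> P \<Longrightarrow> x \<in> \<O>" and P_0: "0 \<in> P"
  and P_add: "x \<in> P \<Longrightarrow> y \<in> P \<Longrightarrow> x + y \<in> P"
  and P_mult: "x \<in> \<O> \<Longrightarrow> y \<in> P \<Longrightarrow> x * y \<in> P"
  using P_ideal unfolding OK_ideal_iff by auto

lemma P_mult2: "x \<in> P \<Longrightarrow> y \<in> \<O> \<Longrightarrow> x * y \<in> P"
  by (metis P_mult mult.commute)

lemma P_uminus: "x \<in> P \<Longrightarrow> - x \<in> P"
  using P_mult[of "-1" x] O_1 O_uminus by force

lemma P_diff: "x \<in> P \<Longrightarrow> y \<in> P \<Longrightarrow> x - y \<in> P"
  using P_add[of x "-y"] P_uminus by simp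

lemma P_sum: "(\<And>i. i \<in> A \<Longrightarrow> f i \<in> P) \<Longrightarrow> sum f A \<in> P"
  by (induction A rule: infinite_finite_induct) (auto simp: P_0 P_add)

lemma of_int_in_P_iff: "of_int n \<in> P \<longleftrightarrow> int p dvd n"
proof -
  have "of_int n \<in> P \<longleftrightarrow> (of_int n :: 'a) \<in> P \<inter> \<int>" by simp
  also have "\<dots> \<longleftrightarrow> (of_int n :: 'a) \<in> range (\<lambda>k::int. of_int (int p * k))"
    using prime_ideal_above by (simp add: prime_ideal_above_def)
  also have "\<dots> \<longleftrightarrow> int p dvd n" unfolding dvd_def
    by (simp only: image_iff of_int_eq_iff) auto
  finally show ?thesis .
qed

lemma of_nat_in_P_iff: "of_nat n \<in> P \<longleftrightarrow> p dvd n"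
  using of_int_in_P_iff[of "int n"] by simp

lemma p_in_P: "of_nat p \<in> P"
  by (simp add: of_nat_in_P_iff)

lemma p_pos: "p > 0" and p_nz: "(of_nat p :: 'a) \<noteq> 0"
  using prime_p prime_gt_0_nat by auto

lemma pz_in_P: "z \<in> \<O> \<Longrightarrow> of_nat p * z \<in> P"
  using P_mult2 p_in_P by blast

text \<open>The denominators of the localisation at \<open>P\<close>.\<close>

definition S where "S = \<O> - P"

lemma S_1: "1 \<in> S" and S_O: "s \<in> S \<Longrightarrow> s \<in> \<O>"
  by (auto simp: S_def O_1 one_notin_P)

lemma S_mult: "s \<in> S \<Longrightarrow> t \<in> S \<Longrightarrow> s * t \<in> S"
  using P_multD by (auto simp: S_def O_mult)

lemma S_power: "s \<in> S \<Longrightarrow> s ^ n \<in> S"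
  by (induction n) (auto simp: S_1 S_mult)

lemma S_prod: "(\<And>i. i \<in> A \<Longrightarrow> f i \<in> S) \<Longrightarrow> prod f A \<in> S"
  by (induction A rule: infinite_finite_induct) (auto simp: S_1 S_mult)

lemma S_nz: "s \<in> S \<Longrightarrow> s \<noteq> 0"
  using P_0 by (auto simp: S_def)

lemma S_of_int: "\<not> int p dvd n \<Longrightarrow> of_int n \<in> S"
  by (simp add: S_def O_of_int of_int_in_P_iff)

lemma P_notin_S: "x \<in> P \<Longrightarrow> x \<notin> S" by (simp add: S_def)

text \<open>A finite domain is a field: two congruent powers of \<open>s\<close> differ by
  \<open>s^i\<close> times \<open>s^(k+1) - 1\<close>, up to sign, and \<open>s^i\<close> is outside
  the prime ideal.\<close>

lemma S_inverse_mod_P: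
  assumes s: "s \<in> S"
  obtains s' where "s' \<in> \<O>" "s * s' - 1 \<in> P"
proof -
  obtain i j z where ij: "i < j" "z \<in> \<O>" "s ^ i - s ^ j = of_nat p * z"
    using pigeonhole_mod_prime[OF prime_p, of "\<lambda>i. s ^ i"] S_O[OF s] O_power by metis
  define k where "k = j - i - 1"
  have "s ^ i * (s * s ^ k - 1) = - (s ^ i - s ^ j)"
    using ij(1) by (simp add: k_def algebra_simps flip: power_add power_Suc)
  hence "s ^ i * (s * s ^ k - 1) = - (of_nat p * z)" by (simp only: ij(3))
  hence "s ^ i * (s * s ^ k - 1) \<in> P" using pz_in_P[OF ij(2)] P_uminus by auto
  moreover have "s * s ^ k - 1 \<in> \<O>" using S_O[OF s] by (intro O_diff O_mult O_power O_1)
  ultimately have "s * s ^ k - 1 \<in> P" using P_multD S_power[OF s, of i] by (auto simp: S_def)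
  thus ?thesis using that O_power S_O[OF s] by blast
qed

text \<open>\<open>a\<close> vanishes in the localisation of \<open>\<O>/p\<O>\<close> at \<open>P\<close>.\<close>

definition killed where "killed a \<longleftrightarrow> (\<exists>s\<in>S. \<exists>z\<in>\<O>. s * a = of_nat p * z)"

lemma killed_mult: "killed a \<Longrightarrow> b \<in> \<O> \<Longrightarrow> killed (b * a)"
  unfolding killed_def
proof (elim bexE)
  fix s z assume "b \<in> \<O>" "s \<in> S" "z \<in> \<O>" "s * a = of_nat p * z"
  hence "s * (b * a) = of_nat p * (b * z)" "b * z \<in> \<O>" by (auto simp: mult_ac O_mult)
  thus "\<exists>s\<in>S. \<exists>z\<in>\<O>. s * (b * a) = of_nat p * z" using \<open>s \<in> S\<close> by blast
qed

lemma one_not_killed: "\<not> killed 1"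
  unfolding killed_def using pz_in_P P_notin_S by fastforce

text \<open>Nilpotence of the maximal ideal in a finite local ring: \<open>x^i (1 - x^(j-i))\<close>
  is divisible by \<open>p\<close>, and the second factor is outside \<open>P\<close>.\<close>

lemma power_killed:
  assumes x: "x \<in> P"
  obtains n where "killed (x ^ n)"
proof -
  obtain i j z where ij: "i < j" "z \<in> \<O>" "x ^ i - x ^ j = of_nat p * z"
    using pigeonhole_mod_prime[OF prime_p, of "\<lambda>i. x ^ i"] P_O[OF x] O_power by metis
  have "x ^ j = x ^ i * x ^ (j - i)" using ij(1) by (simp flip: power_add)
  hence "(1 - x ^ (j - i)) * x ^ i = of_nat p * z"
    unfolding ij(3)[symmetric] by (simp add: algebra_simps)
  moreover have "x ^ (j - i) \<in> P"
    using P_mult2[OF x O_power[OF P_O[OF x], of "j - i - 1"]] ij(1) 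
    by (simp add: Suc_diff_Suc flip: power_Suc)
  hence "1 - x ^ (j - i) \<in> S" using O_diff[OF O_1 P_O] one_notin_P P_add[of "1 - x ^ (j - i)" "x ^ (j - i)"]
    by (auto simp: S_def)
  ultimately have "killed (x ^ i)" using ij(2) unfolding killed_def by blast
  thus ?thesis by (rule that)
qed

text \<open>A finite local ring has a nonzero element annihilated by its maximal ideal. It is
  reached one generator at a time: \<open>b\<close> is multiplied by the last power of
  \<open>x\<close> that does not kill it.\<close>

lemma unkilled_annihilated:
  assumes "finite Y" "Y \<subseteq> P"
  shows "\<exists>b\<in>\<O>. \<not> killed b \<and> (\<forall>x\<in>Y. killed (x * b))"
  using assms
proof (induction Y)
  case empty
  show ?case using O_1 one_not_killed by blast
next
  case (insert x Y)
  then obtain b where b: "b \<in> \<O>" "\<not> killed b" "\<And>y. y \<in> Y \<Longrightarrow> killed (y * b)" by blast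
  have x: "x \<in> P" "x \<in> \<O>" using insert P_O by auto
  obtain n where "killed (x ^ n)" by (rule power_killed[OF x(1)])
  hence "killed (b * x ^ n)" using b(1) killed_mult by blast
  hence ex: "\<exists>n. killed (x ^ n * b)" by (auto simp: mult.commute)
  define m where "m = (LEAST n. killed (x ^ n * b))"
  have m: "killed (x ^ m * b)" unfolding m_def by (rule LeastI_ex[OF ex])
  have "m \<noteq> 0" using m b(2) by (intro notI) auto
  then obtain k where k: "m = Suc k" using not0_implies_Suc by blast
  have nk: "\<not> killed (x ^ k * b)" using not_less_Least[of k "\<lambda>n. killed (x ^ n * b)"] k m_def by auto
  have "killed (y * (x ^ k * b))" if "y \<in> insert x Y" for y
  proof (cases "y = x")
    case True
    then show ?thesis using m k by (simp add: mult.assoc)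
  next
    case False
    hence "killed (x ^ k * (y * b))" using that b(3) killed_mult O_power x(2) by blast
    thus ?thesis by (simp add: mult_ac)
  qed
  thus ?case using nk b x by (intro bexI[of _ "x ^ k * b"] conjI) (auto simp: O_mult O_power)
qed

text \<open>The finitely many representatives of \<open>P\<close> modulo \<open>p\<close> have a
  common denominator \<open>s0\<close>. Multiplying by it turns divisibility by \<open>p\<close> in
  the localisation into divisibility in \<open>\<O>\<close>.\<close>

lemma annihilator_of_P:
  obtains b where "b \<in> \<O>" "\<not> killed b" "\<And>x. x \<in> P \<Longrightarrow> \<exists>z\<in>\<O>. b * x = of_nat p * z"
proof -
  obtain T where T: "finite T" "T \<subseteq> \<O>" "\<And>y. y \<in> \<O> \<Longrightarrow> \<exists>t\<in>T. \<exists>z\<in>\<O>. y = t + of_nat p * z"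
    using O_finite_mod_prime[OF prime_p] by blast
  define Y where "Y = T \<inter> P"
  have Y: "finite Y" "Y \<subseteq> P" using T by (auto simp: Y_def)
  obtain b where b: "b \<in> \<O>" "\<not> killed b" "\<And>x. x \<in> Y \<Longrightarrow> killed (x * b)"
    using unkilled_annihilated[OF Y] by blast
  have "\<forall>x\<in>Y. \<exists>s\<in>S. \<exists>z\<in>\<O>. s * (x * b) = of_nat p * z" using b(3) unfolding killed_def by blast
  then obtain s where s: "\<And>x. x \<in> Y \<Longrightarrow> s x \<in> S \<and> (\<exists>z\<in>\<O>. s x * (x * b) = of_nat p * z)" by metis
  define s0 where "s0 = (\<Prod>x\<in>Y. s x)"
  have s0: "s0 \<in> S" using s by (auto simp: s0_def intro!: S_prod)
  show ?thesis
  proof (rule that[of "s0 * b"])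
    show "s0 * b \<in> \<O>" using S_O[OF s0] b O_mult by blast
    show "\<not> killed (s0 * b)"
    proof
      assume "killed (s0 * b)"
      then obtain r z where "r \<in> S" "z \<in> \<O>" "(r * s0) * b = of_nat p * z" 
        by (auto simp: killed_def mult.assoc)
      thus False using b(2) S_mult[OF _ s0] unfolding killed_def by blast
    qed
    fix x assume x: "x \<in> P"
    obtain t z where tz: "t \<in> T" "z \<in> \<O>" "x = t + of_nat p * z" using T(3)[OF P_O[OF x]] by blast
    have "t \<in> P" using P_diff[OF x pz_in_P[OF tz(2)]] tz(3) by simp
    hence t: "t \<in> Y" using tz Y_def by auto
    obtain z' where z': "z' \<in> \<O>" "s t * (t * b) = of_nat p * z'" using s[OF t] by blast
    define s1 where "s1 = (\<Prod>x\<in>Y-{t}. s x)"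
    have s1: "s1 \<in> \<O>" using s S_O by (auto simp: s1_def intro!: O_prod)
    have "s0 = s t * s1" unfolding s0_def s1_def using Y(1) t by (rule prod.remove)
    have "s0 * b * x = s1 * (s t * (t * b)) + of_nat p * (s0 * b * z)"
      by (simp add: tz \<open>s0 = s t * s1\<close> algebra_simps)
    also have "\<dots> = of_nat p * (s1 * z' + s0 * b * z)" unfolding z' by (simp add: algebra_simps)
    finally show "\<exists>z\<in>\<O>. s0 * b * x = of_nat p * z"
      using s1 z' S_O[OF s0] b(1) tz(2) by (blast intro: O_add O_mult)
  qed
qed

text \<open>
  The element \<open>z = b / p\<close> spans the inverse of \<open>P\<close> together with 1. If \<open>zP \<subseteq> P\<close>, then all powers 
  of \<open>z\<close> lie in \<open>p\<^sup>-\<^sup>1\<O>\<close>, two of them are congruent modulo \<open>\<O>\<close> and \<open>z\<close> is integral.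
\<close>

lemma inverse_of_P:
  obtains z where "z \<in> K" "\<And>x. x \<in> P \<Longrightarrow> z * x \<in> \<O>" "\<exists>x\<in>P. z * x \<notin> P"
proof -
  obtain b where b: "b \<in> \<O>" "\<not> killed b" "\<And>x. x \<in> P \<Longrightarrow> \<exists>z\<in>\<O>. b * x = of_nat p * z"
    using annihilator_of_P by blast
  define z where "z = b / of_nat p"
  have zK: "z \<in> K" using b(1) by (auto simp: z_def O_K K_divide K_of_nat)
  have zO: "z * x \<in> \<O>" if x: "x \<in> P" for x
  proof -
    obtain y where "y \<in> \<O>" "b * x = of_nat p * y" using b(3)[OF x] by blast
    moreover from this have "z * x = y" using p_nz by (simp add: z_def field_simps)
    ultimately show ?thesis by simp
  qed
  moreover have "\<exists>x\<in>P. z * x \<notin> P"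
  proof (rule ccontr)
    assume "\<not> ?thesis"
    hence *: "z * x \<in> P" if "x \<in> P" for x using that by blast
    have zk: "z ^ k * of_nat p \<in> P" for k
      by (induction k) (auto simp: p_in_P * mult.assoc)
    obtain i j y where ij: "i < j" "y \<in> \<O>" "z ^ i * of_nat p - z ^ j * of_nat p = of_nat p * y"
      using pigeonhole_mod_prime[OF prime_p, of "\<lambda>k. z ^ k * of_nat p"] zk P_O by blast
    have "of_nat p * (z ^ j - z ^ i) = of_nat p * (- y)"
      using ij(3) by (simp add: algebra_simps)
    hence "z ^ j - z ^ i = - y" using p_nz by (metis mult_left_cancel)
    hence "algebraic_int (z ^ j - z ^ i)" using O_uminus[OF ij(2)] by (simp add: O_iff)
    hence "z \<in> \<O>" using algebraic_int_if_power_diff[OF ij(1)] zK by (simp add: O_iff)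
    \<comment> \<open>Integrality of \<open>z\<close> makes \<open>b\<close> divisible by
      \<open>p\<close>, hence killed with denominator 1.\<close>
    moreover have "1 * b = of_nat p * z" using p_nz by (simp add: z_def)
    ultimately show False using b(2) S_1 unfolding killed_def by blast
  qed
  ultimately show ?thesis using that zK by blast
qed

section \<open>A uniformizer, and division by its powers\<close>

definition z where "z = (SOME z. z \<in> K \<and> (\<forall>x\<in>P. z * x \<in> \<O>) \<and> (\<exists>x\<in>P. z * x \<notin> P))"

lemma z_O: "x \<in> P \<Longrightarrow> z * x \<in> \<O>" and z_ex: "\<exists>x\<in>P. z * x \<notin> P"
proof -
  have "\<exists>z. z \<in> K \<and> (\<forall>x\<in>P. z * x \<in> \<O>) \<and> (\<exists>x\<in>P. z * x \<notin> P)" using inverse_of_P by metis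
  from someI_ex[OF this] show "x \<in> P \<Longrightarrow> z * x \<in> \<O>" "\<exists>x\<in>P. z * x \<notin> P"
    unfolding z_def by blast+
qed

text \<open>A uniformizer: \<open>z * \<pi>\<close> is a unit at \<open>P\<close>, and
  \<open>x = \<pi> * (z * x) / (z * \<pi>)\<close> with \<open>z * x\<close> integral for
  \<open>x\<close> in \<open>P\<close>. So multiplication by \<open>z\<close> is division by
  \<open>\<pi>\<close> up to a unit.\<close>

definition \<pi> where "\<pi> = (SOME x. x \<in> P \<and> z * x \<notin> P)"

lemma pi_P: "\<pi> \<in> P" and zpi: "z * \<pi> \<in> S"
proof -
  have "\<exists>x. x \<in> P \<and> z * x \<notin> P" using z_ex by blast
  from someI_ex[OF this] show "\<pi> \<in> P" "z * \<pi> \<in> S" using z_O unfolding \<pi>_def S_def by auto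
qed

lemma pi_O: "\<pi> \<in> \<O>" and pi_K: "\<pi> \<in> K"
  using pi_P P_O O_K by auto

lemma pi_nz: "\<pi> \<noteq> 0"
  using S_nz[OF zpi] by auto

text \<open>\<open>x\<close> divides some nonzero integer \<open>m0 = p^v m'\<close>, and
  \<open>p\<close> divides \<open>\<pi>^N\<close> up to a factor in \<open>S\<close>. So, up to
  units at \<open>P\<close>, \<open>x\<close> divides \<open>\<pi>^(N v)\<close> and cannot be
  divisible by one more power of \<open>\<pi>\<close>.\<close>

lemma nonzero_bounded:
  assumes "x \<in> \<O>" "x \<noteq> 0"
  obtains k where "\<And>y. y \<in> \<O> \<Longrightarrow> x * (z * \<pi>) ^ k \<noteq> \<pi> ^ k * y"
proof -
  obtain m0 :: int where m0: "m0 > 0" "of_int m0 * (1 / x) \<in> \<O>"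
    by (rule K_denominator[of "1 / x"]) (use assms O_K K_1 K_divide in auto)
  define x' where "x' = of_int m0 * (1 / x)"
  have xx': "x * x' = of_int m0" using assms by (simp add: x'_def)
  define v where "v = multiplicity (int p) m0"
  have "\<exists>m'. m0 = int p ^ v * m' \<and> \<not> int p dvd m'"
    using multiplicity_decompose'[of m0 "int p"] m0(1) prime_p unfolding v_def
    by (metis less_irrefl not_prime_unit prime_nat_int_transfer)
  then obtain m' where m': "m0 = int p ^ v * m'" "\<not> int p dvd m'" by blast
  obtain N where "killed (\<pi> ^ N)" by (rule power_killed[OF pi_P])
  then obtain s c where sc: "s \<in> S" "c \<in> \<O>" "s * \<pi> ^ N = of_nat p * c" by (auto simp: killed_def)
  define k where "k = Suc (N * v)"
  show ?thesis
  proof (rule that[of k], rule notI)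
    fix y assume y: "y \<in> \<O>" "x * (z * \<pi>) ^ k = \<pi> ^ k * y"
    have "\<pi> ^ (N * v) * (s ^ v * of_int m' * (z * \<pi>) ^ k) = (s * \<pi> ^ N) ^ v * of_int m' * (z * \<pi>) ^ k"
      by (simp add: power_mult power_mult_distrib)
    also have "\<dots> = of_int m0 * c ^ v * (z * \<pi>) ^ k" by (simp add: sc m' power_mult_distrib)
    also have "\<dots> = (x * (z * \<pi>) ^ k) * x' * c ^ v" by (simp add: xx'[symmetric])
    also have "\<dots> = \<pi> ^ (N * v) * (\<pi> * (y * x' * c ^ v))" 
      unfolding y(2) by (simp add: k_def)
    finally have "s ^ v * of_int m' * (z * \<pi>) ^ k = \<pi> * (y * x' * c ^ v)"
      using pi_nz by simp
    moreover have "\<pi> * (y * x' * c ^ v) \<in> P" 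
      using y(1) m0(2)[folded x'_def] sc(2) by (intro P_mult2 pi_P O_mult O_power)
    moreover have "s ^ v * of_int m' * (z * \<pi>) ^ k \<in> S"
      by (rule S_mult[OF S_mult[OF S_power[OF sc(1)] S_of_int[OF m'(2)]] S_power[OF zpi]])
    ultimately show False using P_notin_S by auto
  qed
qed

text \<open>Divide by \<open>\<pi>\<close>, that is multiply by \<open>z\<close>, as long as the
  quotient stays in \<open>P\<close>; the previous lemma makes this stop.\<close>

lemma pi_decompose_O:
  assumes "x \<in> \<O>" "x \<noteq> 0"
  shows "\<exists>k. \<exists>s\<in>S. \<exists>t\<in>S. s * x = t * \<pi> ^ k"
proof (rule ccontr)
  assume *: "\<not> ?thesis"
  have "\<exists>y\<in>\<O>. x * (z * \<pi>) ^ k = \<pi> ^ k * y" for k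
  proof (induction k)
    case 0
    show ?case using assms by auto
  next
    case (Suc k)
    then obtain y where y: "y \<in> \<O>" "x * (z * \<pi>) ^ k = \<pi> ^ k * y" by blast
    have "y \<notin> S" using * y(2) S_power[OF zpi, of k] by (metis mult.commute)
    hence "z * y \<in> \<O>" using y z_O by (auto simp: S_def)
    moreover have "x * (z * \<pi>) ^ Suc k = \<pi> ^ Suc k * (z * y)"
    proof -
      have "x * (z * \<pi>) ^ Suc k = (x * (z * \<pi>) ^ k) * (z * \<pi>)" by simp
      also have "\<dots> = \<pi> ^ Suc k * (z * y)" unfolding y(2) by simp
      finally show ?thesis .
    qed
    ultimately show ?case by blast
  qed
  thus False using nonzero_bounded[OF assms] by metis
qed

lemma pi_decompose:
  assumes "x \<in> K" "x \<noteq> 0"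
  shows "\<exists>k. \<exists>s\<in>S. \<exists>t\<in>S. s * x = t * \<pi> powi k"
proof -
  obtain m :: int where m: "m > 0" "of_int m * x \<in> \<O>" using K_denominator[OF assms(1)] by blast
  obtain k s t where 1: "s \<in> S" "t \<in> S" "s * (of_int m * x) = t * \<pi> ^ k"
    using pi_decompose_O[OF m(2)] m(1) assms(2) by auto
  obtain k' s' t' where 2: "s' \<in> S" "t' \<in> S" "s' * of_int m = t' * \<pi> ^ k'"
    using pi_decompose_O[OF O_of_int, of m] m(1) by auto
  have "(s * t') * x * \<pi> ^ k' = s * (s' * of_int m) * x" by (simp add: 2)
  also have "\<dots> = s' * (s * (of_int m * x))" by simp
  also have "\<dots> = (s' * t) * \<pi> ^ k" unfolding 1 by simp
  finally have "(s * t') * x = (s' * t) * \<pi> powi (int k - int k')"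
    using pi_nz by (simp add: power_int_diff field_simps)
  thus ?thesis using S_mult 1 2 by blast
qed

section \<open>The discrete valuation attached to \<open>P\<close>\<close>

definition val :: "'a \<Rightarrow> int" where
  "val x = (THE k. \<exists>s\<in>S. \<exists>t\<in>S. s * x = t * \<pi> powi k)"

lemma pi_decompose_unique_aux:
  assumes "s \<in> S" "t \<in> S" "s' \<in> S" "t' \<in> S" "s * x = t * \<pi> powi k" "s' * x = t' * \<pi> powi l"
  shows "\<not> k < l"
proof
  assume "k < l"
  then obtain n where n: "l = k + int (Suc n)" using zless_iff_Suc_zadd by auto
  have "(t * s') * \<pi> powi k = s' * (s * x)" unfolding assms by simp
  also have "\<dots> = s * (s' * x)" by simp
  also have "\<dots> = (\<pi> * (s * t' * \<pi> ^ n)) * \<pi> powi k"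
    unfolding assms n using pi_nz by (simp add: power_int_add mult_ac)
  finally have "t * s' = \<pi> * (s * t' * \<pi> ^ n)" using pi_nz by simp
  moreover have "\<pi> * (s * t' * \<pi> ^ n) \<in> P" 
    using assms pi_O S_O by (intro P_mult2 pi_P O_mult O_power) auto
  moreover have "t * s' \<in> S" using assms S_mult by blast
  ultimately show False using P_notin_S by metis
qed

lemma val_eqI:
  assumes "s \<in> S" "t \<in> S" "s * x = t * \<pi> powi k"
  shows "val x = k"
  unfolding val_def
proof (rule the_equality)
  show "\<exists>s\<in>S. \<exists>t\<in>S. s * x = t * \<pi> powi k" using assms by blast
  fix l assume "\<exists>s\<in>S. \<exists>t\<in>S. s * x = t * \<pi> powi l"
  then obtain s' t' where "s' \<in> S" "t' \<in> S" "s' * x = t' * \<pi> powi l" by blast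
  thus "l = k" using pi_decompose_unique_aux assms by (meson linorder_neqE)
qed

lemma val_decompose:
  assumes "x \<in> K" "x \<noteq> 0"
  obtains s t where "s \<in> S" "t \<in> S" "s * x = t * \<pi> powi (val x)"
  using pi_decompose[OF assms] val_eqI by metis

lemma val_mult:
  assumes "x \<in> K" "x \<noteq> 0" "y \<in> K" "y \<noteq> 0"
  shows "val (x * y) = val x + val y"
proof -
  obtain s t where 1: "s \<in> S" "t \<in> S" "s * x = t * \<pi> powi (val x)" using val_decompose[OF assms(1,2)] .
  obtain s' t' where 2: "s' \<in> S" "t' \<in> S" "s' * y = t' * \<pi> powi (val y)" using val_decompose[OF assms(3,4)] .
  have "(s * s') * (x * y) = (s * x) * (s' * y)" by simp
  also have "\<dots> = (t * t') * \<pi> powi (val x + val y)" unfolding 1 2 using pi_nz by (simp add: power_int_add)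
  finally show ?thesis using val_eqI S_mult 1 2 by blast
qed

lemma val_S: "s \<in> S \<Longrightarrow> val s = 0"
  by (rule val_eqI[OF S_1]) auto

lemma val_1: "val 1 = 0"
  using val_S S_1 by blast

lemma val_pi: "val \<pi> = 1"
  by (rule val_eqI[OF S_1 S_1]) auto

lemma val_inverse:
  assumes "x \<in> K" "x \<noteq> 0"
  shows "val (inverse x) = - val x"
  using val_mult[of x "inverse x"] assms K_inverse val_1 by simp

lemma val_divide:
  assumes "x \<in> K" "x \<noteq> 0" "y \<in> K" "y \<noteq> 0"
  shows "val (x / y) = val x - val y"
  using val_mult[of x "inverse y"] val_inverse[of y] assms K_inverse by (simp add: divide_inverse)

lemma val_power:
  assumes "x \<in> K" "x \<noteq> 0"
  shows "val (x ^ n) = int n * val x"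
  by (induction n) (use assms in \<open>auto simp: val_1 val_mult K_power algebra_simps\<close>)

lemma val_power_int:
  assumes "x \<in> K" "x \<noteq> 0"
  shows "val (x powi n) = n * val x"
  using assms by (cases "n \<ge> 0") (auto simp: power_int_def val_power K_power val_inverse K_inverse)

lemma val_prod:
  assumes "finite A" "\<And>i. i \<in> A \<Longrightarrow> f i \<in> K" "\<And>i. i \<in> A \<Longrightarrow> f i \<noteq> 0"
  shows "val (prod f A) = (\<Sum>i\<in>A. val (f i))"
  using assms
proof (induction A)
  case (insert x A)
  hence "prod f A \<in> K" "prod f A \<noteq> 0" by (auto intro!: K_prod)
  then show ?case using insert by (simp add: val_mult)
qed (auto simp: val_1)

lemma val_nonneg:
  assumes "x \<in> \<O>" "x \<noteq> 0"
  shows "val x \<ge> 0"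
proof -
  obtain k s t where "s \<in> S" "t \<in> S" "s * x = t * \<pi> ^ k" using pi_decompose_O[OF assms] by blast
  hence "val x = int k" by (intro val_eqI) auto
  thus ?thesis by simp
qed

text \<open>The value \<open>val 0\<close> is junk; \<open>vge\<close> treats it as infinite.\<close>

definition vge where "vge k x \<longleftrightarrow> x \<in> K \<and> (x = 0 \<or> k \<le> val x)"

lemma vge_K: "vge k x \<Longrightarrow> x \<in> K" by (simp add: vge_def)

lemma vge_zero: "vge k 0" by (simp add: vge_def K_0)

lemma vge_O: "x \<in> \<O> \<Longrightarrow> vge 0 x"
  using val_nonneg by (auto simp: vge_def O_K)

lemma vge_mono: "vge k x \<Longrightarrow> l \<le> k \<Longrightarrow> vge l x"
  by (auto simp: vge_def)

lemma vge_mult: "vge k x \<Longrightarrow> vge l y \<Longrightarrow> vge (k + l) (x * y)"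
  by (cases "x = 0 \<or> y = 0") (auto simp: vge_def K_mult K_0 val_mult)

lemma vge_uminus: "vge k x \<Longrightarrow> vge k (- x)"
  using vge_mult[of k x 0 "-1"] vge_O[OF O_uminus[OF O_1]] by simp

text \<open>The valuation ring is the localisation of \<open>\<O>\<close> at \<open>P\<close>. In
  this form closure under addition is visible; the ultrametric inequality follows after scaling by a
  power of \<open>\<pi>\<close>.\<close>

lemma vge_0_iff: "vge 0 x \<longleftrightarrow> (\<exists>s\<in>S. s * x \<in> \<O>)"
proof
  assume x: "vge 0 x"
  show "\<exists>s\<in>S. s * x \<in> \<O>"
  proof (cases "x = 0")
    case False
    then obtain s t where "s \<in> S" "t \<in> S" "s * x = t * \<pi> powi (val x)"
      using val_decompose x vge_K by metis
    moreover have "\<pi> powi (val x) = \<pi> ^ nat (val x)" using x False by (simp add: vge_def power_int_def)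
    ultimately show ?thesis using pi_O S_O by (metis O_mult O_power)
  qed (use S_1 O_0 in auto)
next
  assume "\<exists>s\<in>S. s * x \<in> \<O>"
  then obtain s where s: "s \<in> S" "s * x \<in> \<O>" by blast
  have "x = (s * x) / s" using S_nz s by simp
  hence xK: "x \<in> K" using s S_O O_K K_divide by metis
  show "vge 0 x"
  proof (cases "x = 0")
    case False
    hence "val s + val x \<ge> 0" using val_nonneg[OF s(2)] s(1) S_nz S_O O_K xK by (auto simp: val_mult)
    then show ?thesis using xK val_S[OF s(1)] by (simp add: vge_def)
  qed (use vge_zero in auto)
qed

lemma vge_iff: "vge k x \<longleftrightarrow> vge 0 (x * \<pi> powi (- k))"
proof -
  have 1: "val (\<pi> powi l) = l" "\<pi> powi l \<in> K" for l
    using pi_nz pi_K by (auto simp: val_power_int val_pi K_power_int)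
  have "x * \<pi> powi (- k) * \<pi> powi k = x" using pi_nz by (simp add: mult.assoc flip: power_int_add)
  hence "vge k x" if "vge 0 (x * \<pi> powi (- k))"
  proof -
    have "vge (0 + k) (x * \<pi> powi (- k) * \<pi> powi k)" using 1 by (intro vge_mult that) (simp add: vge_def)
    thus ?thesis unfolding \<open>x * \<pi> powi (- k) * \<pi> powi k = x\<close> by simp
  qed
  moreover have "vge 0 (x * \<pi> powi (- k))" if "vge k x"
    using vge_mult[OF that, of "- k" "\<pi> powi (- k)"] 1 by (simp add: vge_def)
  ultimately show ?thesis by blast
qed

lemma vge_add:
  assumes "vge k x" "vge k y"
  shows "vge k (x + y)"
proof -
  have *: "vge 0 (x + y)" if "vge 0 x" "vge 0 y" for x y
  proof -
    obtain s t where "s \<in> S" "t \<in> S" "s * x \<in> \<O>" "t * y \<in> \<O>" using \<open>vge 0 x\<close> \<open>vge 0 y\<close> by (auto simp: vge_0_iff)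
    moreover have "s * t * (x + y) = t * (s * x) + s * (t * y)" by (simp add: algebra_simps)
    ultimately show ?thesis unfolding vge_0_iff using S_mult S_O O_add O_mult by metis
  qed
  show ?thesis using *[of "x * \<pi> powi (-k)" "y * \<pi> powi (-k)"] assms
    by (simp add: vge_iff[of k] distrib_right)
qed

lemma vge_diff: "vge k x \<Longrightarrow> vge k y \<Longrightarrow> vge k (x - y)"
  using vge_add[of k x "-y"] vge_uminus by simp

lemma vge_sum: "(\<And>i. i \<in> A \<Longrightarrow> vge k (f i)) \<Longrightarrow> vge k (sum f A)"
  by (induction A rule: infinite_finite_induct) (auto simp: vge_zero vge_add)

lemma vge_S_inverse: "s \<in> S \<Longrightarrow> vge 0 (inverse s)"
  using val_inverse[of s] S_nz[of s] val_S[of s] O_K[OF S_O, of s] by (simp add: vge_def K_inverse)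

text \<open>For \<open>x\<close> in \<open>P\<close>, the unit multiple
  \<open>(z * \<pi>) * x\<close> equals \<open>\<pi>\<close> times the integral element
  \<open>z * x\<close>. Conversely, integral elements outside \<open>P\<close> are units.\<close>

lemma vge_1_iff_P: "x \<in> \<O> \<Longrightarrow> vge 1 x \<longleftrightarrow> x \<in> P"
proof
  assume x: "x \<in> \<O>" "vge 1 x"
  show "x \<in> P"
  proof (rule ccontr)
    assume "x \<notin> P"
    hence "val x = 0" "x \<noteq> 0" using val_S[of x] x(1) P_0 by (auto simp: S_def)
    thus False using x(2) by (simp add: vge_def)
  qed
next
  assume "x \<in> P"
  have "(z * \<pi>) * x = \<pi> * (z * x)" by (simp only: mult_ac)
  moreover have "z * x \<in> \<O>" using z_O \<open>x \<in> P\<close> by blast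
  hence "vge (1 + 0) (\<pi> * (z * x))" by (intro vge_mult vge_O) (auto simp: vge_def val_pi pi_K)
  ultimately have 1: "vge 1 ((z * \<pi>) * x)" by (simp only: add_0_right)
  have "vge (0 + 1) (inverse (z * \<pi>) * ((z * \<pi>) * x))"
    by (rule vge_mult[OF vge_S_inverse[OF zpi] 1])
  moreover have "inverse (z * \<pi>) * ((z * \<pi>) * x) = x" using S_nz[OF zpi] by (simp add: field_simps)
  ultimately show "vge 1 x" by (simp only: add_0_left)
qed

lemma vge_cancel: 
  assumes "vge (k + val y) (x * y)" "x \<in> K" "y \<in> K" "y \<noteq> 0"
  shows "vge k x"
  using assms by (cases "x = 0") (auto simp: vge_def val_mult)

text \<open>Localising does not enlarge the residue field: dividing by \<open>s\<close> is, modulo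
  \<open>P\<close>, multiplying by an inverse of \<open>s\<close> in \<open>\<O>\<close>.\<close>

lemma vge_approx:
  assumes "vge 0 x"
  obtains y where "y \<in> \<O>" "vge 1 (x - y)"
proof -
  obtain s where s: "s \<in> S" "s * x \<in> \<O>" using assms by (auto simp: vge_0_iff)
  obtain s' where s': "s' \<in> \<O>" "s * s' - 1 \<in> P" by (rule S_inverse_mod_P[OF s(1)])
  have "x - s * x * s' = - ((s * s' - 1) * x)" by (simp add: algebra_simps)
  moreover have "vge (1 + 0) ((s * s' - 1) * x)"
    using s' vge_1_iff_P P_O assms by (intro vge_mult) auto
  ultimately have "vge 1 (x - s * x * s')" using vge_uminus by fastforce
  thus ?thesis using that s(2) s'(1) O_mult by blast
qed

lemma val_p_pos: "val (of_nat p) > 0"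
  using vge_1_iff_P[OF O_of_nat, of p] p_in_P p_nz by (simp add: vge_def)

lemma val_of_int_unit: "\<not> int p dvd n \<Longrightarrow> val (of_int n) = 0"
  using S_of_int val_S by blast

end

subsection \<open>The exponents\<close>

text \<open>Any cutoff \<open>N\<close> from \<open>n\<close> on is allowed, because
  \<open>n < 2^n\<close>; sums for different \<open>n\<close> can therefore share one range.\<close>

lemma w_eq_sum:
  assumes "q \<ge> 2" "n \<le> N"
  shows "w q n = (\<Sum>k=1..N. n div q ^ k)"
proof -
  have "w q n = (\<Sum>j<N. n div q ^ Suc j)" unfolding w_def
  proof (rule suminf_finite)
    fix j assume "j \<notin> {..<N}"
    hence "n \<le> j" using assms(2) by simp
    also have "j < 2 ^ j" by (rule less_exp)
    also have "\<dots> \<le> 2 ^ Suc j" by simp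
    also have "\<dots> \<le> q ^ Suc j" using assms(1) by (intro power_mono) auto
    finally show "n div q ^ Suc j = 0" by simp
  qed simp
  also have "\<dots> = (\<Sum>k=1..N. n div q ^ k)"
    by (rule sum.reindex_bij_witness[of _ "\<lambda>k. k - 1" Suc]) auto
  finally show ?thesis .
qed

lemma w_mono: "q \<ge> 2 \<Longrightarrow> m \<le> n \<Longrightarrow> w q m \<le> w q n"
  unfolding w_eq_sum[OF _ order_refl, of q n] w_eq_sum[of q m n]
  by (intro sum_mono div_le_mono)

text \<open>Double counting. It exchanges a sum of valuations, each counted as a number of levels
  \<open>k\<close>, for a sum over \<open>k\<close> of numbers of indices.\<close>

lemma sum_card_swap:
  assumes "finite A" "finite B"
  shows "(\<Sum>k\<in>B. card {i\<in>A. R k i}) = (\<Sum>i\<in>A. card {k\<in>B. R k i})"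
proof -
  have "(\<Sum>k\<in>B. card {i\<in>A. R k i}) = (\<Sum>k\<in>B. \<Sum>i\<in>A. if R k i then 1 else 0)"
    using assms by (intro sum.cong refl) (simp add: sum.inter_filter[symmetric])
  also have "\<dots> = (\<Sum>i\<in>A. \<Sum>k\<in>B. if R k i then 1 else 0)" by (rule sum.swap)
  also have "\<dots> = (\<Sum>i\<in>A. card {k\<in>B. R k i})"
    using assms by (intro sum.cong refl) (simp add: sum.inter_filter[symmetric])
  finally show ?thesis .
qed

lemma card_residue_class_ge:
  assumes "j < (Q::nat)"
  shows "n div Q \<le> card {i. i < n \<and> i mod Q = j}"
proof -
  have "(\<lambda>l. j + l * Q) ` {..<n div Q} \<subseteq> {i. i < n \<and> i mod Q = j}"
  proof (intro subsetI, elim imageE)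
    fix i l assume l: "i = j + l * Q" "l \<in> {..<n div Q}"
    have "j + l * Q < Suc l * Q" using assms by simp
    also have "\<dots> \<le> (n div Q) * Q" using l by (intro mult_le_mono1) auto
    also have "\<dots> \<le> n" by simp
    finally show "i \<in> {i. i < n \<and> i mod Q = j}" using l assms by simp
  qed
  moreover have "inj_on (\<lambda>l. j + l * Q) {..<n div Q}" using assms by (auto simp: inj_on_def)
  ultimately have "card {..<n div Q} \<le> card {i. i < n \<and> i mod Q = j}"
    by (intro card_inj_on_le) auto
  thus ?thesis by simp
qed

text \<open>Members of the class of \<open>n\<close> below \<open>n\<close> are told apart by their
  quotients, all smaller than \<open>n div Q\<close>. So this class has the least possible size,
  which is why the bound on the product is attained at the \<open>n\<close>-th node.\<close>

lemma card_residue_class_le: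
  assumes "0 < (Q::nat)"
  shows "card {i. i < n \<and> i mod Q = n mod Q} \<le> n div Q"
proof -
  have "(\<lambda>i. i div Q) ` {i. i < n \<and> i mod Q = n mod Q} \<subseteq> {..<n div Q}"
  proof (intro subsetI, elim imageE)
    fix y i assume "y = i div Q" "i \<in> {i. i < n \<and> i mod Q = n mod Q}"
    hence i: "y = i div Q" "i < n" "i mod Q = n mod Q" by auto
    have "i div Q \<le> n div Q" using i by (intro div_le_mono) auto
    moreover have "i div Q \<noteq> n div Q" using i by (metis div_mult_mod_eq less_irrefl)
    ultimately show "y \<in> {..<n div Q}" using i by simp
  qed
  moreover have "inj_on (\<lambda>i. i div Q) {i. i < n \<and> i mod Q = n mod Q}"
    by (rule inj_onI) (metis (mono_tags, lifting) div_mult_mod_eq mem_Collect_eq)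
  ultimately have "card {i. i < n \<and> i mod Q = n mod Q} \<le> card {..<n div Q}"
    by (intro card_inj_on_le) auto
  thus ?thesis by simp
qed

context prime_above
begin

subsection \<open>Ramification index and residue field\<close>

definition e where "e = nat (val (of_nat p))"

lemma e_pos: "e > 0" and val_p: "val (of_nat p) = int e"
  using val_p_pos by (auto simp: e_def)

text \<open>\<open>J i\<close> is \<open>p P\<^sup>-\<^sup>i\<close>, because \<open>\<O> + z\<O>\<close> is the inverse of \<open>P\<close>.\<close>

primrec J where
  "J 0 = {x * of_nat p | x. x \<in> \<O>}"
| "J (Suc i) = {x + z * y | x y. x \<in> J i \<and> y \<in> J i}"

text \<open>Invertibility of \<open>P\<close>: its product with the fractional ideal generated by 1
  and \<open>z\<close> contains 1.\<close>

lemma P_plus_zP: obtains m x where "m \<in> P" "x \<in> P" "m + z * x = 1"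
proof -
  obtain s' where s': "s' \<in> \<O>" "(z * \<pi>) * s' - 1 \<in> P" by (rule S_inverse_mod_P[OF zpi])
  have "- ((z * \<pi>) * s' - 1) + z * (\<pi> * s') = 1" by (simp add: algebra_simps)
  thus ?thesis using that P_uminus[OF s'(2)] P_mult2[OF pi_P s'(1)] by blast
qed

text \<open>\<open>J i \<subseteq> P\<close> keeps the elements \<open>z * y\<close> integral. For
  the product, one inclusion uses that \<open>z\<close> maps \<open>P\<close> into
  \<open>\<O>\<close>, the other multiplies \<open>x\<close> by the decomposition of 1 from
  \<open>P_plus_zP\<close>.\<close>

lemma J_Suc_ideal:
  assumes J: "ideal (J i) (OK K)" and JP: "J i \<subseteq> P"
  shows "ideal (J (Suc i)) (OK K)" "P \<cdot>\<^bsub>OK K\<^esub> J (Suc i) = J i"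
proof -
  have J': "J i \<subseteq> \<O>" "0 \<in> J i" "\<And>x y. x \<in> J i \<Longrightarrow> y \<in> J i \<Longrightarrow> x + y \<in> J i"
     "\<And>x y. x \<in> \<O> \<Longrightarrow> y \<in> J i \<Longrightarrow> x * y \<in> J i"
    using J unfolding OK_ideal_iff by auto
  have "x + y \<in> J (Suc i)" if "x \<in> J (Suc i)" "y \<in> J (Suc i)" for x y
  proof -
    from that obtain a b c d where *: "a \<in> J i" "b \<in> J i" "c \<in> J i" "d \<in> J i" "x = a + z * b" "y = c + z * d"
      by auto
    have "x + y = (a + c) + z * (b + d)" by (simp add: * algebra_simps)
    thus ?thesis using * J'(3) unfolding J.simps by blast
  qed
  moreover have "x * y \<in> J (Suc i)" if "x \<in> \<O>" "y \<in> J (Suc i)" for x y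
  proof -
    from that obtain a b where *: "a \<in> J i" "b \<in> J i" "y = a + z * b" by auto
    have "x * y = x * a + z * (x * b)" by (simp add: * algebra_simps)
    thus ?thesis using * J'(4) that unfolding J.simps by blast
  qed
  moreover have "J (Suc i) \<subseteq> \<O>" using J'(1) JP z_O by (auto intro!: O_add)
  moreover have "0 + z * 0 \<in> J (Suc i)" using J'(2) unfolding J.simps by blast
  ultimately show "ideal (J (Suc i)) (OK K)" unfolding OK_ideal_iff by simp
  show "P \<cdot>\<^bsub>OK K\<^esub> J (Suc i) = J i"
  proof (intro equalityI subsetI)
    fix x assume "x \<in> P \<cdot>\<^bsub>OK K\<^esub> J (Suc i)"
    thus "x \<in> J i"
    proof induction
      case (prod a y)
      then obtain b c where *: "b \<in> J i" "c \<in> J i" "y = b + z * c" by auto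
      have "a * y = a * b + (z * a) * c" by (simp add: * algebra_simps)
      moreover have "a * b \<in> J i" "(z * a) * c \<in> J i" using J'(4) * prod P_O z_O by auto
      ultimately show ?case using J'(3) by simp
    next
      case (sum s1 s2)
      then show ?case using J'(3) by simp
    qed
  next
    fix x assume x: "x \<in> J i"
    obtain m y where my: "m \<in> P" "y \<in> P" "m + z * y = 1" by (rule P_plus_zP)
    have 1: "x + z * 0 \<in> J (Suc i)" "0 + z * x \<in> J (Suc i)" using x J'(2) unfolding J.simps by blast+
    hence "m * x \<in> P \<cdot>\<^bsub>OK K\<^esub> J (Suc i)" "y * (z * x) \<in> P \<cdot>\<^bsub>OK K\<^esub> J (Suc i)"
      using ideal_prod.prod[OF my(1) 1(1), of "OK K"] ideal_prod.prod[OF my(2) 1(2), of "OK K"] by auto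
    hence "m * x + y * (z * x) \<in> P \<cdot>\<^bsub>OK K\<^esub> J (Suc i)"
      using ideal_prod.sum[of _ "OK K"] by fastforce
    moreover have "m * x + y * (z * x) = (m + z * y) * x" by (simp add: algebra_simps)
    ultimately show "x \<in> P \<cdot>\<^bsub>OK K\<^esub> J (Suc i)" using my by simp
  qed
qed

abbreviation Ppow where "Ppow k \<equiv> P [^]\<^bsub>ideals_set (OK K)\<^esub> (k::nat)"

lemma ideals_monoid: "comm_monoid (ideals_set (OK K))"
  using OK_cring by (rule cring.ideals_set_is_comm_monoid)

lemma Ppow_Suc: "Ppow (Suc k) = Ppow k \<cdot>\<^bsub>OK K\<^esub> P" and Ppow_0: "Ppow 0 = \<O>"
  and Ppow_ideal: "ideal (Ppow k) (OK K)"
proof -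
  interpret comm_monoid "ideals_set (OK K)" by (rule ideals_monoid)
  show "Ppow (Suc k) = Ppow k \<cdot>\<^bsub>OK K\<^esub> P" "Ppow 0 = \<O>" by (auto simp: ideals_set_def nat_pow_def)
  have "Ppow k \<in> carrier (ideals_set (OK K))"
    by (rule nat_pow_closed) (simp add: ideals_set_def P_ideal)
  thus "ideal (Ppow k) (OK K)" by (simp add: ideals_set_def)
qed

lemma Ppow_vge: "x \<in> Ppow k \<Longrightarrow> vge (int k) x"
proof (induction k arbitrary: x)
  case 0
  then show ?case by (metis Ppow_0 vge_O of_nat_0)
next
  case (Suc k)
  from Suc.prems have "x \<in> Ppow k \<cdot>\<^bsub>OK K\<^esub> P" by (simp only: Ppow_Suc)
  thus ?case
  proof induction
    case (prod i j)
    have "vge (int k + 1) (i * j)" using prod Suc.IH vge_1_iff_P P_O by (intro vge_mult) auto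
    then show ?case by (simp add: add.commute)
  qed (simp add: vge_add)
qed

lemma pi_power_Ppow: "\<pi> ^ k \<in> Ppow k"
proof (induction k)
  case 0
  then show ?case using Ppow_0 O_1 by simp
next
  case (Suc k)
  have "\<pi> ^ k \<otimes>\<^bsub>OK K\<^esub> \<pi> \<in> Ppow k \<cdot>\<^bsub>OK K\<^esub> P" using Suc pi_P by (rule ideal_prod.prod)
  then show ?case by (simp only: Ppow_Suc OK_simps power_Suc2)
qed

text \<open>The construction continues while \<open>i < e\<close>: an element of \<open>J i\<close>
  outside \<open>P\<close>, multiplied by \<open>\<pi>^i\<close>, would be a multiple of
  \<open>p\<close> with valuation only \<open>i\<close>.\<close>

lemma J_ideal: "i \<le> e \<Longrightarrow> ideal (J i) (OK K) \<and> Ppow i \<cdot>\<^bsub>OK K\<^esub> J i = J 0"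
proof (induction i)
  case 0
  have "PIdl\<^bsub>OK K\<^esub> (of_nat p) = J 0" by (simp add: cgenideal_def)
  moreover have "ideal (PIdl\<^bsub>OK K\<^esub> (of_nat p)) (OK K)"
    using OK_cring by (rule cring.cgenideal_ideal) (simp add: O_of_nat)
  ultimately have J: "ideal (J 0) (OK K)" by simp
  interpret comm_monoid "ideals_set (OK K)" by (rule ideals_monoid)
  have "\<one>\<^bsub>ideals_set (OK K)\<^esub> \<otimes>\<^bsub>ideals_set (OK K)\<^esub> J 0 = J 0"
    by (rule l_one) (use J in \<open>simp add: ideals_set_def\<close>)
  thus ?case using J Ppow_0 by (simp add: ideals_set_def)
next
  case (Suc i)
  hence IH: "ideal (J i) (OK K)" "Ppow i \<cdot>\<^bsub>OK K\<^esub> J i = J 0" and i: "i < e" by auto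
  have "J i \<subseteq> P"
  proof
    fix j assume j: "j \<in> J i"
    hence jO: "j \<in> \<O>" using IH(1) unfolding OK_ideal_iff by blast
    show "j \<in> P"
    proof (rule ccontr)
      assume "j \<notin> P"
      hence jS: "j \<in> S" using jO by (simp add: S_def)
      have "\<pi> ^ i \<otimes>\<^bsub>OK K\<^esub> j \<in> Ppow i \<cdot>\<^bsub>OK K\<^esub> J i" using pi_power_Ppow j by (rule ideal_prod.prod)
      hence "\<pi> ^ i * j \<in> J 0" by (simp only: IH OK_simps)
      then obtain x where x: "x \<in> \<O>" "\<pi> ^ i * j = x * of_nat p" by auto
      hence "x \<noteq> 0" using pi_nz S_nz[OF jS] by auto
      have "val (\<pi> ^ i * j) = int i" 
        using pi_nz S_nz[OF jS] pi_K jO O_K by (simp add: val_mult val_power val_pi val_S[OF jS] K_power)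
      moreover have "val (x * of_nat p) = val x + int e"
        using x(1) \<open>x \<noteq> 0\<close> p_nz K_of_nat O_K by (simp add: val_mult val_p)
      ultimately show False using val_nonneg[OF x(1) \<open>x \<noteq> 0\<close>] i x by simp
    qed
  qed
  note * = J_Suc_ideal[OF IH(1) this]
  interpret comm_monoid "ideals_set (OK K)" by (rule ideals_monoid)
  have "(Ppow i \<otimes>\<^bsub>ideals_set (OK K)\<^esub> P) \<otimes>\<^bsub>ideals_set (OK K)\<^esub> J (Suc i) 
      = Ppow i \<otimes>\<^bsub>ideals_set (OK K)\<^esub> (P \<otimes>\<^bsub>ideals_set (OK K)\<^esub> J (Suc i))"
    using Ppow_ideal P_ideal *(1) by (intro m_assoc) (auto simp: ideals_set_def)
  hence "Ppow (Suc i) \<cdot>\<^bsub>OK K\<^esub> J (Suc i) = J 0" 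
    using *(2) IH(2) by (simp add: ideals_set_def)
  thus ?case using * by blast
qed

text \<open>\<open>J e\<close> is an explicit cofactor of the \<open>e\<close>-th power of
  \<open>P\<close> in \<open>p\<O>\<close>, and a \<open>k\<close>-th power dividing
  \<open>p\<O>\<close> forces \<open>val p\<close> to be at least \<open>k\<close>. This connects
  the index defined by ideals with the valuation.\<close>

lemma ramification_index_eq: "ramification_index K p P = e"
  unfolding ramification_index_def
proof (rule Greatest_equality)
  have J0: "PIdl\<^bsub>OK K\<^esub> (of_nat p) = J 0" by (simp add: cgenideal_def)
  show "Ppow e divides\<^bsub>ideals_set (OK K)\<^esub> PIdl\<^bsub>OK K\<^esub> (of_nat p)"
    unfolding factor_def J0 using J_ideal[of e] by (intro bexI[of _ "J e"]) (auto simp: ideals_set_def)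
  fix k assume "Ppow k divides\<^bsub>ideals_set (OK K)\<^esub> PIdl\<^bsub>OK K\<^esub> (of_nat p)"
  then obtain I where I: "ideal I (OK K)" "J 0 = Ppow k \<cdot>\<^bsub>OK K\<^esub> I"
    unfolding factor_def J0 by (auto simp: ideals_set_def)
  have "x \<in> Ppow k \<cdot>\<^bsub>OK K\<^esub> I \<Longrightarrow> vge (int k) x" for x
  proof (induction rule: ideal_prod.induct)
    case (prod i j)
    have "vge (int k + 0) (i * j)" using prod Ppow_vge I by (intro vge_mult vge_O) (auto simp: OK_ideal_iff)
    then show ?case by simp
  qed (simp add: vge_add)
  moreover have "of_nat p \<in> J 0" using O_1 by force
  ultimately have "vge (int k) (of_nat p)" using I(2) by blast
  thus "k \<le> e" using p_nz val_p by (simp add: vge_def)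
qed

definition q where "q = residue_card K P"

text \<open>Since \<open>card\<close> of an infinite set is 0, the residue ring must first be seen
  to be finite, as a quotient of \<open>\<O>/p\<O>\<close>. The values \<open>r i\<close> for
  \<open>i \<ge> q\<close> are arbitrary elements of \<open>\<O>\<close>.\<close>

lemma residue_representatives:
  obtains r where "\<And>i. r i \<in> \<O>" "\<And>x. x \<in> \<O> \<Longrightarrow> \<exists>i<q. x - r i \<in> P"
    "\<And>i j. i < q \<Longrightarrow> j < q \<Longrightarrow> r i - r j \<in> P \<Longrightarrow> i = j"
proof -
  define coset where "coset a = (\<lambda>h. h + a) ` P" for a
  have coset_eq: "coset a = coset b \<longleftrightarrow> a - b \<in> P" if "a \<in> \<O>" "b \<in> \<O>" for a b
  proof
    assume "coset a = coset b"
    moreover have "0 + a \<in> coset a" unfolding coset_def using P_0 by blast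
    ultimately obtain h where "h \<in> P" "a = h + b" by (auto simp: coset_def)
    thus "a - b \<in> P" by simp
  next
    assume "a - b \<in> P"
    hence *: "h + (a - b) \<in> P" "h - (a - b) \<in> P" if "h \<in> P" for h using that P_add P_diff by auto
    have "h + a \<in> coset b" "h + b \<in> coset a" if "h \<in> P" for h
      using imageI[OF *(1)[OF that], of "\<lambda>h. h + b"] imageI[OF *(2)[OF that], of "\<lambda>h. h + a"]
      by (simp_all add: coset_def)
    thus "coset a = coset b" unfolding coset_def by blast
  qed
  have carr: "carrier (OK K Quot P) = coset ` \<O>"
    by (auto simp: FactRing_def A_RCOSETS_def' a_r_coset_def' coset_def image_def)
  obtain T where T: "finite T" "T \<subseteq> \<O>" "\<And>y. y \<in> \<O> \<Longrightarrow> \<exists>t\<in>T. \<exists>z\<in>\<O>. y = t + of_nat p * z"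
    using O_finite_mod_prime[OF prime_p] by blast
  have "coset ` \<O> \<subseteq> coset ` T"
  proof
    fix c assume "c \<in> coset ` \<O>"
    then obtain y where y: "y \<in> \<O>" "c = coset y" by blast
    then obtain t z where t: "t \<in> T" "z \<in> \<O>" "y = t + of_nat p * z" using T by blast
    hence "coset y = coset t" using coset_eq[of y t] y T pz_in_P by auto
    thus "c \<in> coset ` T" using t y by blast
  qed
  hence fin: "finite (coset ` \<O>)" using T finite_subset by blast
  obtain h where h: "bij_betw h {0..<q} (coset ` \<O>)"
    using ex_bij_betw_nat_finite[OF fin] carr unfolding q_def residue_card_def by auto
  have "\<exists>a\<in>\<O>. i < q \<longrightarrow> h i = coset a" for i
  proof -
    have "h i \<in> coset ` \<O>" if "i < q" using bij_betwE[OF h] that by simp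
    thus ?thesis using O_0 by blast
  qed
  then obtain r where r: "\<And>i. r i \<in> \<O>" "\<And>i. i < q \<Longrightarrow> h i = coset (r i)" by metis
  show ?thesis
  proof (rule that[of r])
    fix x assume "x \<in> \<O>"
    then obtain i where "i < q" "h i = coset x" 
      using h unfolding bij_betw_def by (metis (no_types, lifting) atLeastLessThan_iff imageE imageI)
    thus "\<exists>i<q. x - r i \<in> P" using r coset_eq[OF \<open>x \<in> \<O>\<close> r(1)] by metis
  next
    fix i j assume "i < q" "j < q" "r i - r j \<in> P"
    hence "h i = h j" using coset_eq r by metis
    thus "i = j" using h \<open>i < q\<close> \<open>j < q\<close> unfolding bij_betw_def inj_on_def by auto
  qed (use r in auto)
qed

definition res where "res = (SOME r. (\<forall>i. r i \<in> \<O>) \<and> (\<forall>x\<in>\<O>. \<exists>i<q. x - r i \<in> P) \<and>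
    (\<forall>i<q. \<forall>j<q. r i - r j \<in> P \<longrightarrow> i = j))"

lemma res_O: "res i \<in> \<O>" and res_ex: "x \<in> \<O> \<Longrightarrow> \<exists>i<q. x - res i \<in> P"
  and res_inj: "i < q \<Longrightarrow> j < q \<Longrightarrow> res i - res j \<in> P \<Longrightarrow> i = j"
proof -
  have "\<exists>r. (\<forall>i. r i \<in> \<O>) \<and> (\<forall>x\<in>\<O>. \<exists>i<q. x - r i \<in> P) \<and> (\<forall>i<q. \<forall>j<q. r i - r j \<in> P \<longrightarrow> i = j)"
    using residue_representatives by metis
  from someI_ex[OF this] show "res i \<in> \<O>" "x \<in> \<O> \<Longrightarrow> \<exists>i<q. x - res i \<in> P"
    "i < q \<Longrightarrow> j < q \<Longrightarrow> res i - res j \<in> P \<Longrightarrow> i = j"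
    unfolding res_def by blast+
qed

text \<open>The integers below \<open>p\<close> are incongruent modulo \<open>P\<close>. Hence
  \<open>q \<ge> 2\<close>, and primes exceeding \<open>n\<close> contribute nothing to the
  denominator.\<close>

lemma p_le_q: "p \<le> q"
proof -
  obtain f where f: "\<And>n::nat. f n < q \<and> of_nat n - res (f n) \<in> P" using res_ex[OF O_of_nat] by metis
  have "inj_on f {..<p}"
  proof (rule inj_onI)
    fix m n assume mn: "m \<in> {..<p}" "n \<in> {..<p}" "f m = f n"
    have "(of_nat m - res (f m)) - (of_nat n - res (f n)) \<in> P" using f P_diff by blast
    hence "of_int (int m - int n) \<in> P" using mn by simp
    hence "int p dvd int m - int n" by (simp only: of_int_in_P_iff)
    moreover have "\<bar>int m - int n\<bar> < int p" using mn by auto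
    ultimately show "m = n" using zdvd_not_zless[of "\<bar>int m - int n\<bar>" "int p"] by fastforce
  qed
  moreover have "f ` {..<p} \<subseteq> {..<q}" using f by blast
  ultimately have "card {..<p} \<le> card {..<q}" by (intro card_inj_on_le) auto
  thus ?thesis by simp
qed

lemma q_ge_2: "q \<ge> 2"
  using p_le_q prime_ge_2_nat[OF prime_p] by simp

subsection \<open>A very well distributed sequence\<close>

text \<open>Replace the base-\<open>q\<close> digits of \<open>n\<close> by residue representatives and \<open>q\<close> by the uniformizer.\<close>

primrec sq :: "nat \<Rightarrow> nat \<Rightarrow> 'a" where
  "sq 0 n = 0"
| "sq (Suc N) n = res (n mod q) + \<pi> * sq N (n div q)"

lemma sq_O: "sq N n \<in> \<O>"
  by (induction N arbitrary: n) (auto simp: O_0 res_O pi_O O_add O_mult)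

lemma vge_Suc_pi_iff: "x \<in> K \<Longrightarrow> vge (int (Suc k)) (\<pi> * x) \<longleftrightarrow> vge (int k) x"
  by (cases "x = 0") (auto simp: vge_def K_mult pi_K pi_nz val_mult val_pi K_0)

text \<open>This is the very good distribution of the sequence. Compare lowest digits: different
  ones give a difference outside \<open>P\<close>, equal ones leave \<open>\<pi>\<close> times the
  difference for the remaining digits. Only \<open>N\<close> digits are kept, whence
  \<open>k \<le> N\<close>.\<close>

lemma vge_sq_diff_iff:
  "k \<le> N \<Longrightarrow> vge (int k) (sq N m - sq N n) \<longleftrightarrow> m mod q ^ k = n mod q ^ k"
proof (induction k arbitrary: N m n)
  case 0
  show ?case using sq_O O_diff vge_O by simp
next
  case (Suc k)
  then obtain N' where N: "N = Suc N'" "k \<le> N'" by (cases N) auto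
  define D where "D = sq N' (m div q) - sq N' (n div q)"
  have D: "D \<in> \<O>" using sq_O O_diff by (simp add: D_def)
  have eq: "sq N m - sq N n = (res (m mod q) - res (n mod q)) + \<pi> * D"
    by (simp add: N D_def algebra_simps)
  have mods: "m mod q ^ Suc k = n mod q ^ Suc k \<longleftrightarrow> 
      m mod q = n mod q \<and> (m div q) mod q ^ k = (n div q) mod q ^ k"
  proof
    assume *: "m mod q ^ Suc k = n mod q ^ Suc k"
    have 1: "m mod q = n mod q" using arg_cong[OF *, of "\<lambda>x. x mod q"] by (simp add: mod_mod_cancel)
    thus "m mod q = n mod q \<and> (m div q) mod q ^ k = (n div q) mod q ^ k" 
      using * q_ge_2 by (simp add: mod_mult2_eq)
  qed (simp add: mod_mult2_eq)
  show ?case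
  proof (cases "m mod q = n mod q")
    case True
    hence "vge (int (Suc k)) (sq N m - sq N n) \<longleftrightarrow> vge (int k) D"
      unfolding eq using vge_Suc_pi_iff[OF O_K[OF D]] by simp
    then show ?thesis using Suc.IH[OF N(2)] mods True by (simp add: D_def)
  next
    case False
    have "\<not> vge (int (Suc k)) (sq N m - sq N n)"
    proof
      assume "vge (int (Suc k)) (sq N m - sq N n)"
      hence "vge 1 (sq N m - sq N n)" by (rule vge_mono) simp
      hence "sq N m - sq N n \<in> P" using vge_1_iff_P sq_O O_diff by blast
      hence "(sq N m - sq N n) - \<pi> * D \<in> P" using P_diff P_mult2 pi_P D by blast
      hence "res (m mod q) - res (n mod q) \<in> P" by (simp add: eq)
      thus False using res_inj False q_ge_2 by auto
    qed
    thus ?thesis using mods False by simp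
  qed
qed

text \<open>\<open>j\<close> is the number whose base-\<open>q\<close> digits are the first
  \<open>k\<close> digits of the expansion of \<open>x\<close> in powers of
  \<open>\<pi>\<close>.\<close>

lemma sq_approx:
  "k \<le> N \<Longrightarrow> vge 0 x \<Longrightarrow> \<exists>j<q ^ k. vge (int k) (x - sq N j)"
proof (induction k arbitrary: N x)
  case 0
  show ?case using 0 sq_O vge_diff vge_O by simp
next
  case (Suc k)
  then obtain N' where N: "N = Suc N'" "k \<le> N'" by (cases N) auto
  obtain y where y: "y \<in> \<O>" "vge 1 (x - y)" using vge_approx[OF Suc.prems(2)] by blast
  obtain i where i: "i < q" "y - res i \<in> P" using res_ex[OF y(1)] by blast
  have "vge 1 ((x - y) + (y - res i))" using y i vge_1_iff_P P_O by (intro vge_add) auto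
  hence x1: "vge 1 (x - res i)" by simp
  define x' where "x' = (x - res i) / \<pi>"
  have x': "x - res i = \<pi> * x'" using pi_nz by (simp add: x'_def)
  have x'K: "x' \<in> K" using x1 vge_K pi_K by (auto simp: x'_def K_divide)
  have "vge (int 0) x'" using vge_Suc_pi_iff[OF x'K, of 0] x1 x' by simp
  then obtain j' where j': "j' < q ^ k" "vge (int k) (x' - sq N' j')" using Suc.IH[OF N(2)] by auto
  define j where "j = i + q * j'"
  have j: "j mod q = i" "j div q = j'" using i by (auto simp: j_def)
  have "x - sq N j = \<pi> * (x' - sq N' j')" using x' by (simp add: N j algebra_simps)
  moreover have "x' - sq N' j' \<in> K" using x'K sq_O O_K K_diff by blast
  ultimately have "vge (int (Suc k)) (x - sq N j)" using vge_Suc_pi_iff j'(2) by simp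
  moreover have "j < q ^ Suc k"
  proof -
    have "j < q * Suc j'" using i by (simp add: j_def)
    also have "\<dots> \<le> q * q ^ k" using j' by (intro mult_le_mono2) auto
    finally show ?thesis by simp
  qed
  ultimately show ?case by blast
qed

lemma vge_sq_iff:
  assumes "k \<le> N" "vge 0 x"
  obtains j where "j < q ^ k" "\<And>i. vge (int k) (x - sq N i) \<longleftrightarrow> i mod q ^ k = j"
proof -
  obtain j where j: "j < q ^ k" "vge (int k) (x - sq N j)" using sq_approx[OF assms] by blast
  have "vge (int k) (x - sq N i) \<longleftrightarrow> i mod q ^ k = j" for i
  proof -
    have "vge (int k) (x - sq N i) \<longleftrightarrow> vge (int k) (sq N j - sq N i)"
      using vge_diff[OF j(2), of "sq N j - sq N i"] vge_diff[OF _ j(2), of "x - sq N i"]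
        vge_diff[of "int k" "x - sq N i" "x - sq N j"] vge_add[OF j(2), of "sq N j - sq N i"] 
      by (auto simp: algebra_simps)
    also have "\<dots> \<longleftrightarrow> i mod q ^ k = j" using vge_sq_diff_iff[OF assms(1)] j(1) by auto
    finally show ?thesis .
  qed
  thus ?thesis using that j(1) by blast
qed

text \<open>Legendre's count: a factor of valuation \<open>v\<close> is counted once for each level
  \<open>k\<close> from 1 to \<open>v\<close>. For fixed \<open>k\<close> the indices counted form a
  residue class modulo \<open>q^k\<close>, with at least \<open>n div q^k\<close> members below
  \<open>n\<close>.\<close>

lemma vge_prod_sq:
  assumes "n \<le> N" "x \<in> \<O>"
  shows "vge (int (w q n)) (\<Prod>i<n. x - sq N i)"
proof (cases "\<exists>i<n. x - sq N i = 0")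
  case True
  hence "(\<Prod>i<n. x - sq N i) = 0" by auto
  then show ?thesis using vge_zero by metis
next
  case False
  have K: "x - sq N i \<in> K" and O: "x - sq N i \<in> \<O>" for i using assms(2) sq_O O_diff O_K by auto
  have "w q n = (\<Sum>k=1..N. n div q ^ k)" using q_ge_2 assms(1) by (rule w_eq_sum)
  also have "\<dots> \<le> (\<Sum>k=1..N. card {i\<in>{..<n}. vge (int k) (x - sq N i)})"
  proof (rule sum_mono)
    fix k assume "k \<in> {1..N}"
    then obtain j where "j < q ^ k" "\<And>i. vge (int k) (x - sq N i) \<longleftrightarrow> i mod q ^ k = j"
      using vge_sq_iff[of k N x] vge_O[OF assms(2)] by auto
    thus "n div q ^ k \<le> card {i\<in>{..<n}. vge (int k) (x - sq N i)}"
      using card_residue_class_ge[of j "q ^ k" n] by simp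
  qed
  also have "\<dots> = (\<Sum>i<n. card {k\<in>{1..N}. vge (int k) (x - sq N i)})"
    by (rule sum_card_swap) auto
  \<comment> \<open>Only an inequality, because a factor may have valuation above the cutoff
    \<open>N\<close>.\<close>
  also have "\<dots> \<le> (\<Sum>i<n. nat (val (x - sq N i)))"
  proof (rule sum_mono)
    fix i assume "i \<in> {..<n}"
    hence "{k\<in>{1..N}. vge (int k) (x - sq N i)} \<subseteq> {1..nat (val (x - sq N i))}"
      using False by (auto simp: vge_def)
    from card_mono[OF _ this] show "card {k\<in>{1..N}. vge (int k) (x - sq N i)} \<le> nat (val (x - sq N i))"
      by simp
  qed
  finally have "int (w q n) \<le> int (\<Sum>i<n. nat (val (x - sq N i)))" by (simp only: of_nat_le_iff)
  also have "\<dots> = (\<Sum>i<n. val (x - sq N i))"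
    unfolding of_nat_sum using False O val_nonneg by (intro sum.cong refl) auto
  also have "\<dots> = val (\<Prod>i<n. x - sq N i)" using False K by (intro val_prod[symmetric]) auto
  finally show ?thesis using K by (auto simp: vge_def intro!: K_prod)
qed

text \<open>At the node \<open>n\<close> the count is exact. Since \<open>N < q^N\<close>, no factor
  reaches valuation \<open>N\<close>, so nothing is cut off; and the residue class at each level is
  that of \<open>n\<close>, which has at most \<open>n div q^k\<close> members below
  \<open>n\<close>.\<close>

lemma val_prod_sq:
  assumes "n \<le> N"
  shows "val (\<Prod>i<n. sq N n - sq N i) = int (w q n)" "(\<Prod>i<n. sq N n - sq N i) \<noteq> 0"
proof -
  have K: "sq N n - sq N i \<in> K" and O: "sq N n - sq N i \<in> \<O>" for i using sq_O O_diff O_K by auto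
  have "N < 2 ^ N" by (rule less_exp)
  also have "(2::nat) ^ N \<le> q ^ N" using q_ge_2 by (intro power_mono) auto
  finally have N: "N < q ^ N" .
  have notN: "\<not> vge (int N) (sq N n - sq N i)" if "i < n" for i
    using vge_sq_diff_iff[of N N n i] N that assms by simp
  have nz: "sq N n - sq N i \<noteq> 0" if "i < n" for i using notN[OF that] vge_zero by metis
  thus nz': "(\<Prod>i<n. sq N n - sq N i) \<noteq> 0" by simp
  have "val (\<Prod>i<n. sq N n - sq N i) = (\<Sum>i<n. val (sq N n - sq N i))"
    using nz K by (intro val_prod) auto
  also have "\<dots> = int (\<Sum>i<n. nat (val (sq N n - sq N i)))"
    unfolding of_nat_sum using nz O val_nonneg by (intro sum.cong refl) auto
  also have "(\<Sum>i<n. nat (val (sq N n - sq N i))) = (\<Sum>i<n. card {k\<in>{1..N}. vge (int k) (sq N n - sq N i)})"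
  proof (intro sum.cong refl)
    fix i assume "i \<in> {..<n}"
    hence i: "i < n" by simp
    have "val (sq N n - sq N i) < int N" using notN[OF i] K by (auto simp: vge_def)
    hence "{k\<in>{1..N}. vge (int k) (sq N n - sq N i)} = {1..nat (val (sq N n - sq N i))}"
      using nz[OF i] K by (auto simp: vge_def)
    thus "nat (val (sq N n - sq N i)) = card {k\<in>{1..N}. vge (int k) (sq N n - sq N i)}" by simp
  qed
  also have "\<dots> = (\<Sum>k=1..N. card {i\<in>{..<n}. vge (int k) (sq N n - sq N i)})"
    by (rule sum_card_swap[symmetric]) auto
  also have "\<dots> \<le> (\<Sum>k=1..N. n div q ^ k)"
  proof (rule sum_mono)
    fix k assume "k \<in> {1..N}"
    hence "vge (int k) (sq N n - sq N i) \<longleftrightarrow> i mod q ^ k = n mod q ^ k" for i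
      using vge_sq_diff_iff[of k N n i] by (metis atLeastAtMost_iff)
    hence "{i\<in>{..<n}. vge (int k) (sq N n - sq N i)} = {i. i < n \<and> i mod q ^ k = n mod q ^ k}"
      by simp
    thus "card {i\<in>{..<n}. vge (int k) (sq N n - sq N i)} \<le> n div q ^ k"
      using card_residue_class_le[of "q ^ k" n] q_ge_2 by simp
  qed
  also have "\<dots> = w q n" using w_eq_sum[OF q_ge_2 assms] by simp
  finally have "val (\<Prod>i<n. sq N n - sq N i) \<le> int (w q n)" by simp
  moreover have "vge (int (w q n)) (\<Prod>i<n. sq N n - sq N i)" using assms sq_O by (rule vge_prod_sq)
  ultimately show "val (\<Prod>i<n. sq N n - sq N i) = int (w q n)" using nz' by (simp add: vge_def)
qed

section \<open>Newton interpolation at the nodes\<close>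

definition newton :: "nat \<Rightarrow> nat \<Rightarrow> 'a poly" where
  "newton N m = (\<Prod>i<m. [:- sq N i, 1:])"

lemma poly_newton: "poly (newton N m) x = (\<Prod>i<m. x - sq N i)"
  by (simp add: newton_def poly_prod)

lemma degree_newton: "Polynomial.degree (newton N m) = m"
  unfolding newton_def by (subst degree_prod_eq_sum_degree) auto

lemma monic_newton: "Polynomial.coeff (newton N m) m = 1"
proof -
  have "Polynomial.lead_coeff (newton N m) = 1" unfolding newton_def by (rule monic_prod) auto
  thus ?thesis by (simp add: degree_newton)
qed

lemma coeff_newton_O: "Polynomial.coeff (newton N m) i \<in> \<O>"
proof (induction m arbitrary: i)
  case 0
  show ?case by (auto simp: newton_def coeff_1 O_0 O_1)
next
  case (Suc m)
  have "newton N (Suc m) = smult (- sq N m) (newton N m) + pCons 0 (newton N m)"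
    by (simp add: newton_def algebra_simps)
  thus ?case using Suc sq_O
    by (auto simp: coeff_pCons O_0 intro!: O_add O_diff O_mult O_uminus split: nat.splits)
qed

lemma newton_expansion:
  assumes "\<And>i. Polynomial.coeff g i \<in> K" "Polynomial.degree g \<le> n"
  shows "\<exists>c. (\<forall>m. c m \<in> K) \<and> g = (\<Sum>m\<le>n. smult (c m) (newton N m))"
  using assms
proof (induction n arbitrary: g)
  case 0
  then obtain a where "g = [:a:]" by (metis degree_eq_zeroE le_zero_eq)
  thus ?case using 0(1)[of 0] by (intro exI[of _ "\<lambda>_. a"]) (auto simp: newton_def)
next
  case (Suc n)
  define a where "a = Polynomial.coeff g (Suc n)"
  define g' where "g' = g - smult a (newton N (Suc n))"
  have "Polynomial.coeff g' i \<in> K" for i 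
    using Suc.prems(1) coeff_newton_O O_K by (auto simp: g'_def a_def intro!: K_diff K_mult)
  moreover have "Polynomial.degree g' \<le> n"
  proof (rule degree_le, intro allI impI)
    fix i assume "n < i"
    then consider "i = Suc n" | "i > Suc n" by linarith
    thus "Polynomial.coeff g' i = 0"
    proof cases
      case 1
      then show ?thesis by (simp add: g'_def a_def monic_newton)
    next
      case 2
      then show ?thesis using Suc.prems(2) by (simp add: g'_def coeff_eq_0 degree_newton)
    qed
  qed
  ultimately obtain c where c: "\<forall>m. c m \<in> K" "g' = (\<Sum>m\<le>n. smult (c m) (newton N m))"
    using Suc.IH by blast
  have "g = (\<Sum>m\<le>Suc n. smult ((c(Suc n := a)) m) (newton N m))"
    using c(2) by (simp add: g'_def diff_eq_eq)
  thus ?case using c(1) Suc.prems(1) a_def by (intro exI[of _ "c(Suc n := a)"]) auto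
qed

text \<open>At the node \<open>sq n m\<close> the later Newton terms vanish and the earlier ones are
  integral at \<open>P\<close> by induction, so \<open>c m\<close> times a product of valuation
  exactly \<open>w q m\<close> is integral there. Integral coefficients of the Newton polynomials
  and monotonicity of \<open>w q\<close> carry the bound over to ordinary coefficients.\<close>

lemma int_valued_coeff_vge:
  assumes "\<And>i. Polynomial.coeff g i \<in> K" "Polynomial.degree g \<le> n"
    and int: "\<And>x. x \<in> \<O> \<Longrightarrow> vge 0 (poly g x)"
  shows "vge (- int (w q n)) (Polynomial.coeff g i)"
proof -
  obtain c where cK: "\<And>m. c m \<in> K" and g: "g = (\<Sum>m\<le>n. smult (c m) (newton n m))"
    using newton_expansion[OF assms(1,2), of n] by blast
  have c: "m \<le> n \<Longrightarrow> vge (- int (w q m)) (c m)" for m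
  proof (induction m rule: less_induct)
    case (less m)
    define u where "u j = c j * (\<Prod>i<j. sq n m - sq n i)" for j
    have "poly g (sq n m) = (\<Sum>j\<le>n. u j)"
      by (simp add: g poly_sum poly_newton u_def)
    also have "\<dots> = (\<Sum>j\<le>m. u j)"
    proof (rule sum.mono_neutral_right)
      show "\<forall>j\<in>{..n} - {..m}. u j = 0" by (auto simp: u_def)
    qed (use less.prems in auto)
    also have "\<dots> = (\<Sum>j<m. u j) + u m" by (simp flip: lessThan_Suc_atMost)
    finally have "u m = poly g (sq n m) - (\<Sum>j<m. u j)" by simp
    moreover have "vge 0 (u j)" if "j < m" for j
    proof -
      have "vge (- int (w q j) + int (w q j)) (u j)"
        unfolding u_def using that less.prems less.IH by (intro vge_mult vge_prod_sq sq_O) auto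
      thus ?thesis by simp
    qed
    ultimately have "vge 0 (u m)" using int[OF sq_O] by (auto intro!: vge_diff vge_sum)
    hence "vge (- int (w q m) + val (\<Prod>i<m. sq n m - sq n i)) (c m * (\<Prod>i<m. sq n m - sq n i))"
      using val_prod_sq(1)[OF less.prems] by (simp add: u_def)
    moreover have "(\<Prod>i<m. sq n m - sq n i) \<in> K" using sq_O O_K by (intro K_prod K_diff) auto
    ultimately show ?case using vge_cancel cK val_prod_sq(2)[OF less.prems] by blast
  qed
  have "Polynomial.coeff g i = (\<Sum>m\<le>n. c m * Polynomial.coeff (newton n m) i)"
    by (simp add: g coeff_sum)
  also have "vge (- int (w q n)) \<dots>"
  proof (rule vge_sum)
    fix m assume "m \<in> {..n}"
    hence "vge (- int (w q m) + 0) (c m * Polynomial.coeff (newton n m) i)"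
      using c coeff_newton_O vge_O by (intro vge_mult) auto
    thus "vge (- int (w q n)) (c m * Polynomial.coeff (newton n m) i)"
      using w_mono[OF q_ge_2, of m n] \<open>m \<in> {..n}\<close> by (auto intro: vge_mono)
  qed
  finally show ?thesis .
qed

text \<open>The floor arises here: valuations of rational numbers are multiples of \<open>e\<close>,
  so an exponent \<open>v\<close> of \<open>p\<close> in the denominator satisfies
  \<open>v * e \<le> w q n\<close>.\<close>

lemma int_valued_coeff_multiplicity:
  assumes "f \<in> Int_Q K" "Polynomial.degree f \<le> n" 
    and "Polynomial.coeff f i = of_int a / of_int b" "Rings.coprime a b" "b \<noteq> 0"
  shows "multiplicity (int p) b \<le> w q n div e"
proof (cases "int p dvd b")
  case False
  then show ?thesis by (simp add: not_dvd_imp_multiplicity_0)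
next
  case True
  define v where "v = multiplicity (int p) b"
  have pa: "\<not> int p dvd a" using True assms(4) prime_p 
    by (metis coprime_common_divisor not_prime_unit prime_nat_int_transfer)
  have "\<exists>b'. b = int p ^ v * b' \<and> \<not> int p dvd b'"
    using multiplicity_decompose'[of b "int p"] assms(5) prime_p unfolding v_def
    by (metis not_prime_unit prime_nat_int_transfer)
  then obtain b' where b': "b = int p ^ v * b'" "\<not> int p dvd b'" by blast
  define g :: "'a poly" where "g = map_poly of_rat f"
  have "vge (- int (w q n)) (Polynomial.coeff g i)"
  proof (rule int_valued_coeff_vge)
    show "Polynomial.coeff g i \<in> K" for i by (simp add: g_def coeff_map_poly K_of_rat)
    show "Polynomial.degree g \<le> n" using assms(2) by (simp add: g_def degree_map_poly)
    show "vge 0 (poly g x)" if "x \<in> \<O>" for x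
      using assms(1) that by (auto simp: Int_Q_def g_def intro: vge_O)
  qed
  moreover have "Polynomial.coeff g i = of_int a / of_int b"
    by (simp add: g_def coeff_map_poly assms(3) of_rat_divide)
  moreover have nz: "a \<noteq> 0" "b' \<noteq> 0" using pa b' by auto
  moreover have "val (of_int a / of_int b) = - (int v * int e)"
  proof -
    have "val (of_int b) = int v * int e"
      using nz p_nz by (simp add: b' val_mult K_power K_of_nat K_of_int val_power val_p val_of_int_unit)
    thus ?thesis using nz assms(5) by (simp add: val_divide K_of_int val_of_int_unit pa)
  qed
  ultimately have "int v * int e \<le> int (w q n)" using assms(5) by (simp add: vge_def)
  hence "v * e \<le> w q n" by (simp flip: of_nat_mult)
  thus ?thesis using e_pos by (simp add: v_def less_eq_div_iff_mult_less_eq)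
qed

end

subsection \<open>The Galois group\<close>

lemma poly_eq_sum_atMost:
  fixes g :: "'b :: comm_semiring_1 poly"
  assumes "Polynomial.degree g \<le> n"
  shows "poly g x = (\<Sum>i\<le>n. Polynomial.coeff g i * x ^ i)"
  unfolding poly_altdef using assms
  by (intro sum.mono_neutral_left) (auto simp: coeff_eq_0)

context number_field_on
begin

lemma sub_ring_on_simps:
  "carrier (sub_ring_on A) = A" "x \<otimes>\<^bsub>sub_ring_on A\<^esub> y = x * y" "x \<oplus>\<^bsub>sub_ring_on A\<^esub> y = x + y"
  "\<one>\<^bsub>sub_ring_on A\<^esub> = 1"
  by (simp_all add: sub_ring_on_def ring_of_type_algebra_def)

text \<open>
  The values of an element of \<^const>\<open>aut_over_Q\<close> outside \<open>K\<close> are arbitrary. We normalise them, so that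
  composition is composition of total functions.
\<close>

definition G where "G = {\<sigma> \<in> aut_over_Q K. \<forall>x. x \<notin> K \<longrightarrow> \<sigma> x = x}"

lemma aut_over_Q_iff:
  "\<sigma> \<in> aut_over_Q K \<longleftrightarrow> bij_betw \<sigma> K K \<and> (\<forall>x\<in>K. \<forall>y\<in>K. \<sigma> (x + y) = \<sigma> x + \<sigma> y) \<and>
     (\<forall>x\<in>K. \<forall>y\<in>K. \<sigma> (x * y) = \<sigma> x * \<sigma> y) \<and> (\<forall>q. \<sigma> (of_rat q) = of_rat q)"
proof -
  have "bij_betw \<sigma> K K \<Longrightarrow> \<sigma> \<in> K \<rightarrow> K" using bij_betwE by blast
  moreover have "(\<forall>q. \<sigma> (of_rat q) = of_rat q) \<Longrightarrow> \<sigma> 1 = 1" by (metis of_rat_1)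
  ultimately show ?thesis
    unfolding aut_over_Q_def ring_iso_def Ring.ring_hom_def by (auto simp: sub_ring_on_simps)
qed

lemma G_iff:
  "\<sigma> \<in> G \<longleftrightarrow> bij_betw \<sigma> K K \<and> (\<forall>x\<in>K. \<forall>y\<in>K. \<sigma> (x + y) = \<sigma> x + \<sigma> y) \<and>
     (\<forall>x\<in>K. \<forall>y\<in>K. \<sigma> (x * y) = \<sigma> x * \<sigma> y) \<and> (\<forall>q. \<sigma> (of_rat q) = of_rat q) \<and> (\<forall>x. x \<notin> K \<longrightarrow> \<sigma> x = x)"
  by (auto simp: G_def aut_over_Q_iff)

lemma G_K: "\<sigma> \<in> G \<Longrightarrow> x \<in> K \<Longrightarrow> \<sigma> x \<in> K"
  and G_add: "\<sigma> \<in> G \<Longrightarrow> x \<in> K \<Longrightarrow> y \<in> K \<Longrightarrow> \<sigma> (x + y) = \<sigma> x + \<sigma> y"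
  and G_mult: "\<sigma> \<in> G \<Longrightarrow> x \<in> K \<Longrightarrow> y \<in> K \<Longrightarrow> \<sigma> (x * y) = \<sigma> x * \<sigma> y"
  and G_of_rat: "\<sigma> \<in> G \<Longrightarrow> \<sigma> (of_rat r) = of_rat r"
  and G_outside: "\<sigma> \<in> G \<Longrightarrow> x \<notin> K \<Longrightarrow> \<sigma> x = x"
  by (auto simp: G_iff bij_betwE)

lemma G_inj: "\<sigma> \<in> G \<Longrightarrow> \<sigma> x = \<sigma> y \<Longrightarrow> x = y"
  unfolding G_iff bij_betw_def inj_on_def by (metis imageI)

lemma G_0: "\<sigma> \<in> G \<Longrightarrow> \<sigma> 0 = 0" and G_1: "\<sigma> \<in> G \<Longrightarrow> \<sigma> 1 = 1"
  and G_of_int: "\<sigma> \<in> G \<Longrightarrow> \<sigma> (of_int k) = of_int k"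
  and G_of_nat: "\<sigma> \<in> G \<Longrightarrow> \<sigma> (of_nat m) = of_nat m"
  using G_of_rat[of \<sigma> 0] G_of_rat[of \<sigma> 1] G_of_rat[of \<sigma> "of_int k"] G_of_rat[of \<sigma> "of_nat m"] by auto

lemma G_eq_0_iff: "\<sigma> \<in> G \<Longrightarrow> \<sigma> x = 0 \<longleftrightarrow> x = 0"
  using G_inj G_0 by metis

lemma G_uminus: "\<sigma> \<in> G \<Longrightarrow> x \<in> K \<Longrightarrow> \<sigma> (- x) = - \<sigma> x"
  using G_add[of \<sigma> x "- x"] K_uminus[of x] G_0[of \<sigma>] by (simp add: eq_neg_iff_add_eq_0 add.commute)

lemma G_diff: "\<sigma> \<in> G \<Longrightarrow> x \<in> K \<Longrightarrow> y \<in> K \<Longrightarrow> \<sigma> (x - y) = \<sigma> x - \<sigma> y"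
  using G_add[of \<sigma> x "- y"] G_uminus[of \<sigma> y] K_uminus[of y] by simp

lemma G_inverse: "\<sigma> \<in> G \<Longrightarrow> x \<in> K \<Longrightarrow> \<sigma> (inverse x) = inverse (\<sigma> x)"
proof (cases "x = 0")
  case False
  assume *: "\<sigma> \<in> G" "x \<in> K"
  hence "\<sigma> x * \<sigma> (inverse x) = 1" using G_mult[of \<sigma> x "inverse x"] K_inverse G_1[OF *(1)] False by simp
  thus ?thesis by (rule inverse_unique[symmetric])
qed (simp add: G_0)

lemma G_divide: "\<sigma> \<in> G \<Longrightarrow> x \<in> K \<Longrightarrow> y \<in> K \<Longrightarrow> \<sigma> (x / y) = \<sigma> x / \<sigma> y"
  by (simp add: divide_inverse G_mult G_inverse K_inverse)

lemma G_power: "\<sigma> \<in> G \<Longrightarrow> x \<in> K \<Longrightarrow> \<sigma> (x ^ n) = \<sigma> x ^ n"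
  by (induction n) (auto simp: G_1 G_mult K_power)

lemma G_power_int: "\<sigma> \<in> G \<Longrightarrow> x \<in> K \<Longrightarrow> \<sigma> (x powi n) = \<sigma> x powi n"
  by (auto simp: power_int_def G_power G_inverse K_inverse)

lemma G_sum: "\<sigma> \<in> G \<Longrightarrow> (\<And>i. i \<in> A \<Longrightarrow> f i \<in> K) \<Longrightarrow> \<sigma> (sum f A) = (\<Sum>i\<in>A. \<sigma> (f i))"
  by (induction A rule: infinite_finite_induct) (auto simp: G_0 G_add K_sum)

lemma G_prod: "\<sigma> \<in> G \<Longrightarrow> (\<And>i. i \<in> A \<Longrightarrow> f i \<in> K) \<Longrightarrow> \<sigma> (prod f A) = (\<Prod>i\<in>A. \<sigma> (f i))"
  by (induction A rule: infinite_finite_induct) (auto simp: G_1 G_mult K_prod)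

lemma G_int_poly:
  assumes "\<sigma> \<in> G" "x \<in> K"
  shows "\<sigma> (poly (map_poly of_int r) x) = poly (map_poly of_int r) (\<sigma> x)"
  using assms by (simp add: poly_altdef G_sum K_mult K_power coeff_map_poly K_of_int G_mult G_of_int G_power)

lemma G_O: "\<sigma> \<in> G \<Longrightarrow> x \<in> \<O> \<Longrightarrow> \<sigma> x \<in> \<O>"
proof -
  assume *: "\<sigma> \<in> G" "x \<in> \<O>"
  then obtain r where r: "poly (map_poly of_int r) x = 0" "lead_coeff r = 1"
    by (auto simp: O_iff algebraic_int_altdef_ipoly)
  have "poly (map_poly of_int r) (\<sigma> x) = 0" using G_int_poly[OF *(1) O_K[OF *(2)], of r] r G_0[OF *(1)] by simp
  thus "\<sigma> x \<in> \<O>" using r G_K * by (auto simp: O_iff algebraic_int_altdef_ipoly)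
qed

text \<open>After scaling by \<open>m\<close>, all images of \<open>x\<close> are roots of the same
  integer polynomial.\<close>

lemma G_orbit_finite:
  assumes "x \<in> K"
  shows "finite ((\<lambda>\<sigma>. \<sigma> x) ` G)"
proof -
  obtain m :: int where m: "m > 0" "of_int m * x \<in> \<O>" using K_denominator[OF assms] by blast
  then obtain r where r: "poly (map_poly of_int r) (of_int m * x) = 0" "lead_coeff r = 1"
    by (auto simp: O_iff algebraic_int_altdef_ipoly)
  have "r \<noteq> 0" using r by auto
  hence "map_poly of_int r \<noteq> (0 :: 'a poly)" by (simp add: map_poly_eq_0_iff)
  hence fin: "finite {y :: 'a. poly (map_poly of_int r) y = 0}" by (rule poly_roots_finite)
  have "(\<lambda>\<sigma>. \<sigma> x) ` G \<subseteq> (\<lambda>y. y / of_int m) ` {y. poly (map_poly of_int r) y = 0}"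
  proof (intro subsetI, elim imageE)
    fix y \<sigma> assume y: "y = \<sigma> x" "\<sigma> \<in> G"
    have "poly (map_poly of_int r) (\<sigma> (of_int m * x)) = 0"
      using G_int_poly[OF y(2) O_K[OF m(2)], of r] r(1) G_0[OF y(2)] by simp
    moreover have "\<sigma> (of_int m * x) = of_int m * y" using y assms by (simp add: G_mult K_of_int G_of_int)
    ultimately show "y \<in> (\<lambda>y. y / of_int m) ` {y. poly (map_poly of_int r) y = 0}"
      using m(1) by (intro image_eqI[of _ _ "of_int m * y"]) auto
  qed
  thus ?thesis using fin finite_surj by blast
qed

text \<open>An element of \<open>G\<close> is determined by its values on a finite spanning set, by
  the normalisation also outside \<open>K\<close>; each of these values has a finite orbit.\<close>

lemma G_finite: "finite G"
proof -
  obtain B where B: "finite B" "K = qvec.span B" by (rule K_basis)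
  have BK: "b \<in> K" if "b \<in> B" for b using B qvec.span_base that by blast
  define \<Phi> where "\<Phi> \<sigma> = restrict \<sigma> B" for \<sigma> :: "'a \<Rightarrow> 'a"
  have "\<Phi> ` G \<subseteq> (\<Pi>\<^sub>E b\<in>B. (\<lambda>\<sigma>. \<sigma> b) ` G)" by (auto simp: \<Phi>_def)
  moreover have "finite (\<Pi>\<^sub>E b\<in>B. (\<lambda>\<sigma>. \<sigma> b) ` G)" using B(1) G_orbit_finite BK by (intro finite_PiE) auto
  ultimately have "finite (\<Phi> ` G)" by (rule finite_subset)
  moreover have "inj_on \<Phi> G"
  proof (rule inj_onI)
    fix \<sigma> \<tau> assume *: "\<sigma> \<in> G" "\<tau> \<in> G" "\<Phi> \<sigma> = \<Phi> \<tau>"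
    have eqB: "\<sigma> b = \<tau> b" if "b \<in> B" for b using fun_cong[OF *(3), of b] that by (simp add: \<Phi>_def)
    have "x \<in> K \<and> \<sigma> x = \<tau> x" if "x \<in> qvec.span B" for x
      using that
    proof (induction rule: qvec.span_induct_alt)
      case (step c x y)
      hence "x \<in> K" "of_rat c * x \<in> K" using BK K_of_rat K_mult by auto
      then show ?case using step eqB * by (simp add: G_add G_mult G_of_rat K_of_rat K_add)
    qed (simp add: G_0[OF *(1)] G_0[OF *(2)] K_0)
    thus "\<sigma> = \<tau>" using G_outside * B(2) by (metis ext)
  qed
  ultimately show ?thesis by (rule finite_imageD)
qed

lemma id_G: "id \<in> G"
  by (auto simp: G_iff)

lemma comp_G: "\<sigma> \<in> G \<Longrightarrow> \<tau> \<in> G \<Longrightarrow> \<sigma> \<circ> \<tau> \<in> G"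
proof -
  assume *: "\<sigma> \<in> G" "\<tau> \<in> G"
  hence "bij_betw (\<sigma> \<circ> \<tau>) K K" unfolding G_iff using bij_betw_trans by blast
  thus ?thesis unfolding G_iff[of "\<sigma> \<circ> \<tau>"] using * 
    by (auto simp: G_add G_mult G_of_rat G_outside G_K)
qed

text \<open>By finiteness, a submonoid of \<open>G\<close> is a subgroup.\<close>

lemma left_translation_bij:
  assumes "H \<subseteq> G" "\<And>\<sigma> \<tau>. \<sigma> \<in> H \<Longrightarrow> \<tau> \<in> H \<Longrightarrow> \<sigma> \<circ> \<tau> \<in> H" "\<sigma> \<in> H"
  shows "bij_betw (\<lambda>\<tau>. \<sigma> \<circ> \<tau>) H H"
proof -
  have "inj_on (\<lambda>\<tau>. \<sigma> \<circ> \<tau>) H"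
  proof (rule inj_onI)
    fix \<tau> \<rho> assume "\<sigma> \<circ> \<tau> = \<sigma> \<circ> \<rho>"
    hence "\<sigma> (\<tau> x) = \<sigma> (\<rho> x)" for x by (metis comp_apply)
    thus "\<tau> = \<rho>" using G_inj assms(1,3) by blast
  qed
  moreover have "(\<lambda>\<tau>. \<sigma> \<circ> \<tau>) ` H \<subseteq> H" using assms by blast
  moreover have "finite H" using G_finite assms(1) finite_subset by blast
  ultimately show ?thesis using endo_inj_surj unfolding bij_betw_def by blast
qed

lemma submonoid_inverse:
  assumes "H \<subseteq> G" "\<And>\<sigma> \<tau>. \<sigma> \<in> H \<Longrightarrow> \<tau> \<in> H \<Longrightarrow> \<sigma> \<circ> \<tau> \<in> H" "id \<in> H" "\<sigma> \<in> H"
  obtains \<tau> where "\<tau> \<in> H" "\<sigma> \<circ> \<tau> = id" "\<tau> \<circ> \<sigma> = id"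
proof -
  have "id \<in> (\<lambda>\<tau>. \<sigma> \<circ> \<tau>) ` H" using left_translation_bij[OF assms(1,2,4)] assms(3) by (simp add: bij_betw_def)
  then obtain \<tau> where t: "\<tau> \<in> H" "\<sigma> \<circ> \<tau> = id" by auto
  have "\<sigma> (\<tau> (\<sigma> x)) = \<sigma> x" for x using t(2) by (metis comp_apply id_apply)
  hence "\<tau> \<circ> \<sigma> = id" using G_inj assms(1,4) by fastforce
  thus ?thesis using that t by blast
qed

lemma G_surj_O:
  assumes "\<sigma> \<in> G" "x \<in> \<O>"
  obtains y where "y \<in> \<O>" "x = \<sigma> y"
proof -
  obtain \<tau> where "\<tau> \<in> G" "\<sigma> \<circ> \<tau> = id"
    by (rule submonoid_inverse[OF subset_refl comp_G id_G assms(1)])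
  thus ?thesis using that[of "\<tau> x"] G_O assms(2) by (metis comp_apply id_apply)
qed

definition trace where "trace x = (\<Sum>\<sigma>\<in>G. \<sigma> x)"

lemma trace_O: "x \<in> \<O> \<Longrightarrow> trace x \<in> \<O>"
  unfolding trace_def by (rule O_sum) (rule G_O)

lemma trace_Rats:
  assumes gal: "galois_over_Q K" and x: "x \<in> K"
  shows "trace x \<in> \<rat>"
proof -
  have tK: "trace x \<in> K" unfolding trace_def using x by (intro K_sum) (rule G_K)
  have "\<sigma> (trace x) = trace x" if s: "\<sigma> \<in> aut_over_Q K" for \<sigma>
  proof -
    \<comment> \<open>Only the normalised copy of \<open>\<sigma>\<close> lies in \<open>G\<close>,
      where left translation permutes the summands of the trace.\<close>
    define \<sigma>' where "\<sigma>' y = (if y \<in> K then \<sigma> y else y)" for y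
    have "bij_betw \<sigma>' K K" using s bij_betw_cong[of K \<sigma>' \<sigma> K] by (simp add: aut_over_Q_iff \<sigma>'_def)
    hence s': "\<sigma>' \<in> G" using s unfolding G_iff aut_over_Q_iff by (simp add: \<sigma>'_def K_add K_mult K_of_rat)
    have "\<sigma> (trace x) = \<sigma>' (trace x)" using tK by (simp add: \<sigma>'_def)
    also have "\<dots> = (\<Sum>\<tau>\<in>G. (\<sigma>' \<circ> \<tau>) x)" unfolding trace_def using s' x G_K by (simp add: G_sum)
    also have "\<dots> = trace x" unfolding trace_def
      by (rule sum.reindex_bij_betw[OF left_translation_bij]) (use comp_G s' in auto)
    finally show ?thesis .
  qed
  thus ?thesis using gal tK unfolding galois_over_Q_def by blast
qed

end

context prime_above
begin

section \<open>Congruences and the Frobenius map modulo \<open>P\<close>\<close>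

lemma P_prod_cong:
  assumes "\<And>i. i \<in> A \<Longrightarrow> f i \<in> \<O> \<and> g i \<in> \<O> \<and> f i - g i \<in> P"
  shows "prod f A - prod g A \<in> P"
  using assms
proof (induction A rule: infinite_finite_induct)
  case (insert x A)
  have "prod f (insert x A) - prod g (insert x A) = f x * (prod f A - prod g A) + (f x - g x) * prod g A"
    using insert by (simp add: algebra_simps)
  moreover have "f x * (prod f A - prod g A) \<in> P" using insert by (intro P_mult) auto
  moreover have "(f x - g x) * prod g A \<in> P" using insert by (intro P_mult2 O_prod) auto
  ultimately show ?case using P_add by simp
qed (auto simp: P_0)

lemma frobenius_add:
  assumes "a \<in> \<O>" "b \<in> \<O>"
  shows "(a + b) ^ p - a ^ p - b ^ p \<in> P"
proof -
  have "(a + b) ^ p = (\<Sum>k\<le>p. of_nat (p choose k) * a ^ k * b ^ (p - k))" by (rule binomial_ring)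
  also have "{..p} = insert 0 (insert p {1..<p})" using p_pos by auto
  also have "(\<Sum>k\<in>\<dots>. of_nat (p choose k) * a ^ k * b ^ (p - k)) = 
      b ^ p + (a ^ p + (\<Sum>k=1..<p. of_nat (p choose k) * a ^ k * b ^ (p - k)))"
    using p_pos by simp
  finally have "(a + b) ^ p - a ^ p - b ^ p = (\<Sum>k=1..<p. of_nat (p choose k) * a ^ k * b ^ (p - k))"
    by simp
  also have "\<dots> \<in> P"
  proof (intro P_sum P_mult2 O_power assms)
    fix k assume "k \<in> {1..<p}"
    hence "p dvd (p choose k)" using prime_p by (intro dvd_choose_prime) auto
    thus "of_nat (p choose k) \<in> P" by (simp add: of_nat_in_P_iff)
  qed
  finally show ?thesis .
qed

lemma P_powerD: "x \<in> \<O> \<Longrightarrow> x ^ n \<in> P \<Longrightarrow> x \<in> P"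
  using S_power[of x n] by (auto simp: S_def)

text \<open>If two representatives have congruent \<open>p\<close>-th powers, the
  \<open>p\<close>-th power of their difference lies in \<open>P\<close>, hence so does the
  difference. An injective self-map of the finite residue field is surjective.\<close>

lemma frobenius_surj:
  assumes "y \<in> \<O>"
  obtains x where "x \<in> \<O>" "x ^ p - y \<in> P"
proof -
  have "\<forall>i. \<exists>j<q. res i ^ p - res j \<in> P" using res_ex[OF O_power[OF res_O]] by blast
  then obtain f where f: "\<And>i::nat. f i < q \<and> res i ^ p - res (f i) \<in> P" by metis
  have "inj_on f {..<q}"
  proof (rule inj_onI)
    fix i j assume ij: "i \<in> {..<q}" "j \<in> {..<q}" "f i = f j"
    define d where "d = res i - res j"
    have d: "d \<in> \<O>" using res_O O_diff by (simp add: d_def)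
    have "res i ^ p - res j ^ p \<in> P" 
      using P_diff[of "res i ^ p - res (f i)" "res j ^ p - res (f j)"] f[of i] f[of j] ij(3) by simp
    moreover have "(res j + d) ^ p - res j ^ p - d ^ p \<in> P" using frobenius_add res_O d by blast
    ultimately have "d ^ p \<in> P" using P_diff[of "res i ^ p - res j ^ p" "res i ^ p - res j ^ p - d ^ p"] by (simp add: d_def)
    hence "d \<in> P" using P_powerD d by blast
    thus "i = j" using res_inj ij by (simp add: d_def)
  qed
  moreover have "f ` {..<q} \<subseteq> {..<q}" using f by blast
  ultimately have surj: "f ` {..<q} = {..<q}" by (intro endo_inj_surj) auto
  obtain k where k: "k < q" "y - res k \<in> P" using res_ex[OF assms] by blast
  then obtain i where "k = f i" using surj by blast
  hence "(res i ^ p - res k) - (y - res k) \<in> P" using f k P_diff by blast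
  thus ?thesis using that[of "res i"] res_O by simp
qed

subsection \<open>Independence of characters modulo a prime\<close>

text \<open>Artin's argument for characters of the multiplicative monoid \<open>\<O>\<close> with
  values in the domain \<open>\<O>/P\<close>. Different indices may give the same character modulo
  \<open>P\<close>, so what vanishes is the sum of the coefficients over a congruence class.\<close>

lemma independence_of_characters:
  fixes \<chi> :: "'i \<Rightarrow> 'a \<Rightarrow> 'a"
  assumes "finite A" "j \<in> A"
    and \<chi>O: "\<And>i m. m \<in> \<O> \<Longrightarrow> i \<in> A \<Longrightarrow> \<chi> i m \<in> \<O>" 
    and \<chi>_mult: "\<And>i m n. i \<in> A \<Longrightarrow> m \<in> \<O> \<Longrightarrow> n \<in> \<O> \<Longrightarrow> \<chi> i (m * n) = \<chi> i m * \<chi> i n"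
    and \<chi>_1: "\<And>i. i \<in> A \<Longrightarrow> \<chi> i 1 = 1"
    and "\<And>i. i \<in> A \<Longrightarrow> c i \<in> \<O>"
    and "\<And>m. m \<in> \<O> \<Longrightarrow> (\<Sum>i\<in>A. c i * \<chi> i m) \<in> P"
  shows "(\<Sum>i | i \<in> A \<and> (\<forall>m\<in>\<O>. \<chi> i m - \<chi> j m \<in> P). c i) \<in> P"
  using assms
proof (induction A arbitrary: c rule: finite_psubset_induct)
  case (psubset A)
  note j = psubset.prems(1) and \<chi>O = psubset.prems(2) and \<chi>_mult = psubset.prems(3) 
    and \<chi>_1 = psubset.prems(4) and cO = psubset.prems(5) and c = psubset.prems(6)
  define cng where "cng i k \<longleftrightarrow> (\<forall>m\<in>\<O>. \<chi> i m - \<chi> k m \<in> P)" for i k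
  have cng_sym: "cng i k \<Longrightarrow> cng k i" for i k unfolding cng_def using P_uminus by (metis minus_diff_eq)
  have cng_trans: "cng i k \<Longrightarrow> cng k l \<Longrightarrow> cng i l" for i k l 
    unfolding cng_def using P_add by (metis diff_add_cancel add_diff_eq)
  have "(\<Sum>i | i \<in> A \<and> cng i j. c i) \<in> P"
  proof (cases "\<forall>k\<in>A. cng k j")
    case True
    hence "{i. i \<in> A \<and> cng i j} = A" by blast
    moreover have "(\<Sum>i\<in>A. c i) = (\<Sum>i\<in>A. c i * \<chi> i 1)" using \<chi>_1 by (intro sum.cong) auto
    ultimately show ?thesis using c[OF O_1] by simp
  next
    case False
    then obtain k where k: "k \<in> A" "\<not> cng k j" by blast
    hence "\<not> cng j k" using cng_sym by blast
    then obtain m0 where m0: "m0 \<in> \<O>" "\<chi> j m0 - \<chi> k m0 \<notin> P" unfolding cng_def by blast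
    \<comment> \<open>Evaluate the relation at \<open>m0 * m\<close> and subtract
      \<open>\<chi> k m0\<close> times the relation at \<open>m\<close>. The new coefficients vanish
      modulo \<open>P\<close> on the class of \<open>k\<close>, so induction applies to the rest; on
      the class of \<open>j\<close> they are congruent to the old ones times a fixed factor outside
      \<open>P\<close>.\<close>
    define c' where "c' i = c i * (\<chi> i m0 - \<chi> k m0)" for i
    define A' where "A' = {i \<in> A. \<not> cng i k}"
    have c'O: "c' i \<in> \<O>" if "i \<in> A" for i using that cO \<chi>O m0 k by (auto simp: c'_def intro!: O_mult O_diff)
    have "cng k k" by (simp add: cng_def P_0)
    hence A': "A' \<subset> A" "j \<in> A'" using k j \<open>\<not> cng j k\<close> by (auto simp: A'_def)
    have P': "(\<Sum>i\<in>A'. c' i * \<chi> i m) \<in> P" if m: "m \<in> \<O>" for m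
    proof -
      have "(\<Sum>i\<in>A. c' i * \<chi> i m) = (\<Sum>i\<in>A. c i * \<chi> i (m0 * m)) - \<chi> k m0 * (\<Sum>i\<in>A. c i * \<chi> i m)"
        unfolding sum_distrib_left sum_subtractf[symmetric]
        by (intro sum.cong refl) (simp add: c'_def \<chi>_mult m m0 algebra_simps)
      moreover have "\<dots> \<in> P" using c m m0 k \<chi>O O_mult by (intro P_diff P_mult) auto
      moreover have "(\<Sum>i\<in>A. c' i * \<chi> i m) = (\<Sum>i\<in>A'. c' i * \<chi> i m) + (\<Sum>i\<in>A-A'. c' i * \<chi> i m)"
        using psubset.hyps(1) A'(1) by (subst sum.subset_diff[of A' A]) (auto simp: add.commute)
      moreover have "(\<Sum>i\<in>A-A'. c' i * \<chi> i m) \<in> P"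
      proof (rule P_sum)
        fix i assume "i \<in> A - A'"
        hence "i \<in> A" "\<chi> i m0 - \<chi> k m0 \<in> P" using m0 by (auto simp: A'_def cng_def)
        thus "c' i * \<chi> i m \<in> P" unfolding c'_def using cO \<chi>O m by (intro P_mult2 P_mult) auto
      qed
      ultimately show ?thesis using P_diff by (metis add_diff_cancel_right')
    qed
    have "(\<Sum>i | i \<in> A' \<and> (\<forall>m\<in>\<O>. \<chi> i m - \<chi> j m \<in> P). c' i) \<in> P"
      by (rule psubset.IH[OF A']) (use A' \<chi>O \<chi>_mult \<chi>_1 c'O P' in auto)
    moreover have "{i. i \<in> A' \<and> (\<forall>m\<in>\<O>. \<chi> i m - \<chi> j m \<in> P)} = {i. i \<in> A \<and> cng i j}"
      using A'(2) cng_trans cng_sym unfolding A'_def cng_def[symmetric] by blast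
    ultimately have 1: "(\<Sum>i | i \<in> A \<and> cng i j. c' i) \<in> P" by simp
    have "(\<Sum>i | i \<in> A \<and> cng i j. c i * (\<chi> i m0 - \<chi> j m0)) \<in> P"
      using cO m0 by (intro P_sum P_mult) (auto simp: cng_def)
    from P_diff[OF 1 this] have "(\<Sum>i | i \<in> A \<and> cng i j. c i * (\<chi> j m0 - \<chi> k m0)) \<in> P"
      by (simp add: c'_def algebra_simps sum_subtractf[symmetric])
    hence "(\<Sum>i | i \<in> A \<and> cng i j. c i) * (\<chi> j m0 - \<chi> k m0) \<in> P" by (simp add: sum_distrib_right)
    thus ?thesis using m0 j k \<chi>O cO by (auto dest!: P_multD[rotated 2] intro!: O_sum O_diff)
  qed
  thus ?case by (simp add: cng_def)
qed

subsection \<open>The inertia group\<close>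

definition inertia where "inertia = {\<sigma>\<in>G. \<forall>x\<in>\<O>. \<sigma> x - x \<in> P}"

lemma inertia_G: "\<sigma> \<in> inertia \<Longrightarrow> \<sigma> \<in> G" and inertia_P: "\<sigma> \<in> inertia \<Longrightarrow> x \<in> \<O> \<Longrightarrow> \<sigma> x - x \<in> P"
  by (auto simp: inertia_def)

lemma inertia_id: "id \<in> inertia"
  by (simp add: inertia_def id_G P_0)

lemma inertia_comp: "\<sigma> \<in> inertia \<Longrightarrow> \<tau> \<in> inertia \<Longrightarrow> \<sigma> \<circ> \<tau> \<in> inertia"
proof -
  assume *: "\<sigma> \<in> inertia" "\<tau> \<in> inertia"
  have "(\<sigma> \<circ> \<tau>) x - x \<in> P" if x: "x \<in> \<O>" for x
  proof -
    have "(\<sigma> (\<tau> x) - \<tau> x) + (\<tau> x - x) \<in> P"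
      using * x inertia_G G_O inertia_P by (intro P_add) auto
    thus ?thesis by simp
  qed
  moreover have "\<sigma> \<circ> \<tau> \<in> G" using * by (intro comp_G inertia_G)
  ultimately show ?thesis unfolding inertia_def by blast
qed

text \<open>The inertia group is the congruence class of \<open>id\<close> among the characters in
  \<open>G\<close>, and on it \<open>\<sigma> c\<close> is congruent to \<open>c\<close>. If all the
  traces lay in \<open>P\<close>, then so would \<open>card inertia\<close> times
  \<open>c\<close>.\<close>

lemma trace_notin_P:
  assumes "\<not> p dvd card inertia" "c \<in> S"
  obtains \<beta> where "\<beta> \<in> \<O>" "trace (c * \<beta>) \<notin> P"
proof -
  have "\<exists>\<beta>\<in>\<O>. trace (c * \<beta>) \<notin> P"
  proof (rule ccontr)
    assume *: "\<not> ?thesis"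
    have cO: "c \<in> \<O>" using assms S_O by blast
    have "(\<Sum>\<sigma> | \<sigma> \<in> G \<and> (\<forall>m\<in>\<O>. \<sigma> m - id m \<in> P). \<sigma> c) \<in> P"
    proof (rule independence_of_characters[of G id "\<lambda>\<sigma>. \<sigma>"])
      fix m assume m: "m \<in> \<O>"
      have "(\<Sum>\<sigma>\<in>G. \<sigma> c * \<sigma> m) = trace (c * m)"
        unfolding trace_def using cO m O_K by (intro sum.cong refl) (simp add: G_mult)
      thus "(\<Sum>\<sigma>\<in>G. \<sigma> c * \<sigma> m) \<in> P" using * m by simp
    qed (use G_finite id_G G_O G_mult G_1 O_K cO in auto)
    moreover have "{\<sigma>. \<sigma> \<in> G \<and> (\<forall>m\<in>\<O>. \<sigma> m - id m \<in> P)} = inertia" by (auto simp: inertia_def)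
    ultimately have "(\<Sum>\<sigma>\<in>inertia. \<sigma> c) \<in> P" by simp
    moreover have "(\<Sum>\<sigma>\<in>inertia. \<sigma> c - c) \<in> P" using inertia_P cO by (intro P_sum) auto
    ultimately have "(\<Sum>\<sigma>\<in>inertia. \<sigma> c) - (\<Sum>\<sigma>\<in>inertia. \<sigma> c - c) \<in> P" using P_diff by blast
    hence "of_nat (card inertia) * c \<in> P" by (simp add: sum_subtractf)
    hence "of_nat (card inertia) \<in> P" using P_multD[OF O_of_nat cO] assms(2) P_notin_S by blast
    thus False using assms(1) of_nat_in_P_iff by blast
  qed
  thus ?thesis using that by blast
qed

lemma inertia_S: "\<sigma> \<in> inertia \<Longrightarrow> s \<in> S \<Longrightarrow> \<sigma> s \<in> S"
  using inertia_P[of \<sigma> s] inertia_G[of \<sigma>] G_O[of \<sigma> s] P_diff[of "\<sigma> s" "\<sigma> s - s"] by (auto simp: S_def)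

lemma inertia_inverse:
  assumes "\<sigma> \<in> inertia"
  obtains \<tau> where "\<tau> \<in> inertia" "\<sigma> \<circ> \<tau> = id" "\<tau> \<circ> \<sigma> = id"
  using submonoid_inverse[of inertia \<sigma>] inertia_G inertia_comp inertia_id assms by blast

text \<open>Writing \<open>x\<close> as a unit times a power of \<open>\<pi>\<close> shows that
  \<open>\<sigma>\<close> multiplies valuations by \<open>val (\<sigma> \<pi>)\<close>, a positive
  integer. The inverse of \<open>\<sigma>\<close> has such a factor too, and the two multiply to
  1.\<close>

lemma inertia_val:
  assumes s: "\<sigma> \<in> inertia" and x: "x \<in> K" "x \<noteq> 0"
  shows "val (\<sigma> x) = val x"
proof -
  have *: "val (\<sigma> x) = val x * val (\<sigma> \<pi>)" if s: "\<sigma> \<in> inertia" and x: "x \<in> K" "x \<noteq> 0" for \<sigma> x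
  proof -
    note g = inertia_G[OF s]
    obtain a b where ab: "a \<in> S" "b \<in> S" "a * x = b * \<pi> powi val x" using val_decompose[OF x] by blast
    have K: "a \<in> K" "b \<in> K" "\<pi> \<in> K" using ab S_O O_K pi_K by auto
    have "\<sigma> a * \<sigma> x = \<sigma> b * \<sigma> \<pi> powi val x"
      using arg_cong[OF ab(3), of \<sigma>] K x g by (simp add: G_mult G_power_int K_power_int)
    hence "val (\<sigma> a * \<sigma> x) = val (\<sigma> b * \<sigma> \<pi> powi val x)" by simp
    moreover have "\<sigma> a \<in> S" "\<sigma> b \<in> S" using inertia_S s ab by auto
    moreover have "\<sigma> a \<in> K" "\<sigma> b \<in> K" "\<sigma> \<pi> \<in> K" "\<sigma> x \<in> K" "\<sigma> \<pi> \<noteq> 0" "\<sigma> x \<noteq> 0"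
      using K x g pi_nz by (auto simp: G_K G_eq_0_iff)
    ultimately show ?thesis
      by (simp add: val_mult S_nz val_S K_power_int val_power_int)
  qed
  obtain \<tau> where t: "\<tau> \<in> inertia" "\<sigma> \<circ> \<tau> = id" using inertia_inverse[OF s] by blast
  have pos: "val (\<rho> \<pi>) > 0" if "\<rho> \<in> inertia" for \<rho>
  proof -
    have "\<rho> \<pi> - \<pi> + \<pi> \<in> P" using inertia_P[OF that pi_O] pi_P by (rule P_add)
    hence "vge 1 (\<rho> \<pi>)" using vge_1_iff_P P_O by simp
    moreover have "\<rho> \<pi> \<noteq> 0" using that inertia_G pi_nz by (simp add: G_eq_0_iff)
    ultimately show ?thesis by (simp add: vge_def)
  qed
  have "val (\<sigma> (\<tau> \<pi>)) = val (\<tau> \<pi>) * val (\<sigma> \<pi>)"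
    using t inertia_G pi_K pi_nz by (intro * s) (auto simp: G_K G_eq_0_iff)
  moreover have "\<sigma> (\<tau> \<pi>) = \<pi>" using t(2) by (metis comp_apply id_apply)
  ultimately have "val (\<tau> \<pi>) * val (\<sigma> \<pi>) = 1" by (simp add: val_pi)
  hence "val (\<sigma> \<pi>) = 1" using pos[OF s] pos[OF t(1)] by (simp add: pos_zmult_eq_1_iff)
  thus ?thesis using *[OF s x] by simp
qed

lemma inertia_vge: "\<sigma> \<in> inertia \<Longrightarrow> vge k x \<Longrightarrow> vge k (\<sigma> x)"
  using inertia_val[of \<sigma> x] inertia_G[of \<sigma>] G_K[of \<sigma> x] G_0[of \<sigma>] 
  by (cases "x = 0") (auto simp: vge_def)

text \<open>
  A subgroup \<open>H\<close> of order \<open>p\<close> of the inertia group fixes a field which has residue field \<open>\<O>/P\<close>, by taking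
  norms of \<open>p\<close>-th roots, and, if \<open>p\<close> does not divide \<open>e\<close>, contains an element of valuation 1. 
  If \<open>\<tau> \<in> H\<close> moved something, take \<open>y\<close> with \<open>\<tau> y - y\<close> of least valuation and subtract from \<open>y\<close> a
  fixed element with the same residue.
\<close>

lemma card_inertia:
  assumes tame: "\<not> p dvd e"
  shows "\<not> p dvd card inertia"
proof
  assume pd: "p dvd card inertia"
  define Gr where "Gr = \<lparr>carrier = inertia, monoid.mult = (\<circ>), one = (id :: 'a \<Rightarrow> 'a)\<rparr>"
  have gr: "group Gr"
  proof (rule groupI)
    fix x assume "x \<in> carrier Gr"
    then obtain y where "y \<in> inertia" "y \<circ> x = id" 
      using inertia_inverse[of x] by (auto simp: Gr_def)
    thus "\<exists>y\<in>carrier Gr. y \<otimes>\<^bsub>Gr\<^esub> x = \<one>\<^bsub>Gr\<^esub>" by (auto simp: Gr_def)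
  qed (auto simp: Gr_def inertia_comp inertia_id)
  have fin: "finite inertia" using G_finite by (simp add: inertia_def)
  \<comment> \<open>With exponent 1, Sylow's theorem is Cauchy's theorem and gives a subgroup of
    order \<open>p\<close>.\<close>
  obtain m where "card inertia = p ^ 1 * m" using pd by auto
  hence "\<exists>H. subgroup H Gr \<and> card H = p ^ 1"
    using prime_p gr fin by (intro sylow_thm[of _ _ _ m]) (auto simp: Coset.order_def Gr_def)
  then obtain H where H: "subgroup H Gr" "card H = p" by auto
  have HI: "H \<subseteq> inertia" using subgroup.subset[OF H(1)] by (simp add: Gr_def)
  have HG: "H \<subseteq> G" using HI inertia_G by blast
  have H_comp: "\<sigma> \<circ> \<tau> \<in> H" if "\<sigma> \<in> H" "\<tau> \<in> H" for \<sigma> \<tau>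
    using subgroup.m_closed[OF H(1) that] by (simp add: Gr_def)
  have finH: "finite H" using fin HI finite_subset by blast
  define N where "N x = (\<Prod>\<tau>\<in>H. \<tau> x)" for x
  define F where "F = {x\<in>K. \<forall>\<sigma>\<in>H. \<sigma> x = x}"
  have N_F: "N x \<in> F" if x: "x \<in> K" for x
  proof -
    have "\<sigma> (N x) = N x" if s: "\<sigma> \<in> H" for \<sigma>
    proof -
      have "\<sigma> (N x) = (\<Prod>\<tau>\<in>H. (\<sigma> \<circ> \<tau>) x)" unfolding N_def using s HG G_K x by (subst G_prod) auto
      also have "\<dots> = N x" unfolding N_def
        by (rule prod.reindex_bij_betw[OF left_translation_bij[OF HG H_comp s]])
      finally show ?thesis .
    qed
    moreover have "N x \<in> K" unfolding N_def using x HG G_K by (intro K_prod) auto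
    ultimately show ?thesis by (simp add: F_def)
  qed
  have F_residue: "\<exists>l\<in>F. vge 1 (y - l)" if y: "vge 0 y" for y
  proof -
    obtain y0 where y0: "y0 \<in> \<O>" "vge 1 (y - y0)" using vge_approx[OF y] by blast
    obtain x where x: "x \<in> \<O>" "x ^ p - y0 \<in> P" using frobenius_surj[OF y0(1)] by blast
    have "(\<Prod>\<tau>\<in>H. \<tau> x) - (\<Prod>\<tau>\<in>H. x) \<in> P"
      using x(1) HI inertia_P HG G_O by (intro P_prod_cong) auto
    hence "N x - x ^ p \<in> P" using H(2) by (simp add: N_def)
    hence "(N x - x ^ p) + (x ^ p - y0) \<in> P" using x(2) by (rule P_add)
    hence "N x - y0 \<in> P" by simp
    hence "vge 1 (N x - y0)" using vge_1_iff_P P_O by blast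
    hence "vge 1 ((y - y0) - (N x - y0))" by (rule vge_diff[OF y0(2)])
    thus ?thesis using N_F[OF O_K[OF x(1)]] by auto
  qed
  have N_pi: "N \<pi> \<noteq> 0" "val (N \<pi>) = int p" "N \<pi> \<in> F"
  proof -
    have nz: "\<tau> \<pi> \<noteq> 0" "\<tau> \<pi> \<in> K" "val (\<tau> \<pi>) = 1" if "\<tau> \<in> H" for \<tau> 
      using that HG HI pi_nz pi_K inertia_val[of \<tau> \<pi>] val_pi by (auto simp: G_eq_0_iff G_K)
    show "N \<pi> \<noteq> 0" using nz finH by (simp add: N_def)
    show "val (N \<pi>) = int p" unfolding N_def using nz finH H(2) by (subst val_prod) auto
    show "N \<pi> \<in> F" using N_F pi_K by blast
  qed
  \<comment> \<open>The norm of \<open>\<pi>\<close> has valuation \<open>p\<close>, the rational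
    number \<open>p\<close> has valuation \<open>e\<close>, and \<open>H\<close> fixes both. By
    coprimality a product of their powers has valuation 1.\<close>
  have "Rings.coprime (int p) (int e)" using prime_p tame by (intro prime_imp_coprime) auto
  hence "gcd (int p) (int e) = 1" by (simp add: coprime_iff_gcd_eq_1)
  then obtain a b where ab: "a * int p + b * int e = 1" using bezout_int[of "int p" "int e"] by metis
  define u where "u = N \<pi> powi a * of_nat p powi b"
  have NK: "N \<pi> \<in> K" using N_pi(3) by (simp add: F_def)
  have uK: "u \<in> K" using NK by (auto simp: u_def intro!: K_mult K_power_int K_of_nat)
  have u_nz: "u \<noteq> 0" using N_pi(1) p_nz by (simp add: u_def)
  have u_val: "val u = 1" 
    using ab N_pi NK p_nz by (simp add: u_def val_mult val_power_int val_p K_power_int K_of_nat)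
  have u_fix: "\<sigma> u = u" if "\<sigma> \<in> H" for \<sigma>
  proof -
    have "\<sigma> (N \<pi>) = N \<pi>" "\<sigma> \<in> G" using N_pi(3) that HG by (auto simp: F_def)
    thus ?thesis using NK by (simp add: u_def G_mult G_power_int K_power_int K_of_nat G_of_nat)
  qed
  obtain \<tau> where t: "\<tau> \<in> H" "\<tau> \<noteq> id"
  proof -
    have "\<not> H \<subseteq> {id}"
    proof
      assume "H \<subseteq> {id}"
      hence "card H \<le> card {id :: 'a \<Rightarrow> 'a}" by (intro card_mono) auto
      thus False using H(2) prime_ge_2_nat[OF prime_p] by simp
    qed
    thus ?thesis using that by blast
  qed
  have tG: "\<tau> \<in> G" and tI: "\<tau> \<in> inertia" using t HG HI by auto
  \<comment> \<open>Restricting to \<open>y\<close> integral at \<open>P\<close> makes the valuation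
    of \<open>\<tau> y - y\<close> nonnegative, so that a least one exists.\<close>
  define Q where "Q y \<longleftrightarrow> vge 0 y \<and> \<tau> y \<noteq> y" for y
  have "\<exists>y. Q y"
  proof -
    obtain x where x: "\<tau> x \<noteq> x" using t(2) by (metis ext id_apply)
    hence xK: "x \<in> K" using G_outside[OF tG] by blast
    obtain m :: int where m: "m > 0" "of_int m * x \<in> \<O>" using K_denominator[OF xK] by blast
    have "\<tau> (of_int m * x) = of_int m * \<tau> x" using tG xK by (simp add: G_mult K_of_int G_of_int)
    hence "Q (of_int m * x)" using x m vge_O by (simp add: Q_def)
    thus ?thesis by blast
  qed
  then obtain y0 where "Q y0" ..
  from ex_has_least_nat[of Q y0 "\<lambda>y. nat (val (\<tau> y - y))", OF this]
  obtain y where y: "Q y" "\<And>y'. Q y' \<Longrightarrow> nat (val (\<tau> y - y)) \<le> nat (val (\<tau> y' - y'))" by blast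
  have yv: "vge 0 y" "\<tau> y \<noteq> y" using y(1) by (auto simp: Q_def)
  obtain l where l: "l \<in> F" "vge 1 (y - l)" using F_residue[OF yv(1)] by blast
  have K: "y \<in> K" "l \<in> K" "\<tau> l = l" using yv vge_K l t(1) by (auto simp: F_def)
  \<comment> \<open>As \<open>\<tau>\<close> fixes \<open>l\<close> and \<open>u\<close>,
    \<open>\<tau> y - y = (\<tau> r - r) * u\<close>. So \<open>r\<close> competes with
    \<open>y\<close>, with a valuation smaller by one.\<close>
  define r where "r = (y - l) / u"
  have rK: "r \<in> K" using K uK by (simp add: r_def K_diff K_divide)
  have "vge (0 + val u) (r * u)" using l(2) u_nz u_val by (simp add: r_def)
  hence r0: "vge 0 r" using rK uK u_nz vge_cancel by blast
  have eq: "\<tau> y - y = (\<tau> r - r) * u"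
  proof -
    have "\<tau> r = (\<tau> y - l) / u" using K uK tG u_fix[OF t(1)] by (simp add: r_def G_divide G_diff K_diff)
    thus ?thesis using u_nz by (simp add: r_def field_simps)
  qed
  hence rn: "\<tau> r \<noteq> r" using yv(2) by auto
  hence "Q r" using r0 by (simp add: Q_def)
  have "val (\<tau> y - y) = val (\<tau> r - r) + 1"
    unfolding eq using rn rK tG uK u_nz u_val by (simp add: val_mult K_diff G_K)
  moreover have "val (\<tau> r - r) \<ge> 0"
    using vge_diff[OF inertia_vge[OF tI r0] r0] rn by (simp add: vge_def)
  ultimately show False using y(2)[OF \<open>Q r\<close>] by simp
qed

subsection \<open>Integer-valued polynomials with large denominators\<close>

text \<open>Such a \<open>y\<close> is divisible by \<open>p^k\<close> at \<open>P\<close>, but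
  perhaps not at the other primes above \<open>p\<close>. A multiplier from \<open>S\<close> repairs
  this and can be chosen to depend only on the class of \<open>y\<close> modulo \<open>p^k\<close>;
  the product over the finitely many classes works for all \<open>y\<close>.\<close>

lemma uniform_divisor:
  obtains c where "c \<in> S" "\<And>y. y \<in> \<O> \<Longrightarrow> vge (int (e * k)) y \<Longrightarrow> \<exists>x\<in>\<O>. c * y = of_nat p ^ k * x"
proof -
  obtain T where T: "finite T" "T \<subseteq> \<O>" "\<And>y. y \<in> \<O> \<Longrightarrow> \<exists>t\<in>T. \<exists>x\<in>\<O>. y = t + of_nat (p ^ k) * x"
    using O_finite_mod_prime_power[OF prime_p, of k] by blast
  define V where "V = {t\<in>T. vge (int (e * k)) t}"
  have val_pk: "val (of_nat p ^ k) = int (e * k)" using p_nz K_of_nat by (simp add: val_power val_p)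
  have pk: "of_nat p ^ k \<noteq> (0 :: 'a)" "of_nat p ^ k \<in> K" using p_nz K_of_nat K_power by auto
  have "\<exists>s\<in>S. \<exists>x\<in>\<O>. s * t = of_nat p ^ k * x" if "t \<in> V" for t
  proof -
    have t: "vge (int (e * k)) t" using that by (simp add: V_def)
    have "vge (0 + val (of_nat p ^ k)) (t / of_nat p ^ k * of_nat p ^ k)" using t pk val_pk by simp
    hence "vge 0 (t / of_nat p ^ k)" using pk t vge_K K_divide vge_cancel by blast
    then obtain s where "s \<in> S" "s * (t / of_nat p ^ k) \<in> \<O>" by (auto simp: vge_0_iff)
    thus ?thesis using pk by (intro bexI[of _ s] bexI[of _ "s * (t / of_nat p ^ k)"]) auto
  qed
  then obtain s where s: "\<And>t. t \<in> V \<Longrightarrow> s t \<in> S \<and> (\<exists>x\<in>\<O>. s t * t = of_nat p ^ k * x)" by metis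
  define c where "c = (\<Prod>t\<in>V. s t)"
  have finV: "finite V" using T by (simp add: V_def)
  show ?thesis
  proof (rule that[of c])
    show cS: "c \<in> S" unfolding c_def using s by (intro S_prod) auto
    fix y assume y: "y \<in> \<O>" "vge (int (e * k)) y"
    obtain t x where t: "t \<in> T" "x \<in> \<O>" "y = t + of_nat p ^ k * x" using T(3)[OF y(1)] by auto
    have "vge (int (e * k) + 0) (of_nat p ^ k * x)"
      using t pk val_pk by (intro vge_mult vge_O) (auto simp: vge_def)
    hence "vge (int (e * k)) (y - of_nat p ^ k * x)" using y(2) vge_diff by simp
    hence tV: "t \<in> V" using t by (simp add: V_def)
    obtain x' where x': "x' \<in> \<O>" "s t * t = of_nat p ^ k * x'" using s[OF tV] by blast
    define c1 where "c1 = (\<Prod>t\<in>V-{t}. s t)"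
    have c1: "c1 \<in> \<O>" using s S_O by (auto simp: c1_def intro!: O_prod)
    have "c = s t * c1" unfolding c_def c1_def using finV tV by (rule prod.remove)
    hence "c * y = c1 * (s t * t) + of_nat p ^ k * (c * x)" by (simp add: t algebra_simps)
    also have "\<dots> = of_nat p ^ k * (c1 * x' + c * x)" unfolding x' by (simp add: algebra_simps)
    finally show "\<exists>x\<in>\<O>. c * y = of_nat p ^ k * x"
      using c1 x' S_O[OF cS] t(2) by (blast intro: O_add O_mult)
  qed
qed

lemma int_valued_exists:
  assumes gal: "galois_over_Q K" and tame: "\<not> p dvd e"
  obtains f t where "f \<in> Int_Q K" "Polynomial.degree f \<le> n" "\<not> int p dvd t"
    "Polynomial.coeff f n = of_int t / of_nat p ^ (w q n div e)"
proof -
  define k where "k = w q n div e"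
  obtain c where c: "c \<in> S" "\<And>y. y \<in> \<O> \<Longrightarrow> vge (int (e * k)) y \<Longrightarrow> \<exists>x\<in>\<O>. c * y = of_nat p ^ k * x"
    using uniform_divisor by blast
  obtain \<beta> where b: "\<beta> \<in> \<O>" "trace (c * \<beta>) \<notin> P" using trace_notin_P[OF card_inertia[OF tame] c(1)] by blast
  have cO: "c \<in> \<O>" using c S_O by blast
  have pk: "of_nat p ^ k \<noteq> (0 :: 'a)" "of_nat p ^ k \<in> K" using p_nz K_of_nat K_power by auto
  define h where "h = newton n n"
  define \<gamma> where "\<gamma> = c * \<beta> / of_nat p ^ k"
  have gK: "\<gamma> \<in> K" using cO b pk by (auto simp: \<gamma>_def O_K intro!: K_divide K_mult)
  have hK: "Polynomial.coeff h i \<in> K" for i using coeff_newton_O O_K by (simp add: h_def)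
  have gh: "\<gamma> * poly h y \<in> \<O>" if y: "y \<in> \<O>" for y
  proof -
    have "vge (int (w q n)) (poly h y)" using vge_prod_sq[OF _ y, of n n] by (simp add: h_def poly_newton)
    moreover have "e * k \<le> w q n" by (simp add: k_def)
    ultimately have "vge (int (e * k)) (poly h y)" by (rule vge_mono[OF _ of_nat_mono])
    moreover have "poly h y \<in> \<O>" using y sq_O by (auto simp: h_def poly_newton intro!: O_prod O_diff)
    ultimately obtain x where x: "x \<in> \<O>" "c * poly h y = of_nat p ^ k * x" using c(2) by blast
    have "\<gamma> * poly h y = \<beta> * (c * poly h y) / of_nat p ^ k" by (simp add: \<gamma>_def)
    also have "\<dots> = \<beta> * x" unfolding x using p_pos by simp
    finally show ?thesis using x b O_mult by simp
  qed
  have "\<exists>r. of_rat r = trace (\<gamma> * Polynomial.coeff h i)" for i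
    using trace_Rats[OF gal, of "\<gamma> * Polynomial.coeff h i"] gK hK K_mult by (metis Rats_cases)
  then obtain r where r: "\<And>i. of_rat (r i) = trace (\<gamma> * Polynomial.coeff h i)" by metis
  define f where "f = (\<Sum>i\<le>n. Polynomial.monom (r i) i)"
  have cf: "Polynomial.coeff f i = (if i \<le> n then r i else 0)" for i
    by (simp add: f_def coeff_sum)
  have deg: "Polynomial.degree f \<le> n" by (rule degree_le) (simp add: cf)
  have "f \<in> Int_Q K" unfolding Int_Q_def
  proof (intro CollectI ballI)
    fix x assume x: "x \<in> \<O>"
    have "poly (map_poly of_rat f) x = (\<Sum>i\<le>n. of_rat (r i) * x ^ i)"
      using deg by (subst poly_eq_sum_atMost[of _ n]) (auto simp: degree_map_poly coeff_map_poly cf)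
    also have "\<dots> = (\<Sum>\<sigma>\<in>G. \<Sum>i\<le>n. \<sigma> (\<gamma> * Polynomial.coeff h i) * x ^ i)"
      by (simp add: r trace_def sum_distrib_right) (rule sum.swap)
    also have "\<dots> \<in> \<O>"
    proof (rule O_sum)
      fix \<sigma> assume s: "\<sigma> \<in> G"
      \<comment> \<open>The conjugate polynomial at \<open>\<sigma> y\<close> takes the conjugate of
        the value at \<open>y\<close>. As \<open>\<sigma>\<close> permutes \<open>\<O>\<close>,
        every conjugate of \<open>\<gamma> h\<close> maps \<open>\<O>\<close> into itself, and so
        does their sum.\<close>
      obtain y where y: "y \<in> \<O>" "x = \<sigma> y" using G_surj_O[OF s x] by blast
      have yK: "y \<in> K" using y O_K by blast
      have "(\<Sum>i\<le>n. \<sigma> (\<gamma> * Polynomial.coeff h i) * x ^ i) = \<sigma> (\<Sum>i\<le>n. \<gamma> * Polynomial.coeff h i * y ^ i)"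
        using s yK gK hK by (simp add: y(2) G_sum K_mult K_power G_mult G_power)
      also have "(\<Sum>i\<le>n. \<gamma> * Polynomial.coeff h i * y ^ i) = \<gamma> * poly h y"
        using degree_newton[of n n] 
        by (subst poly_eq_sum_atMost[of h n]) (auto simp: h_def sum_distrib_left mult.assoc)
      finally show "(\<Sum>i\<le>n. \<sigma> (\<gamma> * Polynomial.coeff h i) * x ^ i) \<in> \<O>"
        using G_O[OF s gh[OF y(1)]] by simp
    qed
    finally show "poly (map_poly of_rat f) x \<in> \<O>" .
  qed
  moreover have tO: "trace (c * \<beta>) \<in> \<O>" using cO b O_mult trace_O by blast
  have "trace (c * \<beta>) \<in> \<rat>" using trace_Rats[OF gal] cO b O_mult O_K by blast
  then obtain t where t: "trace (c * \<beta>) = of_int t" using O_Rats[OF tO] by (auto elim: Ints_cases)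
  have "\<not> int p dvd t" using b(2) unfolding t of_int_in_P_iff .
  moreover have "Polynomial.coeff f n = of_int t / of_nat p ^ k"
  proof -
    have "of_rat (Polynomial.coeff f n) = trace (c * \<beta> / of_nat p ^ k)"
      using monic_newton[of n n] by (simp add: cf r h_def \<gamma>_def)
    also have "\<dots> = trace (c * \<beta>) / of_nat p ^ k"
      unfolding trace_def sum_divide_distrib
      using cO b O_K K_mult pk(2) by (intro sum.cong refl) (simp add: G_divide G_power K_of_nat G_of_nat)
    also have "\<dots> = of_rat (of_int t / of_nat p ^ k)" by (simp add: t of_rat_divide of_rat_power)
    finally show ?thesis by (simp only: of_rat_eq_iff)
  qed
  ultimately show ?thesis using that deg unfolding k_def by blast
qed

end

subsection \<open>Denominators of a regular basis\<close>

context number_field_on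
begin

text \<open>An ideal containing \<open>p\<close> is determined by its intersection with a finite set
  of representatives modulo \<open>p\<close>. So there are finitely many, and a maximal proper one
  is prime. This gives the choice in \<open>chosen_prime\<close> its meaning.\<close>

lemma prime_above_exists:
  assumes p: "Factorial_Ring.prime (p::nat)"
  shows "\<exists>P. prime_ideal_above K p P"
proof -
  obtain T where T: "finite T" "T \<subseteq> \<O>" "\<And>y. y \<in> \<O> \<Longrightarrow> \<exists>t\<in>T. \<exists>z\<in>\<O>. y = t + of_nat p * z"
    using O_finite_mod_prime[OF p] by blast
  define A where "A = {I. ideal I (OK K) \<and> of_nat p \<in> I \<and> 1 \<notin> I}"
  have A_D: "I \<subseteq> \<O>" "0 \<in> I" "\<And>x y. x \<in> I \<Longrightarrow> y \<in> I \<Longrightarrow> x + y \<in> I" "\<And>x y. x \<in> \<O> \<Longrightarrow> y \<in> I \<Longrightarrow> x * y \<in> I"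
      "of_nat p \<in> I" "1 \<notin> I" if "I \<in> A" for I
    using that by (auto simp: A_def OK_ideal_iff)
  have T_det: "I = {y\<in>\<O>. \<exists>t\<in>I \<inter> T. \<exists>z\<in>\<O>. y = t + of_nat p * z}" if I: "I \<in> A" for I
  proof (intro equalityI subsetI)
    fix y assume y: "y \<in> I"
    then obtain t z where t: "t \<in> T" "z \<in> \<O>" "y = t + of_nat p * z" using T(3) A_D(1)[OF I] by blast
    have "y + (- z) * of_nat p \<in> I" by (rule A_D(3)[OF I y A_D(4)[OF I O_uminus[OF t(2)] A_D(5)[OF I]]])
    hence "t \<in> I" using t(3) by (simp add: algebra_simps)
    thus "y \<in> {y\<in>\<O>. \<exists>t\<in>I \<inter> T. \<exists>z\<in>\<O>. y = t + of_nat p * z}" using t y A_D(1)[OF I] by blast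
  next
    fix y assume "y \<in> {y\<in>\<O>. \<exists>t\<in>I \<inter> T. \<exists>z\<in>\<O>. y = t + of_nat p * z}"
    then obtain t z where t: "t \<in> I" "z \<in> \<O>" "y = t + z * of_nat p" by (auto simp: mult.commute)
    thus "y \<in> I" using A_D(3-5)[OF I] by blast
  qed
  have "inj_on (\<lambda>I. I \<inter> T) A"
  proof (rule inj_onI)
    fix I I' assume "I \<in> A" "I' \<in> A" and eq: "I \<inter> T = I' \<inter> T"
    thus "I = I'" 
      by (intro trans[OF T_det[of I] trans[OF _ T_det[of I', symmetric]]]) (simp_all only: eq)
  qed
  moreover have "(\<lambda>I. I \<inter> T) ` A \<subseteq> Pow T" by blast
  ultimately have "finite A" using T(1) by (meson finite_Pow_iff finite_imageD finite_subset)
  moreover have "{x * of_nat p | x. x \<in> \<O>} \<in> A"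
  proof -
    have "PIdl\<^bsub>OK K\<^esub> (of_nat p) = {x * of_nat p | x. x \<in> \<O>}" by (simp add: cgenideal_def)
    moreover have "ideal (PIdl\<^bsub>OK K\<^esub> (of_nat p)) (OK K)"
      using OK_cring by (rule cring.cgenideal_ideal) (simp add: O_of_nat)
    moreover have "x * of_nat p \<noteq> 1" if "x \<in> \<O>" for x
    proof
      assume *: "x * of_nat p = 1"
      have "p \<noteq> 0" using * by (intro notI) simp
      hence "x = of_rat (1 / of_nat p)" using * by (simp add: of_rat_divide field_simps)
      hence "x \<in> \<int>" using O_Rats that by simp
      then obtain k where "x = of_int k" by (auto elim: Ints_cases)
      hence "of_int (k * int p) = (of_int 1 :: 'a)" using * by simp
      hence "k * int p = 1" by (simp only: of_int_eq_iff)
      thus False using p by (metis dvd_triv_right int_dvd_int_iff nat_dvd_1_iff_1 not_prime_1 of_nat_1)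
    qed
    moreover have "\<exists>x. of_nat p = x * of_nat p \<and> x \<in> \<O>" using O_1 by (intro exI[of _ 1]) auto
    ultimately show ?thesis unfolding A_def by fastforce
  qed
  ultimately obtain M where M: "M \<in> A" "\<And>I. I \<in> A \<Longrightarrow> M \<subseteq> I \<Longrightarrow> I = M"
    using finite_has_maximal[of A] by blast
  note D = A_D[OF M(1)]
  have bigger: "\<exists>m\<in>M. \<exists>a\<in>\<O>. 1 = m + a * x" if x: "x \<in> \<O>" "x \<notin> M" for x
  proof (rule ccontr)
    assume *: "\<not> ?thesis"
    define I where "I = {m + a * x | m a. m \<in> M \<and> a \<in> \<O>}"
    have "ideal I (OK K)" unfolding OK_ideal_iff
    proof (intro conjI ballI)
      show "I \<subseteq> \<O>" using D(1) x by (auto simp: I_def intro!: O_add O_mult)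
      have "0 + 0 * x \<in> I" using D(2) O_0 unfolding I_def by blast
      thus "0 \<in> I" by simp
      fix y y' assume "y \<in> I" "y' \<in> I"
      then obtain m a m' a' where y: "m \<in> M" "a \<in> \<O>" "m' \<in> M" "a' \<in> \<O>" "y = m + a * x" "y' = m' + a' * x"
        unfolding I_def by blast
      have "y + y' = (m + m') + (a + a') * x" by (simp add: y algebra_simps)
      thus "y + y' \<in> I" unfolding I_def using y D(3) O_add by blast
    next
      fix b y assume "b \<in> \<O>" "y \<in> I"
      then obtain m a where y: "m \<in> M" "a \<in> \<O>" "y = m + a * x" unfolding I_def by blast
      have "b * y = b * m + (b * a) * x" by (simp add: y algebra_simps)
      thus "b * y \<in> I" unfolding I_def using y D(4) O_mult \<open>b \<in> \<O>\<close> by blast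
    qed
    moreover have MI: "M \<subseteq> I"
    proof
      fix m assume "m \<in> M"
      hence "m + 0 * x \<in> I" unfolding I_def using O_0 by blast
      thus "m \<in> I" by simp
    qed
    moreover have "1 \<notin> I" using * by (auto simp: I_def)
    ultimately have "I \<in> A" using D(5) by (auto simp: A_def)
    moreover have "0 + 1 * x \<in> I" unfolding I_def using D(2) O_1 by blast
    ultimately show False using M(2)[OF _ MI] x by auto
  qed
  have "primeideal M (OK K)" unfolding OK_primeideal_iff
  proof (intro conjI ballI impI)
    fix x y assume xy: "x \<in> \<O>" "y \<in> \<O>" "x * y \<in> M"
    show "x \<in> M \<or> y \<in> M"
    proof (rule ccontr)
      assume "\<not> (x \<in> M \<or> y \<in> M)"
      then obtain m a m' a' where *: "m \<in> M" "a \<in> \<O>" "m' \<in> M" "a' \<in> \<O>" "1 = m + a * x" "1 = m' + a' * y"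
        using bigger xy by metis
      have "1 = (m + a * x) * (m' + a' * y)" by (simp only: *(5,6)[symmetric] mult_1)
      hence "1 = (m' + a' * y) * m + ((a * x) * m' + (a * a') * (x * y))" by (simp add: algebra_simps)
      moreover have "(m' + a' * y) * m \<in> M" using * xy D(1) by (intro D(4) O_add O_mult) auto
      moreover have "(a * x) * m' \<in> M" "(a * a') * (x * y) \<in> M" using * xy by (auto intro!: D(4) O_mult)
      ultimately show False using D(3,6) by metis
    qed
  qed (use M(1) in \<open>auto simp: A_def\<close>)
  moreover have "M \<inter> \<int> = range (\<lambda>k::int. of_int (int p * k))"
  proof (intro equalityI subsetI)
    fix x assume "x \<in> range (\<lambda>k::int. of_int (int p * k) :: 'a)"
    then obtain k :: int where k: "x = of_int k * of_nat p" by (auto simp: mult.commute)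
    thus "x \<in> M \<inter> \<int>" using D(4)[OF O_of_int D(5)] by auto
  next
    fix x assume "x \<in> M \<inter> \<int>"
    then obtain k where k: "x = of_int k" "x \<in> M" by (auto elim: Ints_cases)
    have "int p dvd k"
    proof (rule ccontr)
      assume "\<not> int p dvd k"
      hence "Rings.coprime (int p) k" using p by (intro prime_imp_coprime) auto
      hence "gcd (int p) k = 1" by (simp add: coprime_iff_gcd_eq_1)
      then obtain a b where "a * int p + b * k = 1" using bezout_int[of "int p" k] by metis
      hence "(of_int (a * int p + b * k) :: 'a) = 1" by simp
      hence "of_int a * of_nat p + of_int b * x = 1" by (simp add: k)
      moreover have "of_int a * of_nat p + of_int b * x \<in> M" using k D(5) by (intro D(3,4) O_of_int)
      ultimately show False using D(6) by simp
    qed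
    thus "x \<in> range (\<lambda>k::int. of_int (int p * k))" using k by (auto simp: dvd_def)
  qed
  ultimately show ?thesis unfolding prime_ideal_above_def by blast
qed

lemma chosen_prime_above: "Factorial_Ring.prime p \<Longrightarrow> prime_above K p (chosen_prime K p)"
  using someI_ex[OF prime_above_exists] unfolding chosen_prime_def
  by unfold_locales blast+

lemma \<omega>_eq:
  assumes "Factorial_Ring.prime p"
  shows "\<omega> K p n = w (prime_above.q K (chosen_prime K p)) n div prime_above.e K p (chosen_prime K p)"
    "e_at K p = prime_above.e K p (chosen_prime K p)"
proof -
  interpret prime_above K p "chosen_prime K p" by (rule chosen_prime_above[OF assms])
  show "\<omega> K p n = w q n div e" "e_at K p = e"
    by (simp_all add: \<omega>_def q_at_def e_at_def q_def ramification_index_eq)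
qed

text \<open>For \<open>n < p\<close> also \<open>n < q\<close>, and every term of
  \<open>w q n\<close> is 0. Hence the product in \<open>denom\<close> is over a finite set and its
  prime exponents can be read off.\<close>

lemma \<omega>_nonzero_le:
  assumes "Factorial_Ring.prime p" "\<omega> K p n \<noteq> 0"
  shows "p \<le> n"
proof (rule ccontr)
  assume "\<not> p \<le> n"
  interpret prime_above K p "chosen_prime K p" by (rule chosen_prime_above[OF assms(1)])
  have "n < q" using \<open>\<not> p \<le> n\<close> p_le_q by simp
  have "n div q ^ k = 0" if "k \<ge> 1" for k
  proof -
    have "q ^ 1 \<le> q ^ k" using that q_ge_2 by (intro power_increasing) auto
    thus ?thesis using \<open>n < q\<close> by simp
  qed
  hence "w q n = 0" using w_eq_sum[OF q_ge_2 order_refl, of n] by simp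
  thus False using assms(2) \<omega>_eq(1)[OF assms(1)] by simp
qed

lemma denom_pos: "denom K n > 0"
  unfolding denom_def by (intro prod_pos) (auto simp: prime_gt_0_nat)

lemma multiplicity_denom:
  assumes "Factorial_Ring.prime (p::nat)"
  shows "multiplicity p (denom K n) = \<omega> K p n"
proof -
  have "finite {p. Factorial_Ring.prime p \<and> \<omega> K p n \<noteq> 0}"
    by (rule finite_subset[of _ "{..n}"]) (auto dest: \<omega>_nonzero_le)
  thus ?thesis unfolding denom_def using assms by (subst multiplicity_prod_prime_powers) auto
qed

text \<open>The reduced denominator \<open>b\<close> divides \<open>denom K n\<close> as soon as it
  does so at each prime \<open>p\<close>, and there the bound from a single prime ideal above
  \<open>p\<close> suffices.\<close>

lemma denom_smult_int:
  assumes "f \<in> Int_Q K" "Polynomial.degree f \<le> n"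
  shows "of_nat (denom K n) * Polynomial.coeff f i \<in> \<int>"
proof -
  obtain a b where ab: "Polynomial.coeff f i = of_int a / of_int b" "Rings.coprime a b" "b > 0"
    by (metis quotient_of_div quotient_of_coprime quotient_of_denom_pos prod.collapse)
  have "b dvd int (denom K n)"
  proof (rule multiplicity_le_imp_dvd)
    fix p' :: int assume "Factorial_Ring.prime p'"
    then obtain p where p: "p' = int p" "Factorial_Ring.prime p"
      by (metis prime_int_nat_transfer prime_ge_0_int nat_0_le)
    interpret prime_above K p "chosen_prime K p" by (rule chosen_prime_above[OF p(2)])
    have "multiplicity p' b \<le> \<omega> K p n"
      using int_valued_coeff_multiplicity[OF assms ab(1,2)] ab(3) \<omega>_eq(1)[OF p(2)] p by simp
    also have "\<omega> K p n \<le> multiplicity p' (int (denom K n))"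
    proof (rule multiplicity_geI)
      have "p ^ \<omega> K p n dvd denom K n"
        using multiplicity_dvd[of p "denom K n"] multiplicity_denom[OF p(2)] by simp
      thus "p' ^ \<omega> K p n dvd int (denom K n)" by (simp add: p(1) flip: of_nat_power)
    qed (use denom_pos p in \<open>auto simp: prime_nat_iff\<close>)
    finally show "multiplicity p' b \<le> multiplicity p' (int (denom K n))" .
  qed (use ab denom_pos in auto)
  then obtain k where "int (denom K n) = b * k" by blast
  hence "(of_nat (denom K n) :: rat) = of_int b * of_int k" by (metis of_int_mult of_int_of_nat_eq)
  thus ?thesis using ab by simp
qed

end

interpretation int_poly_module: Modules.module "\<lambda>k::int. smult (rat_of_int k)"
  by unfold_locales (auto simp: smult_add_left smult_add_right)

text \<open>The degrees in the basis are distinct, so terms of index above \<open>n\<close> cannot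
  cancel and must have coefficient 0, while terms of index below \<open>n\<close> do not reach the
  \<open>n\<close>-th power.\<close>

lemma regular_basis_coeff:
  assumes deg: "\<And>n. Polynomial.degree (f n) = n"
    and h: "h \<in> int_poly_module.span (range f)" "Polynomial.degree h \<le> n"
  shows "\<exists>k::int. Polynomial.coeff h n = of_int k * Polynomial.coeff (f n) n"
proof -
  have "\<exists>M (k :: nat \<Rightarrow> int). h = (\<Sum>m\<le>M. smult (of_int (k m)) (f m))"
    using h(1)
  proof (induction rule: int_poly_module.span_induct_alt)
    case base
    show ?case by (intro exI[of _ 0] exI[of _ "\<lambda>_. 0"]) auto
  next
    case (step c x y)
    then obtain m M and k :: "nat \<Rightarrow> int" where *: "x = f m" "y = (\<Sum>m\<le>M. smult (of_int (k m)) (f m))" by blast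
    define k' where "k' i = (if i \<le> M then k i else 0) + (if i = m then c else 0)" for i
    have "(\<Sum>i\<le>max m M. smult (of_int (k' i)) (f i)) = 
        (\<Sum>i\<le>max m M. if i \<le> M then smult (of_int (k i)) (f i) else 0) + 
        (\<Sum>i\<le>max m M. if i = m then smult (of_int c) (f i) else 0)"
      unfolding sum.distrib[symmetric] by (intro sum.cong) (auto simp: k'_def smult_add_left)
    also have "(\<Sum>i\<le>max m M. if i \<le> M then smult (of_int (k i)) (f i) else 0) = y"
      unfolding * by (intro sum.mono_neutral_cong_right) auto
    also have "(\<Sum>i\<le>max m M. if i = m then smult (of_int c) (f i) else 0) = smult (of_int c) x"
      by (simp add: *)
    finally show ?case by (metis add.commute)
  qed
  then obtain M and k :: "nat \<Rightarrow> int" where "h = (\<Sum>m\<le>M. smult (of_int (k m)) (f m))" by blast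
  thus ?thesis using h(2)
  proof (induction M)
    case 0
    show ?case
    proof (cases "n = 0")
      case True
      then show ?thesis using 0 by auto
    next
      case False
      then show ?thesis using 0 deg[of 0] by (intro exI[of _ 0]) (simp add: coeff_eq_0)
    qed
  next
    case (Suc M)
    have lower: "Polynomial.coeff (\<Sum>m\<le>M. smult (of_int (k m)) (f m)) (Suc M) = 0"
      using deg by (auto simp: coeff_sum intro!: sum.neutral coeff_eq_0)
    consider "Suc M < n" | "Suc M = n" | "Suc M > n" by linarith
    then show ?case
    proof cases
      case 1
      have "Polynomial.coeff (f m) n = 0" if "m < n" for m using that deg by (intro coeff_eq_0) simp
      hence "Polynomial.coeff h n = 0" unfolding Suc.prems(1) coeff_sum using 1 by (intro sum.neutral) auto
      then show ?thesis by (intro exI[of _ 0]) simp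
    next
      case 2
      then show ?thesis using Suc.prems(1) lower by (intro exI[of _ "k n"]) auto
    next
      case 3
      hence "Polynomial.coeff h (Suc M) = 0" using Suc.prems(2) by (intro coeff_eq_0) simp
      hence "of_int (k (Suc M)) * Polynomial.coeff (f (Suc M)) (Suc M) = 0"
        using Suc.prems(1) lower by simp
      moreover have "Polynomial.coeff (f (Suc M)) (Suc M) \<noteq> 0"
        using deg[of "Suc M"] by (metis leading_coeff_0_iff degree_0 nat.distinct(1))
      ultimately show ?thesis using Suc by simp
    qed
  qed
qed

text \<open>Replacing \<open>f n\<close> by its negative again gives a basis of the same kind, so
  the numerator can be monic only up to the sign \<open>\<epsilon>\<close>.\<close>

theorem theorem1p2:
  fixes K :: "'a::field_char_0 set" and f :: "nat \<Rightarrow> rat poly"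
  assumes "number_field K" and "galois_over_Q K" and "tamely_ramified K"
    and "Z_basis f (Int_Q K)" and "\<forall>n. Polynomial.degree (f n) = n"
  shows "\<forall>n. \<exists>(g :: int poly) (\<epsilon> :: rat).
           Polynomial.lead_coeff g = 1 \<and> \<epsilon> \<in> {1, -1} \<and>
           f n = smult (\<epsilon> / rat_of_nat (denom K n)) (map_poly rat_of_int g)"
proof
  fix n
  interpret number_field_on K using assms(1) by unfold_locales
  define D where "D = denom K n"
  have D: "D > 0" using denom_pos by (simp add: D_def)
  have span: "int_poly_module.span (range f) = Int_Q K" using assms(4) by (simp add: Z_basis_def)
  have fn: "f n \<in> Int_Q K" using int_poly_module.span_base[of "f n" "range f"] span by auto
  have deg: "Polynomial.degree (f n) = n" using assms(5) by simp
  have "\<exists>c. of_nat D * Polynomial.coeff (f n) i = of_int c" for i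
    using denom_smult_int[OF fn, of n i] deg unfolding D_def by (auto elim!: Ints_cases)
  then obtain c where c: "\<And>i. of_nat D * Polynomial.coeff (f n) i = of_int (c i)" by metis
  have not_dvd: "\<not> int p dvd c n" if p: "Factorial_Ring.prime p" for p
  proof
    assume dvd: "int p dvd c n"
    interpret prime_above K p "chosen_prime K p" by (rule chosen_prime_above[OF p])
    have tame: "\<not> p dvd e" using assms(3) p \<omega>_eq(2)[OF p] unfolding tamely_ramified_def by metis
    obtain h t where h: "h \<in> Int_Q K" "Polynomial.degree h \<le> n" "\<not> int p dvd t"
        "Polynomial.coeff h n = of_int t / of_nat p ^ (w q n div e)"
      using int_valued_exists[OF assms(2) tame] by blast
    define v where "v = w q n div e"
    have v: "v = \<omega> K p n" using \<omega>_eq(1)[OF p] by (simp add: v_def)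
    obtain k where k: "Polynomial.coeff h n = of_int k * Polynomial.coeff (f n) n"
      using regular_basis_coeff[of f h n] assms(5) h(1,2) span by blast
    \<comment> \<open>\<open>h\<close> attains the exponent \<open>v\<close> at \<open>p\<close>,
      and its coefficient is an integer multiple of that of \<open>f n\<close>. If \<open>p\<close>
      divided \<open>c n\<close>, then \<open>denom K n\<close> would be divisible by
      \<open>p^(v+1)\<close>.\<close>
    have "of_int (t * int D) = of_nat p ^ v * Polynomial.coeff h n * of_nat D"
      using h(4) p_pos by (simp add: v_def)
    also have "\<dots> = of_nat p ^ v * of_int k * (of_nat D * Polynomial.coeff (f n) n)" by (simp add: k)
    also have "\<dots> = (of_int (int p ^ v * k * c n) :: rat)" by (simp add: c)
    finally have eq: "t * int D = int p ^ v * k * c n" by (simp only: of_int_eq_iff)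
    have "int p ^ v * int p dvd int p ^ v * k * c n" using dvd by (simp add: mult.assoc mult_dvd_mono)
    hence "int p ^ Suc v dvd t * int D" by (simp add: eq mult.commute)
    moreover have "Rings.coprime (int p) t" using p h(3) by (intro prime_imp_coprime) auto
    ultimately have "int p ^ Suc v dvd int D" by (simp add: coprime_dvd_mult_right_iff del: power_Suc)
    hence "p ^ Suc v dvd D" by (metis int_dvd_int_iff of_nat_power)
    hence "Suc v \<le> multiplicity p D" using D p by (intro multiplicity_geI) auto
    thus False using multiplicity_denom[OF p] v by (simp add: D_def)
  qed
  have unit: "c n = 1 \<or> c n = - 1"
  proof (rule ccontr)
    assume *: "\<not> ?thesis"
    show False
    proof (cases "c n = 0")
      case True
      \<comment> \<open>Any prime divides 0; the prime 2 serves as the witness.\<close>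
      then show False using not_dvd[OF two_is_prime_nat] by simp
    next
      case False
      moreover have "\<bar>c n\<bar> \<noteq> 1" using * by linarith
      ultimately obtain p' where p': "p' dvd c n" "Factorial_Ring.prime p'"
        using prime_divisor_exists[of "c n"] by auto
      have "0 \<le> p'" "Factorial_Ring.prime (nat p')" using p'(2) prime_int_nat_transfer by blast+
      thus False using not_dvd[of "nat p'"] p'(1) by simp
    qed
  qed
  \<comment> \<open>This is \<open>D\<close> times \<open>f n\<close>, multiplied by the sign
    \<open>c n\<close> so that the leading coefficient becomes \<open>c n * c n = 1\<close>.\<close>
  define g where "g = (\<Sum>i\<le>n. Polynomial.monom (c n * c i) i)"
  have cg: "Polynomial.coeff g i = (if i \<le> n then c n * c i else 0)" for i
    by (simp add: g_def coeff_sum)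
  have cn: "c n * c n = 1" using unit by auto
  have "Polynomial.degree g = n"
  proof (rule antisym)
    show "Polynomial.degree g \<le> n" by (rule degree_le) (simp add: cg)
    show "n \<le> Polynomial.degree g" by (rule le_degree) (simp add: cg cn)
  qed
  hence "Polynomial.lead_coeff g = 1" by (simp add: cg cn)
  moreover have "rat_of_int (c n) \<in> {1, -1}" using unit by auto
  moreover have "f n = smult (of_int (c n) / rat_of_nat D) (map_poly rat_of_int g)"
  proof (rule poly_eqI)
    fix i
    show "Polynomial.coeff (f n) i = Polynomial.coeff (smult (of_int (c n) / rat_of_nat D) (map_poly rat_of_int g)) i"
    proof (cases "i \<le> n")
      case True
      have "Polynomial.coeff (f n) i = of_nat D * Polynomial.coeff (f n) i / of_nat D" using D by simp
      also have "\<dots> = of_int (c n * c n * c i) / of_nat D" by (simp only: c cn mult_1)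
      finally show ?thesis using True by (simp add: coeff_map_poly cg)
    next
      case False
      thus ?thesis using deg by (simp add: coeff_map_poly cg coeff_eq_0)
    qed
  qed
  ultimately show "\<exists>(g :: int poly) (\<epsilon> :: rat).
           Polynomial.lead_coeff g = 1 \<and> \<epsilon> \<in> {1, -1} \<and>
           f n = smult (\<epsilon> / rat_of_nat (denom K n)) (map_poly rat_of_int g)"
    unfolding D_def by blast
qed

end
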